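(* Assume that $0<\varrho_0\le\beta c_h^n\le\varrho<1$ and that the parameters $\gamma,\varsigma_1,\varsigma_2$ and $N$ are chosen large enough. Then the mapping $\mathcal{F}_h:c_h^{n+1,l}\mapsto c_h^{n+1,l+1}$ defined by the linear iteration described in the context is a contraction, i.e., there exists a constant $C_{con}\in(0,1)$ such that $$\frac{3C_{\phi,\min}}4\sum_{K\in\mathcal{K}_h}\|\mathcal{F}_h(c_h^{n+1,l})-\mathcal{F}_h(c_h^{n+1,l-1})\|_{L^2(K)}^2+\left(\varsigma_1C_{\mu,\min}-\frac{\varrho^2C}{\beta^2C_\lambda}\right)\sum_{e\in\mathcal{E}_h^I}\frac1{h_e}\|[\mathcal{F}_h(c_h^{n+1,l})-\mathcal{F}_h(c_h^{n+1,l-1})]\|_{L^2(e)}^2$$ $$\le C_{con}\left(\frac{3C_{\phi,\min}}4\sum_{K\in\mathcal{K}_h}\|c_h^{n+1,l}-c_h^{n+1,l-1}\|_{L^2(K)}^2+\left(\varsigma_1C_{\mu,\min}-\frac{\varrho^2C}{\beta^2C_\lambda}\right)\sum_{e\in\mathcal{E}_h^I}\frac1{h_e}\|[c_h^{n+1,l}-c_h^{n+1,l-1}]\|_{L^2(e)}^2\right),$$ where $C_\lambda$ is the lower bound of $\lambda^{-1}(\phi_h^n)$, $C_{\mu,\min}$ and $C_{\mu,\max}$ are the lower and upper bounds of $\frac{\theta_nRT}{c_h^n(1-\beta c_h^n)^2}$, respectively, $C_{\phi,\min}$ is the minimum value of $\phi_h^n$, and $C>0$ is a generic constant (coming from the discrete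 trace inequality on the mesh).
   Context: Mesh and spaces: $\mathcal{K}_h$ is a non-degenerate quasi-uniform simplicial mesh of $\Omega\subset\mathbb{R}^d$, $d\in\{2,3\}$; $\mathcal{E}_h^I$ is the set of interior edges/faces; $h_e$ is the length (2D) or area (3D) of $e$. For $e=\partial K_i\cap\partial K_j$ with unit normal $\boldsymbol n_e$ from $K_i$ to $K_j$: $[\psi]=\psi|_{K_i}-\psi|_{K_j}$, $\{\psi\}=\frac12(\psi|_{K_i}+\psi|_{K_j})$; $\boldsymbol n=\boldsymbol n_e$ in face sums. $\mathcal{V}_h$: discontinuous piecewise linear $d$-vector fields; $\mathcal{Q}_h$: piecewise constants; $\mathcal{U}_h$: lowest-order Raviart–Thomas space in $H(\mathrm{div},\Omega)$; $\mathcal{U}_h^0=\{\mathbf v\in\mathcal{U}_h:\mathbf v\cdot\boldsymbol n=0\text{ on }\partial\Omega\}$. $(\cdot,\cdot)_K$, $\langle\cdot,\cdot\rangle_e$ are $L^2$ inner products and $(\cdot,\cdot)=\sum_K(\cdot,\cdot)_K$ (derivatives elementwise). Physics: $R,T,b,\beta>0$ constants; $f(c)=cRT\ln c-cRT\ln(1-\beta c)+\frac{bc}{2\sqrt2\beta}\ln\frac{1+(1-\sqrt2)\beta c}{1+(1+\sqrt2)\beta c}$, $\mu(c)=f'(c)$. $\alpha$ is Biot's coefficient, $N>0$ Biot's modulus (a constant), $\eta,\gamma>0$ Lamé parameters, $\boldsymbol\varepsilon(\boldsymbol u)=\frac12(\nabla\boldsymbol u+\nabla\boldsymbol u^T)$,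 $\boldsymbol\sigma_e(\boldsymbol u)=2\eta\boldsymbol\varepsilon(\boldsymbol u)+\gamma(\nabla\cdot\boldsymbol u)\boldsymbol I$. Mobility $\lambda(\phi)=\kappa(\phi)/\nu$, viscosity $\nu>0$, $\kappa(\phi)=\kappa^0(\phi/\phi_r)^3\left(\frac{1-\phi_r}{1-\phi}\right)^2$, where $\kappa^0>0$ is the initial intrinsic permeability and $\phi_r$ the reference porosity; porosities take values in $(0,1)$. Boundary conditions: zero traction and $\boldsymbol u_f\cdot\boldsymbol n=0$ on $\partial\Omega$. $\varsigma_1,\varsigma_2>0$ are penalty parameters. Bilinear form: $$\mathcal{A}(\boldsymbol u,p,\mathbf v)=\sum_K(\boldsymbol\sigma_e(\boldsymbol u),\boldsymbol\varepsilon(\mathbf v))_K-\sum_{e\in\mathcal{E}_h^I}\langle\{\boldsymbol\sigma_e(\boldsymbol u)\boldsymbol n_e\},[\mathbf v]\rangle_e-\alpha\sum_K(p,\nabla\cdot\mathbf v)_K+\alpha\sum_{e\in\mathcal{E}_h^I}\langle\{p\boldsymbol n_e\},[\mathbf v]\rangle_e-\sum_{e\in\mathcal{E}_h^I}\langle[\boldsymbol u],\{\boldsymbol\sigma_e(\mathbf v)\boldsymbol n_e\}\rangle_e+\sum_{e\in\mathcal{E}_h^I}\frac{\varsigma_2}{h_e}\langle[\boldsymbol u],[\mathbf v]\rangle_e .$$ Upwinding: $c_h^{n*}=c_h^n|_{K_i}$ if $\boldsymbol u_{f,h}^n\cdot\boldsymbol n_e\ge0$, else $c_h^n|_{K_j}$.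 Time-level-$n$ quantities $c_h^n,\phi_h^n,p_h^n\in\mathcal{Q}_h$, $\boldsymbol u_{s,h}^n\in\mathcal{V}_h$, $\boldsymbol u_{f,h}^n\in\mathcal{U}_h$ and a time step $\tau>0$ are given. Linear iteration: given the level-$l$ iterates, find $c_h^{n+1,l+1},p_h^{n+1,l+1},\phi_h^{n+1,l+1}\in\mathcal{Q}_h$, $\boldsymbol u_{s,h}^{n+1,l+1}\in\mathcal{V}_h$, $\boldsymbol u_{f,h}^{n+1,l+1}\in\mathcal{U}_h$ (with zero normal component on $\partial\Omega$) such that for all $\mathbf v_h\in\mathcal{V}_h$, $\mathbf w_h\in\mathcal{U}_h^0$, $q_h,z_h,\varphi_h\in\mathcal{Q}_h$: (i) $\mathcal{A}(\boldsymbol u_{s,h}^{n+1,l+1},p_h^{n+1,l+1},\mathbf v_h)=0$; (ii) $\left(\frac{\phi_h^{n+1,l}c_h^{n+1,l+1}-\phi_h^nc_h^n}{\tau},q_h\right)+\sum_{e\in\mathcal{E}_h^I}\langle c_h^{n*}\boldsymbol u_{f,h}^{n+1,l}\cdot\boldsymbol n,[q_h]\rangle_e+\sum_{e\in\mathcal{E}_h^I}\frac{\varsigma_1}{h_e}\langle[\mu_h^{n+1,l+1}],[q_h]\rangle_e=0$; (iii) $(\lambda^{-1}(\phi_h^n)\boldsymbol u_{f,h}^{n+1,l+1},\mathbf w_h)=\sum_{e\in\mathcal{E}_h^I}\langle[\mu_h^{n+1,l+1}],c_h^{n*}\mathbf w_h\cdot\boldsymbol n\rangle_e$; (iv) $(p_h^{n+1,l+1},z_h)=(c_h^n\mu_h^{n+1,l+1}-f(c_h^n),z_h)$;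 (v) $(\phi_h^{n+1,l+1}-\phi_h^n,\varphi_h)=\frac1N(p_h^{n+1,l+1}-p_h^n,\varphi_h)+\alpha(\nabla\cdot(\boldsymbol u_{s,h}^{n+1,l+1}-\boldsymbol u_{s,h}^n),\varphi_h)-\alpha\sum_{e\in\mathcal{E}_h^I}\langle\{\varphi_h\boldsymbol n_e\},[\boldsymbol u_{s,h}^{n+1,l+1}-\boldsymbol u_{s,h}^n]\rangle_e$; where $\mu_h^{n+1,l+1}=\mu(c_h^n)+\theta_nRT\frac{c_h^{n+1,l+1}-c_h^n}{c_h^n(1-\beta c_h^n)^2}$, $\theta_n=\max_{K}\left\{1,\frac{(1-\beta c_h^n)^2}{\chi_1^n(1-\chi_1^n\beta c_h^n)^2},\frac{(1-\beta c_h^n)^2}{\chi_2^n(1-\chi_2^n\beta c_h^n)^2}\right\}$, $\chi_1^n=1-\delta_1(1-\beta c_h^n)^2$, $\chi_2^n=1+\delta_2(1-\beta c_h^n)^2$, $\delta_1,\delta_2\in(0,1)$ fixed. The map $\mathcal{F}_h$ sends $c_h^{n+1,l}$ (which determines $\mu_h^{n+1,l},p_h^{n+1,l},\boldsymbol u_{s,h}^{n+1,l},\boldsymbol u_{f,h}^{n+1,l},\phi_h^{n+1,l}$ through (i),(iii)–(v) at level $l$) to the solution $c_h^{n+1,l+1}$ of (ii).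
   Formalization: The level-l porosities are assumed to lie in [m,1) for a fixed arbitrary m in (0,1), not merely in (0,1), since the contraction fails as porosity tends to 0; "large enough" means thresholds chosen in the order ς1, N, γ, ς2, and they may depend on m, the mesh and the level-n data. *)

theory Defs
  imports "HOL-Analysis.Analysis"
begin

section \<open>Simplicial meshes and face integrals\<close>

text \<open>
  Elements are closed simplices. An interior face is an ordered pair \<open>(K\<^sub>i, K\<^sub>j)\<close> of
  elements; the order is the fixed, arbitrary orientation of the face, on which the upwind
  value depends when the velocity of the old time level has zero normal component.
\<close>

type_synonym 'd elem = "(real^'d) set"
type_synonym 'd face = "'d elem \<times> 'd elem"

record ('d::finite) mesh =
  Omega :: "(real^'d) set"
  Kh :: "(real^'d) set set"
  EI :: "((real^'d) set \<times> (real^'d) set) set"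
  nrm :: "(real^'d) set \<times> (real^'d) set \<Rightarrow> real^'d"

definition face_set :: "('d::finite) face \<Rightarrow> (real^'d) set" where
  "face_set e = fst e \<inter> snd e"

definition interior_face :: "('d::finite) mesh \<Rightarrow> 'd face \<Rightarrow> bool" where
  "interior_face \<M> e \<longleftrightarrow> fst e \<in> Kh \<M> \<and> snd e \<in> Kh \<M> \<and> fst e \<noteq> snd e \<and>
     aff_dim (face_set e) = int CARD('d) - 1 \<and> \<not> face_set e \<subseteq> frontier (Omega \<M>)"

definition unit_normal :: "('d::finite) face \<Rightarrow> real^'d \<Rightarrow> bool" where
  "unit_normal e n \<longleftrightarrow> norm n = 1 \<and>
     (\<exists>s. (\<forall>x\<in>face_set e. n \<bullet> x = s) \<and> (\<forall>x\<in>fst e. n \<bullet> x \<le> s) \<and> (\<forall>x\<in>snd e. s \<le> n \<bullet> x))"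

definition simplicial_mesh :: "('d::finite) mesh \<Rightarrow> bool" where
  "simplicial_mesh \<M> \<longleftrightarrow>
     open (Omega \<M>) \<and> connected (Omega \<M>) \<and> bounded (Omega \<M>) \<and> Omega \<M> \<noteq> {} \<and>
     triangulation (Kh \<M>) \<and> (\<forall>K\<in>Kh \<M>. int CARD('d) simplex K) \<and>
     \<Union>(Kh \<M>) = closure (Omega \<M>) \<and>
     (\<forall>e\<in>EI \<M>. interior_face \<M> e \<and> unit_normal e (nrm \<M> e)) \<and>
     (\<forall>K K'. interior_face \<M> (K, K') \<longrightarrow> ((K, K') \<in> EI \<M>) \<noteq> ((K', K) \<in> EI \<M>))"

definition nondegenerate :: "real \<Rightarrow> ('d::finite) mesh \<Rightarrow> bool" where
  "nondegenerate \<sigma> \<M> \<longleftrightarrow>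
     (\<forall>K\<in>Kh \<M>. \<exists>z r. 0 < r \<and> cball z r \<subseteq> K \<and> diameter K \<le> \<sigma> * r)"

definition quasi_uniform :: "real \<Rightarrow> ('d::finite) mesh \<Rightarrow> bool" where
  "quasi_uniform \<sigma> \<M> \<longleftrightarrow> (\<forall>K\<in>Kh \<M>. \<forall>K'\<in>Kh \<M>. diameter K \<le> \<sigma> * diameter K')"

text \<open>
  Length (2D) or area (3D) measure on a flat face \<open>e\<close>: Lebesgue measure of the prism of
  height 1 erected over \<open>e\<close> in the direction of its unit normal, projected orthogonally
  back onto the hyperplane of \<open>e\<close>.
\<close>

definition face_measure :: "('d::finite) mesh \<Rightarrow> 'd face \<Rightarrow> (real^'d) measure" where
  "face_measure \<M> e =
     distr (restrict_space lborel {x + t *\<^sub>R nrm \<M> e | x t. x \<in> face_set e \<and> t \<in> {0..1}})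
       borel (closest_point (affine hull (face_set e)))"

definition h_face :: "('d::finite) mesh \<Rightarrow> 'd face \<Rightarrow> real" where
  "h_face \<M> e = measure (face_measure \<M> e) UNIV"

definition ip_elem :: "('d::finite) elem \<Rightarrow> (real^'d \<Rightarrow> 'b::euclidean_space) \<Rightarrow> (real^'d \<Rightarrow> 'b) \<Rightarrow> real" where
  "ip_elem K f g = (LINT x:K|lborel. f x \<bullet> g x)"

definition ip_face ::
  "('d::finite) mesh \<Rightarrow> 'd face \<Rightarrow> (real^'d \<Rightarrow> 'b::euclidean_space) \<Rightarrow> (real^'d \<Rightarrow> 'b) \<Rightarrow> real" where
  "ip_face \<M> e f g = (LINT x|face_measure \<M> e. f x \<bullet> g x)"


section \<open>Discontinuous spaces\<close>

text \<open>
  A broken function is a family \<open>\<psi> K\<close> of functions, one per element, extended to the whole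
  space by the same polynomial, so that \<open>\<psi> K x\<close> for \<open>x\<close> on a face of \<open>K\<close> is the trace
  from \<open>K\<close>. Piecewise constants are stored by their values. Families vanish off the mesh.
\<close>

type_synonym ('d, 'b) broken = "(real^'d) set \<Rightarrow> real^'d \<Rightarrow> 'b"

definition pc :: "(('d::finite) elem \<Rightarrow> real) \<Rightarrow> ('d, real) broken" where
  "pc q = (\<lambda>K x. q K)"

definition jump :: "('d::finite) face \<Rightarrow> ('d, 'b::real_vector) broken \<Rightarrow> real^'d \<Rightarrow> 'b" where
  "jump e \<psi> x = \<psi> (fst e) x - \<psi> (snd e) x"

definition avg :: "('d::finite) face \<Rightarrow> ('d, 'b::real_vector) broken \<Rightarrow> real^'d \<Rightarrow> 'b" where
  "avg e \<psi> x = (1/2) *\<^sub>R (\<psi> (fst e) x + \<psi> (snd e) x)"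

definition Qh :: "('d::finite) mesh \<Rightarrow> ('d elem \<Rightarrow> real) set" where
  "Qh \<M> = {q. \<forall>K. K \<notin> Kh \<M> \<longrightarrow> q K = 0}"

definition Vh :: "('d::finite) mesh \<Rightarrow> ('d, real^'d) broken set" where
  "Vh \<M> = {v. (\<forall>K\<in>Kh \<M>. \<exists>A a. \<forall>x. v K x = A *v x + a) \<and> (\<forall>K. K \<notin> Kh \<M> \<longrightarrow> v K = (\<lambda>x. 0))}"

text \<open>Conformity in \<open>H(div)\<close> is continuity of the normal component across interior faces.\<close>

definition Uh :: "('d::finite) mesh \<Rightarrow> ('d, real^'d) broken set" where
  "Uh \<M> = {w. (\<forall>K\<in>Kh \<M>. \<exists>a b. \<forall>x. w K x = a + b *\<^sub>R x) \<and> (\<forall>K. K \<notin> Kh \<M> \<longrightarrow> w K = (\<lambda>x. 0)) \<and>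
     (\<forall>e\<in>EI \<M>. \<forall>x\<in>face_set e. w (fst e) x \<bullet> nrm \<M> e = w (snd e) x \<bullet> nrm \<M> e)}"

definition Uh0 :: "('d::finite) mesh \<Rightarrow> ('d, real^'d) broken set" where
  "Uh0 \<M> = {w \<in> Uh \<M>. \<forall>K\<in>Kh \<M>. \<forall>F. F facet_of K \<and> F \<subseteq> frontier (Omega \<M>) \<longrightarrow>
     (\<forall>n. (\<forall>x\<in>F. \<forall>y\<in>F. n \<bullet> (x - y) = 0) \<longrightarrow> (\<forall>x\<in>F. w K x \<bullet> n = 0))}"


section \<open>Physical data\<close>

record phys =
  Rgas :: real
  Temp :: real
  bconst :: real
  beta :: real
  alpha :: real
  eta :: real
  nu :: real
  kappa0 :: real
  phi_ref :: real
  tau :: real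
  delta1 :: real
  delta2 :: real

definition valid_phys :: "phys \<Rightarrow> bool" where
  "valid_phys P \<longleftrightarrow> 0 < Rgas P \<and> 0 < Temp P \<and> 0 < bconst P \<and> 0 < beta P \<and> 0 < eta P \<and>
     0 < nu P \<and> 0 < kappa0 P \<and> 0 < phi_ref P \<and> phi_ref P < 1 \<and> 0 < tau P \<and>
     0 < delta1 P \<and> delta1 P < 1 \<and> 0 < delta2 P \<and> delta2 P < 1"

definition free_energy :: "phys \<Rightarrow> real \<Rightarrow> real" where
  "free_energy P c = c * Rgas P * Temp P * ln c - c * Rgas P * Temp P * ln (1 - beta P * c)
     + bconst P * c / (2 * sqrt 2 * beta P)
       * ln ((1 + (1 - sqrt 2) * beta P * c) / (1 + (1 + sqrt 2) * beta P * c))"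

definition chem_pot :: "phys \<Rightarrow> real \<Rightarrow> real" where
  "chem_pot P c = deriv (free_energy P) c"

definition permeability :: "phys \<Rightarrow> real \<Rightarrow> real" where
  "permeability P \<phi> = kappa0 P * (\<phi> / phi_ref P) ^ 3 * ((1 - phi_ref P) / (1 - \<phi>))\<^sup>2"

definition mobility :: "phys \<Rightarrow> real \<Rightarrow> real" where
  "mobility P \<phi> = permeability P \<phi> / nu P"

definition grad :: "(real^'d \<Rightarrow> real^'d) \<Rightarrow> real^'d \<Rightarrow> real^('d::finite)^'d" where
  "grad u x = jacobian u (at x)"

definition divg :: "(real^'d \<Rightarrow> real^'d) \<Rightarrow> real^('d::finite) \<Rightarrow> real" where
  "divg u x = trace (grad u x)"

definition strain :: "(real^'d \<Rightarrow> real^'d) \<Rightarrow> real^'d \<Rightarrow> real^('d::finite)^'d" where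
  "strain u x = (1/2) *\<^sub>R (grad u x + transpose (grad u x))"

definition stress :: "phys \<Rightarrow> real \<Rightarrow> (real^'d \<Rightarrow> real^'d) \<Rightarrow> real^'d \<Rightarrow> real^('d::finite)^'d" where
  "stress P \<gamma> u x = (2 * eta P) *\<^sub>R strain u x + (\<gamma> * divg u x) *\<^sub>R mat 1"

text \<open>The inner product of matrices in \<^const>\<open>ip_elem\<close> is the Frobenius product.\<close>

definition bilinA :: "('d::finite) mesh \<Rightarrow> phys \<Rightarrow> real \<Rightarrow> real \<Rightarrow>
    ('d, real^'d) broken \<Rightarrow> ('d elem \<Rightarrow> real) \<Rightarrow> ('d, real^'d) broken \<Rightarrow> real" where
  "bilinA \<M> P \<gamma> \<zeta>2 u p v =
     (\<Sum>K\<in>Kh \<M>. ip_elem K (stress P \<gamma> (u K)) (strain (v K)))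
   - (\<Sum>e\<in>EI \<M>. ip_face \<M> e (avg e (\<lambda>K x. stress P \<gamma> (u K) x *v nrm \<M> e)) (jump e v))
   - alpha P * (\<Sum>K\<in>Kh \<M>. ip_elem K (pc p K) (divg (v K)))
   + alpha P * (\<Sum>e\<in>EI \<M>. ip_face \<M> e (avg e (\<lambda>K x. p K *\<^sub>R nrm \<M> e)) (jump e v))
   - (\<Sum>e\<in>EI \<M>. ip_face \<M> e (jump e u) (avg e (\<lambda>K x. stress P \<gamma> (v K) x *v nrm \<M> e)))
   + (\<Sum>e\<in>EI \<M>. \<zeta>2 / h_face \<M> e * ip_face \<M> e (jump e u) (jump e v))"


section \<open>The linear iteration\<close>

text \<open>Quantities at the old time level \<open>n\<close>: \<open>c\<close>, \<open>\<phi>\<close>, \<open>p\<close>, \<open>u\<^sub>s\<close>, \<open>u\<^sub>f\<close>.\<close>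

record ('d::finite) state =
  c_old :: "(real^'d) set \<Rightarrow> real"
  phi_old :: "(real^'d) set \<Rightarrow> real"
  p_old :: "(real^'d) set \<Rightarrow> real"
  us_old :: "(real^'d) set \<Rightarrow> real^'d \<Rightarrow> real^'d"
  uf_old :: "(real^'d) set \<Rightarrow> real^'d \<Rightarrow> real^'d"

definition valid_state :: "('d::finite) mesh \<Rightarrow> 'd state \<Rightarrow> bool" where
  "valid_state \<M> S \<longleftrightarrow> c_old S \<in> Qh \<M> \<and> phi_old S \<in> Qh \<M> \<and> p_old S \<in> Qh \<M> \<and>
     us_old S \<in> Vh \<M> \<and> uf_old S \<in> Uh \<M> \<and> (\<forall>K\<in>Kh \<M>. 0 < phi_old S K \<and> phi_old S K < 1)"

definition c_upw :: "('d::finite) mesh \<Rightarrow> 'd state \<Rightarrow> 'd face \<Rightarrow> real^'d \<Rightarrow> real" where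
  "c_upw \<M> S e x =
     (if uf_old S (fst e) x \<bullet> nrm \<M> e \<ge> 0 then c_old S (fst e) else c_old S (snd e))"

definition chi1 :: "phys \<Rightarrow> real \<Rightarrow> real" where
  "chi1 P c = 1 - delta1 P * (1 - beta P * c)\<^sup>2"

definition chi2 :: "phys \<Rightarrow> real \<Rightarrow> real" where
  "chi2 P c = 1 + delta2 P * (1 - beta P * c)\<^sup>2"

definition theta :: "('d::finite) mesh \<Rightarrow> phys \<Rightarrow> 'd state \<Rightarrow> real" where
  "theta \<M> P S = Max (\<Union>K\<in>Kh \<M>. let c = c_old S K in
     {1, (1 - beta P * c)\<^sup>2 / (chi1 P c * (1 - chi1 P c * beta P * c)\<^sup>2),
         (1 - beta P * c)\<^sup>2 / (chi2 P c * (1 - chi2 P c * beta P * c)\<^sup>2)})"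

definition mu_slope :: "('d::finite) mesh \<Rightarrow> phys \<Rightarrow> 'd state \<Rightarrow> 'd elem \<Rightarrow> real" where
  "mu_slope \<M> P S K =
     theta \<M> P S * Rgas P * Temp P / (c_old S K * (1 - beta P * c_old S K)\<^sup>2)"

definition mu_h :: "('d::finite) mesh \<Rightarrow> phys \<Rightarrow> 'd state \<Rightarrow> ('d elem \<Rightarrow> real) \<Rightarrow> 'd elem \<Rightarrow> real" where
  "mu_h \<M> P S c K = chem_pot P (c_old S K) + mu_slope \<M> P S K * (c K - c_old S K)"

text \<open>
  \<open>level_system\<close>: the momentum balance, Darcy's law, and the pressure and porosity equations
  that a concentration iterate \<open>c\<close> imposes on \<open>p\<close>, \<open>us\<close>, \<open>uf\<close>, \<open>\<phi>\<close> of the same level.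
  As no displacement is prescribed on the boundary, \<open>us\<close> is determined only up to rigid motions,
  which do not affect \<open>\<phi>\<close>.
\<close>

definition level_system :: "('d::finite) mesh \<Rightarrow> phys \<Rightarrow> 'd state \<Rightarrow> real \<Rightarrow> real \<Rightarrow> real \<Rightarrow>
    ('d elem \<Rightarrow> real) \<Rightarrow> ('d elem \<Rightarrow> real) \<Rightarrow> ('d, real^'d) broken \<Rightarrow> ('d, real^'d) broken \<Rightarrow>
    ('d elem \<Rightarrow> real) \<Rightarrow> bool" where
  "level_system \<M> P S \<gamma> \<zeta>2 N c p us uf \<phi> \<longleftrightarrow>
     p \<in> Qh \<M> \<and> us \<in> Vh \<M> \<and> uf \<in> Uh0 \<M> \<and> \<phi> \<in> Qh \<M> \<and>
     (\<forall>v\<in>Vh \<M>. bilinA \<M> P \<gamma> \<zeta>2 us p v = 0) \<and>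
     (\<forall>w\<in>Uh0 \<M>.
        (\<Sum>K\<in>Kh \<M>. ip_elem K (\<lambda>x. (1 / mobility P (phi_old S K)) *\<^sub>R uf K x) (w K)) =
        (\<Sum>e\<in>EI \<M>. ip_face \<M> e (jump e (pc (mu_h \<M> P S c)))
            (\<lambda>x. c_upw \<M> S e x * (w (fst e) x \<bullet> nrm \<M> e)))) \<and>
     (\<forall>z\<in>Qh \<M>.
        (\<Sum>K\<in>Kh \<M>. ip_elem K (pc p K) (pc z K)) =
        (\<Sum>K\<in>Kh \<M>. ip_elem K
            (\<lambda>x. c_old S K * mu_h \<M> P S c K - free_energy P (c_old S K)) (pc z K))) \<and>
     (\<forall>\<psi>\<in>Qh \<M>.
        (\<Sum>K\<in>Kh \<M>. ip_elem K (\<lambda>x. \<phi> K - phi_old S K) (pc \<psi> K)) =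
        1 / N * (\<Sum>K\<in>Kh \<M>. ip_elem K (\<lambda>x. p K - p_old S K) (pc \<psi> K))
        + alpha P * (\<Sum>K\<in>Kh \<M>. ip_elem K (divg (\<lambda>x. us K x - us_old S K x)) (pc \<psi> K))
        - alpha P * (\<Sum>e\<in>EI \<M>. ip_face \<M> e (avg e (\<lambda>K x. \<psi> K *\<^sub>R nrm \<M> e))
            (jump e (\<lambda>K x. us K x - us_old S K x))))"

definition mass_eq :: "('d::finite) mesh \<Rightarrow> phys \<Rightarrow> 'd state \<Rightarrow> real \<Rightarrow>
    ('d elem \<Rightarrow> real) \<Rightarrow> ('d, real^'d) broken \<Rightarrow> ('d elem \<Rightarrow> real) \<Rightarrow> bool" where
  "mass_eq \<M> P S \<zeta>1 \<phi> uf c' \<longleftrightarrow>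
     (\<forall>q\<in>Qh \<M>.
        (\<Sum>K\<in>Kh \<M>. ip_elem K (\<lambda>x. (\<phi> K * c' K - phi_old S K * c_old S K) / tau P) (pc q K))
        + (\<Sum>e\<in>EI \<M>. ip_face \<M> e
            (\<lambda>x. c_upw \<M> S e x * (uf (fst e) x \<bullet> nrm \<M> e)) (jump e (pc q)))
        + (\<Sum>e\<in>EI \<M>. \<zeta>1 / h_face \<M> e *
            ip_face \<M> e (jump e (pc (mu_h \<M> P S c'))) (jump e (pc q))) = 0)"

definition iteration_step :: "('d::finite) mesh \<Rightarrow> phys \<Rightarrow> 'd state \<Rightarrow> real \<Rightarrow> real \<Rightarrow> real \<Rightarrow> real \<Rightarrow>
    ('d elem \<Rightarrow> real) \<Rightarrow> ('d elem \<Rightarrow> real) \<Rightarrow> bool" where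
  "iteration_step \<M> P S \<gamma> \<zeta>1 \<zeta>2 N c c' \<longleftrightarrow> c' \<in> Qh \<M> \<and>
     (\<exists>p us uf \<phi>. level_system \<M> P S \<gamma> \<zeta>2 N c p us uf \<phi> \<and> mass_eq \<M> P S \<zeta>1 \<phi> uf c')"

definition Fh :: "('d::finite) mesh \<Rightarrow> phys \<Rightarrow> 'd state \<Rightarrow> real \<Rightarrow> real \<Rightarrow> real \<Rightarrow> real \<Rightarrow>
    ('d elem \<Rightarrow> real) \<Rightarrow> 'd elem \<Rightarrow> real" where
  "Fh \<M> P S \<gamma> \<zeta>1 \<zeta>2 N c = (THE c'. iteration_step \<M> P S \<gamma> \<zeta>1 \<zeta>2 N c c')"

text \<open>
  Concentration iterates whose porosity takes values in \<open>[m, 1)\<close>. Without a positive lower bound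
  on the porosity the discrete mass balance may degenerate.
\<close>

definition iterates :: "('d::finite) mesh \<Rightarrow> phys \<Rightarrow> 'd state \<Rightarrow> real \<Rightarrow> real \<Rightarrow> real \<Rightarrow> real \<Rightarrow>
    ('d elem \<Rightarrow> real) set" where
  "iterates \<M> P S \<gamma> \<zeta>2 N m = {c \<in> Qh \<M>. \<forall>p us uf \<phi>. level_system \<M> P S \<gamma> \<zeta>2 N c p us uf \<phi> \<longrightarrow>
     (\<forall>K\<in>Kh \<M>. m \<le> \<phi> K \<and> \<phi> K < 1)}"


section \<open>The contraction estimate\<close>

definition C_lambda :: "('d::finite) mesh \<Rightarrow> phys \<Rightarrow> 'd state \<Rightarrow> real" where
  "C_lambda \<M> P S = Min ((\<lambda>K. 1 / mobility P (phi_old S K)) ` Kh \<M>)"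

definition C_mu_min :: "('d::finite) mesh \<Rightarrow> phys \<Rightarrow> 'd state \<Rightarrow> real" where
  "C_mu_min \<M> P S = Min (mu_slope \<M> P S ` Kh \<M>)"

definition C_phi_min :: "('d::finite) mesh \<Rightarrow> 'd state \<Rightarrow> real" where
  "C_phi_min \<M> S = Min (phi_old S ` Kh \<M>)"

definition jump_coeff :: "('d::finite) mesh \<Rightarrow> phys \<Rightarrow> 'd state \<Rightarrow> real \<Rightarrow> real \<Rightarrow> real \<Rightarrow> real" where
  "jump_coeff \<M> P S \<zeta>1 \<rho> C =
     \<zeta>1 * C_mu_min \<M> P S - \<rho>\<^sup>2 * C / ((beta P)\<^sup>2 * C_lambda \<M> P S)"

definition dist_energy :: "('d::finite) mesh \<Rightarrow> phys \<Rightarrow> 'd state \<Rightarrow> real \<Rightarrow> real \<Rightarrow> real \<Rightarrow>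
    ('d elem \<Rightarrow> real) \<Rightarrow> ('d elem \<Rightarrow> real) \<Rightarrow> real" where
  "dist_energy \<M> P S \<zeta>1 \<rho> C c d =
     (let w = pc (\<lambda>K. c K - d K) in
      3 * C_phi_min \<M> S / 4 * (\<Sum>K\<in>Kh \<M>. ip_elem K (w K) (w K))
      + jump_coeff \<M> P S \<zeta>1 \<rho> C *
          (\<Sum>e\<in>EI \<M>. 1 / h_face \<M> e * ip_face \<M> e (jump e w) (jump e w)))"

end

theory Submission
  imports Defs "HOL-Library.Function_Algebras"
begin

text \<open>
  The mesh being fixed, every constant may depend on it, and only the scaling in \<open>\<zeta>1\<close>, \<open>N\<close>, \<open>\<gamma>\<close> matters.
  For large \<open>\<zeta>2\<close> the elasticity form controls \<open>\<gamma>\<close> times the squared discrete divergence, so with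
  \<open>\<gamma> \<ge> N\<close> the porosity depends on the concentration with Lipschitz constant \<open>O(1/N)\<close>; and since elasticity
  acts monotonically on the pressure, a porosity in \<open>[m, 1)\<close> forces the pressure, hence the Darcy
  fluxes, to be \<open>O(N)\<close>.
  The mass balance is a reaction-diffusion equation on the graph of elements and faces. Fluxes
  only act on jumps, which the penalty divides by \<open>\<zeta>1\<close>, whereas the part constant on the
  components of the graph is fixed by mass conservation. Hence the new concentration is
  \<open>O(N/\<zeta>1)\<close>, and the difference of two of them is at most
  \<open>O(N/\<zeta>1) O(1/N) + O(1/\<zeta>1) = O(1/\<zeta>1)\<close> times the old difference. The energy lies
  between a constant and \<open>O(\<zeta>1)\<close> times the squared norm, so it is contracted by \<open>O(1/\<zeta>1)\<close>.
\<close>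

section \<open>Representation of functionals on finite-dimensional spaces\<close>

text \<open>The obstacle is the product of porosity and concentration in the mass balance:
  subtracting two balances leaves the porosity difference times a new concentration, for which no
  bound is given. The only restriction on iterates is the porosity range, and the bound it yields
  grows with N; this growth is offset exactly by the factor 1/N in the porosity difference. The
  constants must therefore be free of \<zeta>1, N, \<gamma> and \<zeta>2. This leads to the regime
  \<zeta>1 \<le> N \<le> \<gamma>, where only the threshold for \<zeta>2 depends on \<gamma>,
  because tractions grow with \<gamma>. Uniqueness of the new concentration is not clear beforehand,
  as displacements are determined only modulo the kernel of the elasticity form; it is read off the
  Lipschitz estimate for equal data. For the same reason existence rests on a Riesz theorem for
  semidefinite forms. The number \<open>C\<close> enters only through \<open>jump_coeff\<close>,
  where it lowers the weight of the jumps, so any positive value is admissible once \<zeta>1 is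
  large.\<close>

lemma psd_null:
  fixes B :: "'v::ab_group_add \<Rightarrow> 'v \<Rightarrow> real" and scale :: "real \<Rightarrow> 'v \<Rightarrow> 'v"
  assumes lin: "\<And>u v w r. u \<in> V \<Longrightarrow> v \<in> V \<Longrightarrow> w \<in> V \<Longrightarrow> B (u + scale r v) w = B u w + r * B v w"
    and sym: "\<And>u v. u \<in> V \<Longrightarrow> v \<in> V \<Longrightarrow> B u v = B v u"
    and psd: "\<And>u. u \<in> V \<Longrightarrow> 0 \<le> B u u"
    and cl: "\<And>u v r. u \<in> V \<Longrightarrow> v \<in> V \<Longrightarrow> u + scale r v \<in> V"
    and u: "u \<in> V" and v: "v \<in> V" and null: "B v v = 0"
  shows "B u v = 0"
proof (rule ccontr)
  assume ne: "B u v \<noteq> 0"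
  \<comment> \<open>Along \<open>u + t v\<close> the quadratic form is affine in t, since
    \<open>B v v = 0\<close>; a nonzero slope lets it reach every value, and this t produces
    -1.\<close>
  define t where "t = - (B u u + 1) / (2 * B u v)"
  have c: "u + scale t v \<in> V" using cl u v by blast
  have "B (u + scale t v) (u + scale t v) = B u (u + scale t v) + t * B v (u + scale t v)"
    using lin u v c by blast
  also have "\<dots> = B (u + scale t v) u + t * B (u + scale t v) v" using sym u v c by simp
  also have "\<dots> = B u u + t * B v u + t * (B u v + t * B v v)" using lin u v by simp
  also have "\<dots> = B u u + 2 * t * B u v" using sym[OF u v] null by (simp add: algebra_simps)
  also have "\<dots> = - 1" using ne by (simp add: t_def field_simps)
  finally show False using psd[OF c] by simp
qed

text \<open>Gram-Schmidt for a form that is only semidefinite. A functional can be represented only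
  if it vanishes on the null vectors of \<open>B\<close>, which is the premise on \<open>F\<close>;
  the representer need not be unique.\<close>

lemma riesz_finite_span:
  fixes B :: "'v::ab_group_add \<Rightarrow> 'v \<Rightarrow> real" and scale :: "real \<Rightarrow> 'v \<Rightarrow> 'v"
  assumes vs: "vector_space scale" and fin: "finite S"
    and lin: "\<And>u v w r. u \<in> V \<Longrightarrow> v \<in> V \<Longrightarrow> w \<in> V \<Longrightarrow> B (u + scale r v) w = B u w + r * B v w"
    and sym: "\<And>u v. u \<in> V \<Longrightarrow> v \<in> V \<Longrightarrow> B u v = B v u"
    and psd: "\<And>u. u \<in> V \<Longrightarrow> 0 \<le> B u u"
    and V: "module.subspace scale V" and SV: "S \<subseteq> V"
    and F: "\<And>u v r. u \<in> V \<Longrightarrow> v \<in> V \<Longrightarrow> F (u + scale r v) = F u + r * F v"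
    and F0: "\<And>v. v \<in> V \<Longrightarrow> B v v = 0 \<Longrightarrow> F v = 0"
  shows "\<exists>u\<in>module.span scale S. \<forall>v\<in>module.span scale S. B u v = F v"
proof -
  interpret vector_space scale by fact
  have cl: "\<And>u v r. u \<in> V \<Longrightarrow> v \<in> V \<Longrightarrow> u + scale r v \<in> V"
    using V by (simp add: subspace_add subspace_scale)
  have null: "B u v = 0" if "u \<in> V" "v \<in> V" "B v v = 0" for u v
    by (rule psd_null[where V=V and scale=scale, OF lin sym psd cl]) (use that in auto)
  have zero: "0 \<in> V" using V subspace_0 by blast
  have rlin: "B w (u + scale r v) = B w u + r * B w v" if "u \<in> V" "v \<in> V" "w \<in> V" for u v w r
    using lin sym that cl by simp
  show ?thesis using fin SV F F0
  proof (induction S arbitrary: F rule: finite_induct)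
    case empty
    have "B 0 0 = B 0 0 + B 0 0" using lin[of 0 0 0 1] zero by simp
    then have "F 0 = 0" using empty(3) zero by simp
    then show ?case using \<open>B 0 0 = B 0 0 + B 0 0\<close> by simp
  next
    case (insert x S)
    have xV: "x \<in> V" and SV: "S \<subseteq> V" using insert.prems by auto
    have spV: "span S \<subseteq> V" using span_minimal[OF SV V] .
    \<comment> \<open>The projection of \<open>x\<close> onto the span is itself a representer,
      namely of the functional \<open>B x\<close>, which is admissible by \<open>null\<close>. This
      is why the induction runs over all \<open>F\<close>.\<close>
    obtain u0 where u0: "u0 \<in> span S" "\<forall>v\<in>span S. B u0 v = B x v"
      using insert.IH[of "B x", OF SV] rlin xV null by blast
    obtain u1 where u1: "u1 \<in> span S" "\<forall>v\<in>span S. B u1 v = F v"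
      using insert.IH[of F, OF SV insert.prems(2) insert.prems(3)] by blast
    define g where "g = x + scale (- 1) u0"
    have u0V: "u0 \<in> V" and u1V: "u1 \<in> V" using u0 u1 spV by auto
    have gV: "g \<in> V" unfolding g_def using cl xV u0V by blast
    have gperp: "B g v = 0" if "v \<in> span S" for v
      using lin[of x u0 v "-1"] u0 that xV u0V spV unfolding g_def by auto
    \<comment> \<open>If \<open>g\<close> is a null vector, then \<open>F g = 0\<close> and the
      equation \<open>k * B g g = F g\<close> holds with k = 0.\<close>
    define k where "k = (if B g g = 0 then 0 else F g / B g g)"
    have kg: "k * B g g = F g" using insert.prems(3)[OF gV] by (simp add: k_def)
    define u where "u = u1 + scale k g"
    have uV: "u \<in> V" unfolding u_def using cl u1V gV by blast
    have gsp: "g \<in> span (insert x S)" unfolding g_def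
      by (meson span_add span_base span_scale insertI1 span_mono subset_insertI subsetD u0(1))
    have usp: "u \<in> span (insert x S)" unfolding u_def
      by (meson span_add span_scale gsp span_mono subset_insertI subsetD u1(1))
    have "B u v = F v" if v: "v \<in> span (insert x S)" for v
    proof -
      obtain t where t: "v - scale t x \<in> span S" using v span_insert by auto
      \<comment> \<open>Rewrites v along the orthogonal splitting: \<open>x = g + u0\<close>, and
        the \<open>u0\<close> part is moved into the span of \<open>S\<close>.\<close>
      define v' where "v' = (v - scale t x) + scale t u0"
      have v': "v' \<in> span S" unfolding v'_def using t u0(1) span_add span_scale by blast
      have veq: "v = v' + scale t g"
        by (simp add: v'_def g_def scale_right_distrib scale_right_diff_distrib scale_minus_right)
      have v'V: "v' \<in> V" using v' spV by auto
      have "B u v = B u v' + t * B u g" unfolding veq using rlin v'V gV uV by blast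
      also have "B u v' = B u1 v' + k * B g v'" unfolding u_def using lin u1V gV v'V by blast
      also have "B u g = B u1 g + k * B g g" unfolding u_def using lin u1V gV by blast
      also have "B u1 g = 0" using gperp[OF u1(1)] sym u1V gV by simp
      also have "B g v' = 0" using gperp v' by blast
      finally have "B u v = F v' + t * F g" using u1 v' kg by simp
      also have "\<dots> = F v" unfolding veq using insert.prems(2) v'V gV by simp
      finally show ?thesis .
    qed
    then show ?case using usp by blast
  qed
qed

text \<open>The space \<open>Uh0\<close> is cut out by constraints and has no evident generators. It
  suffices that it lies in the span of a finite set: a maximal independent subset of it is then
  finite and spans it.\<close>

lemma riesz_subspace:
  fixes B :: "'v::ab_group_add \<Rightarrow> 'v \<Rightarrow> real" and scale :: "real \<Rightarrow> 'v \<Rightarrow> 'v"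
  assumes vs: "vector_space scale"
    and V: "module.subspace scale V" and fin: "finite S" and VS: "V \<subseteq> module.span scale S"
    and lin: "\<And>u v w r. u \<in> V \<Longrightarrow> v \<in> V \<Longrightarrow> w \<in> V \<Longrightarrow> B (u + scale r v) w = B u w + r * B v w"
    and sym: "\<And>u v. u \<in> V \<Longrightarrow> v \<in> V \<Longrightarrow> B u v = B v u"
    and psd: "\<And>u. u \<in> V \<Longrightarrow> 0 \<le> B u u"
    and F: "\<And>u v r. u \<in> V \<Longrightarrow> v \<in> V \<Longrightarrow> F (u + scale r v) = F u + r * F v"
    and F0: "\<And>v. v \<in> V \<Longrightarrow> B v v = 0 \<Longrightarrow> F v = 0"
  shows "\<exists>u\<in>V. \<forall>v\<in>V. B u v = F v"
proof -
  interpret vector_space scale by fact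
  obtain b where b: "b \<subseteq> V" "independent b" "V \<subseteq> span b"
    using maximal_independent_subset by blast
  have "finite b" using independent_span_bound[OF fin b(2)] b(1) VS by blast
  moreover have "span b = V" using b V span_minimal by blast
  ultimately show ?thesis
    using riesz_finite_span[where V=V and S=b and B=B and F=F, OF vs _ lin sym psd V b(1) F F0] by blast
qed

section \<open>Elementary estimates\<close>

lemma sum_abs_le_L2_set:
  assumes "finite E"
  shows "(\<Sum>e\<in>E. \<bar>f e\<bar>) \<le> sqrt (card E) * L2_set f E"
proof -
  have "(\<Sum>e\<in>E. \<bar>1\<bar> * \<bar>f e\<bar>) \<le> L2_set (\<lambda>_. 1) E * L2_set f E"
    by (rule L2_set_mult_ineq)
  then show ?thesis by (simp add: L2_set_def)
qed

lemma L2_set_le_const: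
  assumes "finite E" and "\<And>i. i \<in> E \<Longrightarrow> \<bar>f i\<bar> \<le> c" and "0 \<le> c"
  shows "L2_set f E \<le> real (card E) * c"
proof -
  have "L2_set f E \<le> (\<Sum>i\<in>E. \<bar>f i\<bar>)" by (rule L2_set_le_sum_abs)
  also have "\<dots> \<le> real (card E) * c" using assms(2) by (intro sum_bounded_above) auto
  finally show ?thesis .
qed

lemma L2_set_scaled:
  assumes "\<And>i. i \<in> E \<Longrightarrow> \<bar>f i\<bar> \<le> c * \<bar>g i\<bar>" and "0 \<le> c"
  shows "L2_set f E \<le> c * L2_set g E"
proof -
  have "L2_set f E = L2_set (\<lambda>i. \<bar>f i\<bar>) E" by (simp add: L2_set_def)
  also have "\<dots> \<le> L2_set (\<lambda>i. c * \<bar>g i\<bar>) E" by (rule L2_set_mono) (use assms in auto)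
  also have "\<dots> = c * L2_set g E" using assms(2) by (simp add: L2_set_def power_mult_distrib sum_distrib_left[symmetric] real_sqrt_mult)
  finally show ?thesis .
qed

lemma abs_sum_mult_le_L2_set:
  "\<bar>\<Sum>i\<in>A. f i * g i\<bar> \<le> L2_set f A * L2_set g A"
proof -
  have "\<bar>\<Sum>i\<in>A. f i * g i\<bar> \<le> (\<Sum>i\<in>A. \<bar>f i\<bar> * \<bar>g i\<bar>)"
    using sum_abs[of "\<lambda>i. f i * g i" A] by (simp add: abs_mult)
  also have "\<dots> \<le> L2_set f A * L2_set g A" by (rule L2_set_mult_ineq)
  finally show ?thesis .
qed

lemma L2_set_power2: "(L2_set f A)\<^sup>2 = (\<Sum>i\<in>A. (f i)\<^sup>2)"
  by (simp add: L2_set_def sum_nonneg)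

lemma finite_lower_bound:
  fixes f :: "'a \<Rightarrow> real"
  assumes "finite A" "\<And>x. x \<in> A \<Longrightarrow> 0 < f x"
  shows "\<exists>a>0. \<forall>x\<in>A. a \<le> f x"
  using assms by (intro exI[of _ "Min (insert 1 (f ` A))"]) auto

lemma finite_upper_bound:
  fixes f :: "'a \<Rightarrow> real"
  assumes "finite A"
  shows "\<exists>b>0. \<forall>x\<in>A. \<bar>f x\<bar> \<le> b"
proof -
  have "0 < Max (insert 1 ((\<lambda>x. \<bar>f x\<bar>) ` A))"
    using assms by (intro less_le_trans[OF zero_less_one Max_ge]) auto
  then show ?thesis using assms by (intro exI[of _ "Max (insert 1 ((\<lambda>x. \<bar>f x\<bar>) ` A))"]) auto
qed

lemma abs_le_L2_set:
  assumes "finite A" "i \<in> A"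
  shows "\<bar>f i\<bar> \<le> L2_set f A"
  using member_le_L2_set[OF assms, of "\<lambda>i. \<bar>f i\<bar>"] by (simp add: L2_set_def)

lemma L2_set_uminus: "L2_set (\<lambda>i. - f i) A = L2_set f A"
  by (simp add: L2_set_def)

text \<open>Testing an equation with its own solution leaves one factor of the norm on both sides.
  It can be cancelled even when it is zero, provided the remaining bound is nonnegative.\<close>

lemma mult_self_cancel_le:
  fixes a b n :: real
  assumes "0 \<le> n" "0 \<le> b" "n * (a * n) \<le> n * b"
  shows "a * n \<le> b"
  using assms by (cases "n = 0") (simp_all add: mult_le_cancel_left)

text \<open>The thresholds for N and \<gamma> are taken to be \<zeta>1 and N themselves, so the
  quantifier alternation collapses to the chain
  \<open>Z \<le> \<zeta>1 \<le> N \<le> \<gamma>\<close>; only the threshold for \<zeta>2 is left to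
  be supplied.\<close>

lemma nested_thresholds:
  fixes Z :: real
  assumes Z: "0 < Z" and Q: "\<And>\<zeta>1 N \<gamma>. Z \<le> \<zeta>1 \<Longrightarrow> \<zeta>1 \<le> N \<Longrightarrow> N \<le> \<gamma> \<Longrightarrow> \<exists>Z2>0. \<forall>\<zeta>2\<ge>Z2. Q \<zeta>1 N \<gamma> (\<zeta>2 :: real)"
  shows "\<exists>Z1>0. \<forall>\<zeta>1\<ge>Z1. \<exists>ZN>0. \<forall>N\<ge>ZN. \<exists>Zg>0. \<forall>\<gamma>\<ge>Zg. \<exists>Z2>0. \<forall>\<zeta>2\<ge>Z2. Q \<zeta>1 N \<gamma> \<zeta>2"
proof -
  have 1: "\<exists>Zg>0. \<forall>\<gamma>\<ge>Zg. \<exists>Z2>0. \<forall>\<zeta>2\<ge>Z2. Q \<zeta>1 N \<gamma> \<zeta>2" if "Z \<le> \<zeta>1" "\<zeta>1 \<le> N" for \<zeta>1 N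
    using Q[OF that] that Z by (intro exI[of _ N]) auto
  have "\<exists>ZN>0. \<forall>N\<ge>ZN. \<exists>Zg>0. \<forall>\<gamma>\<ge>Zg. \<exists>Z2>0. \<forall>\<zeta>2\<ge>Z2. Q \<zeta>1 N \<gamma> \<zeta>2" if "Z \<le> \<zeta>1" for \<zeta>1
    using 1[OF that] that Z by (intro exI[of _ \<zeta>1]) auto
  then show ?thesis using Z by (intro exI[of _ Z]) auto
qed

section \<open>Reaction-diffusion systems on finite graphs\<close>

text \<open>Telescoping along a path: each edge costs at most the whole sum of jumps, so the
  constant is the length of the path.\<close>

lemma graph_path_bound:
  assumes "finite E" and "(a, b) \<in> (E \<union> E\<inverse>)\<^sup>*"
  shows "\<exists>k\<ge>0. \<forall>\<psi>::'a \<Rightarrow> real. \<bar>\<psi> a - \<psi> b\<bar> \<le> k * (\<Sum>e\<in>E. \<bar>\<psi> (fst e) - \<psi> (snd e)\<bar>)"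
  using assms(2)
proof (induction rule: rtrancl_induct)
  case base
  show ?case by (rule exI[of _ 0]) simp
next
  case (step y z)
  then obtain k where k: "k \<ge> 0" "\<And>\<psi>::'a \<Rightarrow> real. \<bar>\<psi> a - \<psi> y\<bar> \<le> k * (\<Sum>e\<in>E. \<bar>\<psi> (fst e) - \<psi> (snd e)\<bar>)"
    by blast
  have yz: "\<bar>\<psi> y - \<psi> z\<bar> \<le> (\<Sum>e\<in>E. \<bar>\<psi> (fst e) - \<psi> (snd e)\<bar>)" for \<psi> :: "'a \<Rightarrow> real"
  proof -
    obtain e where e: "e \<in> E" "e = (y, z) \<or> e = (z, y)" using step(2) by auto
    have "\<bar>\<psi> y - \<psi> z\<bar> = \<bar>\<psi> (fst e) - \<psi> (snd e)\<bar>" using e(2) by auto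
    also have "\<dots> \<le> (\<Sum>e\<in>E. \<bar>\<psi> (fst e) - \<psi> (snd e)\<bar>)"
      using assms(1) e(1) by (intro member_le_sum) auto
    finally show ?thesis .
  qed
  have "\<bar>\<psi> a - \<psi> z\<bar> \<le> (k + 1) * (\<Sum>e\<in>E. \<bar>\<psi> (fst e) - \<psi> (snd e)\<bar>)" for \<psi> :: "'a \<Rightarrow> real"
    using k(2)[of \<psi>] yz[of \<psi>] by (simp add: algebra_simps)
  then show ?case using k(1) by (intro exI[of _ "k + 1"]) auto
qed

text \<open>Connectivity is not assumed, so no single mean value can be subtracted. Instead each
  component gets the value of \<psi> at a chosen representative, which every vertex of the component
  reaches by a path.\<close>

lemma graph_poincare:
  fixes V :: "'a set"
  assumes finE: "finite E" and finV: "finite V"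
  shows "\<exists>k\<ge>0. \<forall>\<psi>::'a \<Rightarrow> real. \<exists>\<psi>0. (\<forall>e\<in>E. \<psi>0 (fst e) = \<psi>0 (snd e)) \<and>
    L2_set (\<lambda>a. \<psi> a - \<psi>0 a) V \<le> k * L2_set (\<lambda>e. \<psi> (fst e) - \<psi> (snd e)) E"
proof -
  define R where "R = (E \<union> E\<inverse>)\<^sup>*"
  have "sym R" unfolding R_def by (intro sym_rtrancl sym_Un_converse)
  have "trans R" unfolding R_def by (rule trans_rtrancl)
  have refl: "(a, a) \<in> R" for a by (simp add: R_def)
  define rep where "rep a = (SOME b. (a, b) \<in> R)" for a
  have rep: "(a, rep a) \<in> R" for a unfolding rep_def by (rule someI) (rule refl)
  \<comment> \<open>Connected vertices see the same set of candidates, and Hilbert choice on equal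
    predicates gives equal representatives.\<close>
  have rep_eq: "rep a = rep b" if "(a, b) \<in> R" for a b
  proof -
    have "(\<lambda>c. (a, c) \<in> R) = (\<lambda>c. (b, c) \<in> R)"
      using that \<open>sym R\<close> \<open>trans R\<close> by (intro ext) (meson symE transE)
    then show ?thesis by (simp add: rep_def)
  qed
  have "\<forall>a. \<exists>k\<ge>0. \<forall>\<psi>::'a \<Rightarrow> real. \<bar>\<psi> a - \<psi> (rep a)\<bar> \<le> k * (\<Sum>e\<in>E. \<bar>\<psi> (fst e) - \<psi> (snd e)\<bar>)"
    using graph_path_bound[OF finE] rep unfolding R_def by blast
  then obtain k where k: "\<And>a. k a \<ge> 0"
    "\<And>a \<psi>::'a \<Rightarrow> real. \<bar>\<psi> a - \<psi> (rep a)\<bar> \<le> k a * (\<Sum>e\<in>E. \<bar>\<psi> (fst e) - \<psi> (snd e)\<bar>)"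
    by metis
  \<comment> \<open>The path constants are summed to become uniform in the vertex,
    \<open>sqrt (card E)\<close> converts the sum of jumps into their Euclidean norm, and
    \<open>card V\<close> converts the maximum over vertices into the Euclidean norm.\<close>
  define c where "c = real (card V) * ((\<Sum>a\<in>V. k a) * sqrt (card E))"
  show ?thesis
  proof (rule exI[of _ c], intro conjI allI)
    show "0 \<le> c" unfolding c_def using k(1) by (simp add: sum_nonneg)
    fix \<psi> :: "'a \<Rightarrow> real"
    let ?j = "L2_set (\<lambda>e. \<psi> (fst e) - \<psi> (snd e)) E"
    have "\<bar>\<psi> a - \<psi> (rep a)\<bar> \<le> ((\<Sum>a\<in>V. k a) * sqrt (card E)) * ?j" if "a \<in> V" for a
    proof -
      have "\<bar>\<psi> a - \<psi> (rep a)\<bar> \<le> k a * (\<Sum>e\<in>E. \<bar>\<psi> (fst e) - \<psi> (snd e)\<bar>)" by (rule k(2))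
      also have "\<dots> \<le> (\<Sum>a\<in>V. k a) * (sqrt (card E) * ?j)"
        using k(1) finV that sum_abs_le_L2_set[OF finE]
        by (intro mult_mono member_le_sum sum_nonneg) auto
      finally show ?thesis by (simp add: mult.assoc)
    qed
    then have "L2_set (\<lambda>a. \<psi> a - \<psi> (rep a)) V \<le> real (card V) * (((\<Sum>a\<in>V. k a) * sqrt (card E)) * ?j)"
      using k(1) by (intro L2_set_le_const finV mult_nonneg_nonneg sum_nonneg) auto
    moreover have "\<forall>e\<in>E. \<psi> (rep (fst e)) = \<psi> (rep (snd e))"
    proof
      fix e assume "e \<in> E"
      then have "(fst e, snd e) \<in> R" unfolding R_def by auto
      then show "\<psi> (rep (fst e)) = \<psi> (rep (snd e))" using rep_eq by metis
    qed
    ultimately show "\<exists>\<psi>0. (\<forall>e\<in>E. \<psi>0 (fst e) = \<psi>0 (snd e)) \<and> L2_set (\<lambda>a. \<psi> a - \<psi>0 a) V \<le> c * ?j"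
      by (intro exI[of _ "\<lambda>a. \<psi> (rep a)"]) (simp add: c_def mult.assoc)
  qed
qed

text \<open>The equation is tested with a function \<open>\<psi>0\<close> that is constant on the components of the graph
  and with \<open>\<psi> - \<psi>0\<close>, which the Poincare inequality bounds by the jumps of \<open>\<psi>\<close>.\<close>

lemma graph_reaction_diffusion_estimate:
  fixes V :: "'a set"
  assumes finE: "finite E" and finV: "finite V" and d0: "0 < d0"
  shows "\<exists>C>0. \<forall>\<zeta>\<ge>C. \<forall>D \<psi> f g. (\<forall>a\<in>V. d0 \<le> D a \<and> D a \<le> (d1::real)) \<longrightarrow>
     (\<forall>q::'a \<Rightarrow> real. (\<Sum>a\<in>V. D a * \<psi> a * q a)
        + \<zeta> * (\<Sum>e\<in>E. (\<psi> (fst e) - \<psi> (snd e)) * (q (fst e) - q (snd e)))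
      = (\<Sum>a\<in>V. f a * q a) + (\<Sum>e\<in>E. g e * (q (fst e) - q (snd e)))) \<longrightarrow>
     L2_set \<psi> V \<le> C * (L2_set f V + L2_set g E / \<zeta>)"
proof -
  obtain c where c: "c \<ge> 0" and poinc: "\<And>\<psi>::'a \<Rightarrow> real. \<exists>\<psi>0. (\<forall>e\<in>E. \<psi>0 (fst e) = \<psi>0 (snd e)) \<and>
    L2_set (\<lambda>a. \<psi> a - \<psi>0 a) V \<le> c * L2_set (\<lambda>e. \<psi> (fst e) - \<psi> (snd e)) E"
    using graph_poincare[OF finE finV] by blast
  \<comment> \<open>For empty V the bound \<open>d1\<close> may be negative, hence the absolute
    value.\<close>
  define b where "b = \<bar>d1\<bar>"
  define k where "k = (b / d0 + 1) * c"
  have b: "b \<ge> 0" by (simp add: b_def)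
  have k: "k \<ge> 0" using c d0 b by (simp add: k_def)
  \<comment> \<open>The summand 1 gives \<zeta> \<ge> 1, the second lets half of
    \<open>\<zeta> * j\<close> absorb the feedback of the jumps through the reaction term, and the
    others dominate the final coefficients of F and G.\<close>
  define C where "C = 1 + 2 * b * c * k + 1 / d0 + 2 * k\<^sup>2 + 2 * k"
  have parts: "0 \<le> 2 * b * c * k" "0 \<le> 1 / d0" "0 \<le> 2 * k\<^sup>2" "0 \<le> 2 * k"
    using b c k d0 by simp_all
  have "L2_set \<psi> V \<le> C * (L2_set f V + L2_set g E / \<zeta>)"
    if z: "\<zeta> \<ge> C" and D: "\<forall>a\<in>V. d0 \<le> D a \<and> D a \<le> d1"
      and eq: "\<And>q::'a \<Rightarrow> real. (\<Sum>a\<in>V. D a * \<psi> a * q a)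
        + \<zeta> * (\<Sum>e\<in>E. (\<psi> (fst e) - \<psi> (snd e)) * (q (fst e) - q (snd e)))
      = (\<Sum>a\<in>V. f a * q a) + (\<Sum>e\<in>E. g e * (q (fst e) - q (snd e)))"
    for \<zeta> D f g and \<psi> :: "'a \<Rightarrow> real"
  proof -
    obtain \<psi>0 where flat: "\<And>e. e \<in> E \<Longrightarrow> \<psi>0 (fst e) = \<psi>0 (snd e)"
      and po: "L2_set (\<lambda>a. \<psi> a - \<psi>0 a) V \<le> c * L2_set (\<lambda>e. \<psi> (fst e) - \<psi> (snd e)) E"
      using poinc by blast
    define j where "j = L2_set (\<lambda>e. \<psi> (fst e) - \<psi> (snd e)) E"
    define \<psi>1 where "\<psi>1 = (\<lambda>a. \<psi> a - \<psi>0 a)"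
    define F G n n0 n1 where "F = L2_set f V" and "G = L2_set g E" and "n = L2_set \<psi> V"
      and "n0 = L2_set \<psi>0 V" and "n1 = L2_set \<psi>1 V"
    have nonneg: "0 \<le> j" "0 \<le> F" "0 \<le> G" "0 \<le> n" "0 \<le> n0" "0 \<le> n1"
      by (simp_all add: j_def F_def G_def n_def n0_def n1_def)
    have n1: "n1 \<le> c * j" using po by (simp add: n1_def \<psi>1_def j_def)
    have Dabs: "\<bar>D a\<bar> \<le> b" if "a \<in> V" for a using D that d0 by (force simp: b_def)
    have DL: "L2_set (\<lambda>a. D a * h a) V \<le> b * L2_set h V" for h
      using Dabs b by (intro L2_set_scaled) (auto simp: abs_mult intro: mult_right_mono)
    have z1: "\<zeta> \<ge> 1" using z parts unfolding C_def by linarith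
    have jump1: "\<psi>1 (fst e) - \<psi>1 (snd e) = \<psi> (fst e) - \<psi> (snd e)" if "e \<in> E" for e
      using flat[OF that] by (simp add: \<psi>1_def)
    \<comment> \<open>Test with \<open>\<psi>1\<close>, whose jumps are those of \<psi>; this
      controls \<open>\<zeta> * j\<close>, at the price of a reaction term containing the full norm
      n.\<close>
    have "(\<Sum>a\<in>V. D a * \<psi> a * \<psi>1 a) + \<zeta> * (\<Sum>e\<in>E. (\<psi> (fst e) - \<psi> (snd e)) * (\<psi> (fst e) - \<psi> (snd e)))
      = (\<Sum>a\<in>V. f a * \<psi>1 a) + (\<Sum>e\<in>E. g e * (\<psi> (fst e) - \<psi> (snd e)))"
      using eq[of \<psi>1] jump1 by (simp cong: sum.cong)
    then have e1: "\<zeta> * j\<^sup>2 = (\<Sum>a\<in>V. f a * \<psi>1 a) + (\<Sum>e\<in>E. g e * (\<psi> (fst e) - \<psi> (snd e)))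
        - (\<Sum>a\<in>V. D a * \<psi> a * \<psi>1 a)"
      unfolding j_def L2_set_power2 by (simp add: power2_eq_square)
    have "\<bar>\<Sum>a\<in>V. f a * \<psi>1 a\<bar> \<le> F * n1" unfolding F_def n1_def by (rule abs_sum_mult_le_L2_set)
    moreover have "\<bar>\<Sum>e\<in>E. g e * (\<psi> (fst e) - \<psi> (snd e))\<bar> \<le> G * j"
      unfolding G_def j_def by (rule abs_sum_mult_le_L2_set)
    moreover have "\<bar>\<Sum>a\<in>V. D a * \<psi> a * \<psi>1 a\<bar> \<le> b * n * n1"
      using abs_sum_mult_le_L2_set[of "\<lambda>a. D a * \<psi> a" \<psi>1 V] mult_right_mono[OF DL[of \<psi>] nonneg(6)]
      unfolding n1_def n_def by linarith
    ultimately have "\<zeta> * j\<^sup>2 \<le> F * n1 + G * j + b * n * n1" using e1 by linarith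
    also have "\<dots> \<le> F * (c * j) + G * j + b * n * (c * j)"
      using n1 nonneg b by (intro add_mono mult_left_mono) auto
    finally have "j * (\<zeta> * j) \<le> j * (c * F + G + b * c * n)" by (simp add: algebra_simps power2_eq_square)
    then have zj: "\<zeta> * j \<le> c * F + G + b * c * n"
      using nonneg b c by (cases "j = 0") (auto simp: mult_le_cancel_left)
    \<comment> \<open>Test with \<open>\<psi>0\<close>: both the diffusion and the flux data
      \<open>g\<close> drop out, so the flat part is governed by f and \<open>\<psi>1\<close> alone,
      without any help from \<zeta>.\<close>
    have "(\<Sum>a\<in>V. D a * \<psi> a * \<psi>0 a) = (\<Sum>a\<in>V. f a * \<psi>0 a)"
      using eq[of \<psi>0] flat by simp
    then have "(\<Sum>a\<in>V. D a * \<psi>0 a * \<psi>0 a) = (\<Sum>a\<in>V. f a * \<psi>0 a) - (\<Sum>a\<in>V. D a * \<psi>1 a * \<psi>0 a)"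
      by (simp add: \<psi>1_def algebra_simps sum_subtractf sum.distrib)
    moreover have "d0 * n0\<^sup>2 \<le> (\<Sum>a\<in>V. D a * \<psi>0 a * \<psi>0 a)"
    proof -
      have "d0 * n0\<^sup>2 = (\<Sum>a\<in>V. d0 * (\<psi>0 a)\<^sup>2)" by (simp add: n0_def L2_set_power2 sum_distrib_left)
      also have "\<dots> \<le> (\<Sum>a\<in>V. D a * (\<psi>0 a)\<^sup>2)" using D by (intro sum_mono mult_right_mono) auto
      finally show ?thesis by (simp add: power2_eq_square mult.assoc)
    qed
    moreover have "\<bar>\<Sum>a\<in>V. f a * \<psi>0 a\<bar> \<le> F * n0" unfolding F_def n0_def by (rule abs_sum_mult_le_L2_set)
    moreover have "\<bar>\<Sum>a\<in>V. D a * \<psi>1 a * \<psi>0 a\<bar> \<le> b * n1 * n0"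
      using abs_sum_mult_le_L2_set[of "\<lambda>a. D a * \<psi>1 a" \<psi>0 V] mult_right_mono[OF DL[of \<psi>1] nonneg(5)]
      unfolding n1_def n0_def by linarith
    ultimately have "n0 * (d0 * n0) \<le> n0 * (F + b * n1)" by (simp add: algebra_simps power2_eq_square)
    then have "d0 * n0 \<le> F + b * n1"
      using nonneg b by (cases "n0 = 0") (auto simp: mult_le_cancel_left)
    also have "\<dots> \<le> F + b * (c * j)" using n1 b by (intro add_left_mono mult_left_mono)
    finally have n0: "n0 \<le> (F + b * (c * j)) / d0" using d0 by (simp add: pos_le_divide_eq mult.commute)
    have "n \<le> n0 + n1"
      using L2_set_triangle_ineq[of \<psi>0 \<psi>1 V] by (simp add: n_def n0_def n1_def \<psi>1_def)
    then have n: "n \<le> F / d0 + k * j" using n0 n1 by (simp add: k_def add_divide_distrib algebra_simps)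
    have "b * c * n \<le> b * c * (F / d0 + k * j)" using n b c by (intro mult_left_mono) auto
    then have "\<zeta> * j \<le> k * F + G + b * c * k * j" using zj by (simp add: k_def algebra_simps)
    \<comment> \<open>Closes the loop: n was bounded by j again, and the resulting multiple of j is
      at most half of the left-hand side because \<zeta> \<ge> C.\<close>
    moreover have "2 * (b * c * k * j) \<le> \<zeta> * j"
      using mult_right_mono[of "2 * b * c * k" \<zeta> j] z parts nonneg(1) unfolding C_def by (simp add: algebra_simps)
    ultimately have "\<zeta> * j \<le> 2 * (k * F + G)" by (smt (verit))
    then have "j \<le> 2 * (k * F + G) / \<zeta>" using z1 by (simp add: pos_le_divide_eq mult.commute)
    then have "k * j \<le> k * (2 * (k * F + G) / \<zeta>)" using k by (rule mult_left_mono)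
    also have "\<dots> = 2 * k\<^sup>2 * (F / \<zeta>) + 2 * k * (G / \<zeta>)" by (simp add: power2_eq_square add_divide_distrib algebra_simps)
    also have "\<dots> \<le> 2 * k\<^sup>2 * F + 2 * k * (G / \<zeta>)"
      using nonneg z1 by (intro add_right_mono mult_left_mono) (auto simp: divide_le_eq mult_le_cancel_left1)
    finally have "n \<le> (1 / d0 + 2 * k\<^sup>2) * F + 2 * k * (G / \<zeta>)" using n by (simp add: algebra_simps)
    also have "\<dots> \<le> C * F + C * (G / \<zeta>)"
    proof (rule add_mono)
      have "1 / d0 + 2 * k\<^sup>2 \<le> C" "2 * k \<le> C" using parts unfolding C_def by linarith+
      then show "(1 / d0 + 2 * k\<^sup>2) * F \<le> C * F" "2 * k * (G / \<zeta>) \<le> C * (G / \<zeta>)"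
        using nonneg z1 by (intro mult_right_mono; simp)+
    qed
    finally show ?thesis by (simp add: F_def G_def n_def algebra_simps)
  qed
  moreover have "C > 0" using parts unfolding C_def by linarith
  ultimately show ?thesis by blast
qed

section \<open>The broken spaces as vector spaces\<close>

lemma sum_fun_apply: "(\<Sum>i\<in>I. f i) K = (\<Sum>i\<in>I. (f i K :: 'b::comm_monoid_add))"
  by (induction I rule: infinite_finite_induct) auto

lemma vector_space_fun: "vector_space (\<lambda>(r::real) (f::'a \<Rightarrow> real) x. r * f x)"
  by unfold_locales (auto simp: fun_eq_iff algebra_simps)

definition fscale :: "real \<Rightarrow> ('d, 'b::real_vector) broken \<Rightarrow> ('d, 'b) broken" where
  "fscale r v = (\<lambda>K x. r *\<^sub>R v K x)"

lemma fscale_apply [simp]: "fscale r v K x = r *\<^sub>R v K x"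
  by (simp add: fscale_def)

lemma vector_space_fscale: "vector_space (fscale :: real \<Rightarrow> ('d, 'b::real_vector) broken \<Rightarrow> _)"
  by unfold_locales (auto simp: fun_eq_iff scaleR_add_right scaleR_add_left)

lemma grad_affine: "grad (\<lambda>x. A *v x + a) x = A"
proof -
  have "((\<lambda>x. A *v x + a) has_derivative (\<lambda>h. A *v h)) (at x)"
    by (auto intro!: derivative_eq_intros bounded_linear.has_derivative[OF matrix_vector_mul_bounded_linear])
  then have "frechet_derivative (\<lambda>x. A *v x + a) (at x) = (\<lambda>h. A *v h)"
    by (metis frechet_derivative_at)
  then show ?thesis by (simp add: grad_def jacobian_def)
qed

lemma inner_mat_one: "mat 1 \<bullet> (A :: real^'n^'n) = trace A"
  by (simp add: inner_vec_def mat_def trace_def if_distrib[of "\<lambda>c. c * _"] cong: if_cong)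

lemma norm_matrix_vector_mult_le: "norm (A *v x) \<le> norm (A :: real^'n^'m) * norm x"
proof -
  have "norm (A *v x) = L2_set (\<lambda>i. norm ((A *v x) $ i)) UNIV" by (simp add: norm_vec_def)
  also have "\<dots> \<le> L2_set (\<lambda>i. norm (A $ i) * norm x) UNIV"
    by (intro L2_set_mono) (auto simp: matrix_vector_mul_component Cauchy_Schwarz_ineq2)
  also have "\<dots> = norm A * norm x" by (simp add: L2_set_left_distrib norm_vec_def)
  finally show ?thesis .
qed

lemma trace_scaleR: "trace (r *\<^sub>R (A :: real^'n^'n)) = r * trace A"
  by (simp add: trace_def sum_distrib_left)

lemma trace_transpose_real: "trace (transpose (A :: real^'n^'n)) = trace A"
  by (simp add: trace_def transpose_def)

lemma transpose_add: "transpose (A + B :: real^'n^'m) = transpose A + transpose B"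
  by (simp add: transpose_def vec_eq_iff)

text \<open>Recovers the matrix and the translation of an affine piece from the piece itself. The
  origin may lie outside K, since pieces are defined on the whole space.\<close>

lemma Vh_affine:
  assumes "v \<in> Vh \<M>" and "K \<in> Kh \<M>"
  shows "v K x = grad (v K) 0 *v x + v K 0" and "grad (v K) x = grad (v K) 0"
proof -
  obtain A a where v: "v K = (\<lambda>x. A *v x + a)" using assms unfolding Vh_def by blast
  show "v K x = grad (v K) 0 *v x + v K 0" "grad (v K) x = grad (v K) 0"
    unfolding v grad_affine by simp_all
qed

lemma Vh_continuous:
  assumes "v \<in> Vh \<M>"
  shows "continuous_on UNIV (v K)"
proof (cases "K \<in> Kh \<M>")
  case True
  then have "v K = (\<lambda>x. grad (v K) 0 *v x + v K 0)" using Vh_affine[OF assms] by blast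
  moreover have "continuous_on UNIV (\<lambda>x. grad (v K) 0 *v x + v K 0)"
    by (intro continuous_intros linear_continuous_on matrix_vector_mul_bounded_linear)
  ultimately show ?thesis by metis
next
  case False
  then have "v K = (\<lambda>x. 0)" using assms by (auto simp: Vh_def)
  then show ?thesis by simp
qed

lemma Vh_lin:
  assumes "u \<in> Vh \<M>" and "v \<in> Vh \<M>"
  shows "u + fscale r v \<in> Vh \<M>"
proof -
  have "\<exists>A a. \<forall>x. (u + fscale r v) K x = A *v x + a" if K: "K \<in> Kh \<M>" for K
  proof (intro exI allI)
    fix x
    have "(u + fscale r v) K x = grad (u K) 0 *v x + u K 0 + r *\<^sub>R (grad (v K) 0 *v x + v K 0)"
      using Vh_affine(1)[OF assms(1) K, of x] Vh_affine(1)[OF assms(2) K, of x] by simp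
    then show "(u + fscale r v) K x = (grad (u K) 0 + r *\<^sub>R grad (v K) 0) *v x + (u K 0 + r *\<^sub>R v K 0)"
      by (simp add: matrix_vector_mult_add_rdistrib scaleR_add_right scaleR_matrix_vector_assoc)
  qed
  then show ?thesis using assms by (auto simp: Vh_def fun_eq_iff)
qed

lemma Vh_grad_lin:
  assumes u: "u \<in> Vh \<M>" and v: "v \<in> Vh \<M>" and K: "K \<in> Kh \<M>"
  shows "grad ((u + fscale r v) K) x = grad (u K) x + r *\<^sub>R grad (v K) x"
proof -
  have "(u + fscale r v) K = (\<lambda>x. (grad (u K) 0 + r *\<^sub>R grad (v K) 0) *v x + (u K 0 + r *\<^sub>R v K 0))"
  proof
    fix x
    have "(u + fscale r v) K x = grad (u K) 0 *v x + u K 0 + r *\<^sub>R (grad (v K) 0 *v x + v K 0)"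
      using Vh_affine(1)[OF u K, of x] Vh_affine(1)[OF v K, of x] by simp
    then show "(u + fscale r v) K x = (grad (u K) 0 + r *\<^sub>R grad (v K) 0) *v x + (u K 0 + r *\<^sub>R v K 0)"
      by (simp add: matrix_vector_mult_add_rdistrib scaleR_add_right scaleR_matrix_vector_assoc)
  qed
  then show ?thesis using Vh_affine(2)[OF u K, of x] Vh_affine(2)[OF v K, of x] by (simp add: grad_affine)
qed

lemma zero_in_Vh: "0 \<in> Vh \<M>"
  by (auto simp: Vh_def fun_eq_iff intro!: exI[of _ 0])

lemma subspace_Vh: "module.subspace fscale (Vh \<M>)"
proof -
  interpret vector_space fscale by (rule vector_space_fscale)
  have "u + v \<in> Vh \<M>" "fscale r v \<in> Vh \<M>" if "u \<in> Vh \<M>" "v \<in> Vh \<M>" for u v r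
    using Vh_lin[OF that, of 1] Vh_lin[OF zero_in_Vh that(2), of r] by simp_all
  then show ?thesis using zero_in_Vh unfolding subspace_def by blast
qed

definition single :: "('d::finite) elem \<Rightarrow> (real^'d \<Rightarrow> 'b) \<Rightarrow> ('d, 'b::zero) broken" where
  "single K f = (\<lambda>K' x. if K' = K then f x else 0)"

text \<open>The generators are the constant and the linear monomial fields supported on one element;
  the coefficients are the value and the gradient at the origin.\<close>

lemma Vh_finite_span:
  fixes \<M> :: "('d::finite) mesh"
  assumes fin: "finite (Kh \<M>)"
  shows "\<exists>S. finite S \<and> Vh \<M> \<subseteq> module.span fscale S"
proof -
  interpret vector_space "fscale :: real \<Rightarrow> ('d, real^'d) broken \<Rightarrow> _" by (rule vector_space_fscale)
  define S :: "('d, real^'d) broken set" where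
    "S = (\<Union>K\<in>Kh \<M>. \<Union>i. insert (single K (\<lambda>x. axis i 1)) (\<Union>j. {single K (\<lambda>x. x $ j *\<^sub>R axis i 1)}))"
  have "finite S" unfolding S_def using fin by simp
  moreover have "v \<in> span S" if v: "v \<in> Vh \<M>" for v
  proof -
    have "v = (\<Sum>K\<in>Kh \<M>. \<Sum>i\<in>UNIV. fscale (v K 0 $ i) (single K (\<lambda>x. axis i 1))
       + (\<Sum>j\<in>UNIV. fscale (grad (v K) 0 $ i $ j) (single K (\<lambda>x. x $ j *\<^sub>R axis i 1))))" (is "v = ?s")
    proof (intro ext)
      fix K x
      have "?s K x = (\<Sum>K'\<in>Kh \<M>. if K' = K then \<Sum>i\<in>UNIV. (v K 0 $ i) *\<^sub>R axis i 1
         + (\<Sum>j\<in>UNIV. (grad (v K) 0 $ i $ j) *\<^sub>R (x $ j *\<^sub>R axis i 1)) else 0)"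
        by (auto simp: sum_fun_apply single_def intro!: sum.cong)
      also have "\<dots> = (if K \<in> Kh \<M> then \<Sum>i\<in>UNIV. (v K 0 $ i) *\<^sub>R axis i 1
         + (\<Sum>j\<in>UNIV. (grad (v K) 0 $ i $ j) *\<^sub>R (x $ j *\<^sub>R axis i 1)) else 0)"
        using fin by simp
      also have "\<dots> = v K x"
      proof (cases "K \<in> Kh \<M>")
        case True
        have "(\<Sum>i\<in>UNIV. (v K 0 $ i) *\<^sub>R axis i 1
         + (\<Sum>j\<in>UNIV. (grad (v K) 0 $ i $ j) *\<^sub>R (x $ j *\<^sub>R axis i (1::real)))) = grad (v K) 0 *v x + v K 0"
        proof (rule vec_eq_iff[THEN iffD2], rule allI)
          fix k
          have "(\<Sum>i\<in>UNIV. \<Sum>j\<in>UNIV. if k = i then grad (v K) 0 $ i $ j * x $ j else 0)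
              = (\<Sum>j\<in>UNIV. grad (v K) 0 $ k $ j * x $ j)"
            by (subst sum.swap) simp
          then show "(\<Sum>i\<in>UNIV. (v K 0 $ i) *\<^sub>R axis i 1
         + (\<Sum>j\<in>UNIV. (grad (v K) 0 $ i $ j) *\<^sub>R (x $ j *\<^sub>R axis i (1::real)))) $ k = (grad (v K) 0 *v x + v K 0) $ k"
            by (simp add: axis_def matrix_vector_mult_def if_distrib sum.distrib cong: if_cong)
        qed
        then show ?thesis using True Vh_affine(1)[OF v True, of x] by simp
      next
        case False
        then show ?thesis using v by (simp add: Vh_def)
      qed
      finally show "v K x = ?s K x" by simp
    qed
    moreover have "?s \<in> span S"
      by (intro span_sum span_add span_scale span_base) (auto simp: S_def)
    ultimately show ?thesis by metis
  qed
  ultimately show ?thesis by blast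
qed

text \<open>A field a + b x is affine with matrix b times the identity. Continuity and finite
  dimension are thereby inherited from \<open>Vh\<close>.\<close>

lemma Uh_subset_Vh: "Uh \<M> \<subseteq> Vh \<M>"
proof
  fix w assume w: "w \<in> Uh \<M>"
  have "\<exists>A a. \<forall>x. w K x = A *v x + a" if K: "K \<in> Kh \<M>" for K
  proof -
    obtain a b where "\<And>x. w K x = a + b *\<^sub>R x" using w K unfolding Uh_def by blast
    then have "\<forall>x. w K x = (b *\<^sub>R mat 1) *v x + a"
      by (simp add: scaleR_matrix_vector_assoc[symmetric] add.commute)
    then show ?thesis by blast
  qed
  then show "w \<in> Vh \<M>" using w by (auto simp: Vh_def Uh_def)
qed

lemma Uh0_subset_Vh: "Uh0 \<M> \<subseteq> Vh \<M>"
  using Uh_subset_Vh by (auto simp: Uh0_def)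

lemma Uh0_lin:
  assumes "u \<in> Uh0 \<M>" and "v \<in> Uh0 \<M>"
  shows "u + fscale r v \<in> Uh0 \<M>"
proof -
  have u: "u \<in> Uh \<M>" and v: "v \<in> Uh \<M>" using assms by (auto simp: Uh0_def)
  have "\<exists>a b. \<forall>x. (u + fscale r v) K x = a + b *\<^sub>R x" if K: "K \<in> Kh \<M>" for K
  proof -
    obtain a b where 1: "\<And>x. u K x = a + b *\<^sub>R x" using u K unfolding Uh_def by blast
    obtain a' b' where 2: "\<And>x. v K x = a' + b' *\<^sub>R x" using v K unfolding Uh_def by blast
    have "\<forall>x. (u + fscale r v) K x = (a + r *\<^sub>R a') + (b + r * b') *\<^sub>R x"
      by (simp add: 1 2 algebra_simps)
    then show ?thesis by blast
  qed
  moreover have "\<forall>e\<in>EI \<M>. \<forall>x\<in>face_set e. (u + fscale r v) (fst e) x \<bullet> nrm \<M> e = (u + fscale r v) (snd e) x \<bullet> nrm \<M> e"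
    using u v by (auto simp: Uh_def inner_add_left)
  moreover have "\<forall>K. K \<notin> Kh \<M> \<longrightarrow> (u + fscale r v) K = (\<lambda>x. 0)"
    using u v by (auto simp: Uh_def fun_eq_iff)
  ultimately have "u + fscale r v \<in> Uh \<M>" by (auto simp: Uh_def)
  then show ?thesis using assms by (auto simp: Uh0_def inner_add_left)
qed

lemma zero_in_Uh0: "0 \<in> Uh0 \<M>"
  by (auto simp: Uh0_def Uh_def fun_eq_iff intro!: exI[of _ 0])

lemma subspace_Uh0: "module.subspace fscale (Uh0 \<M>)"
proof -
  interpret vector_space fscale by (rule vector_space_fscale)
  have "u + v \<in> Uh0 \<M>" "fscale r v \<in> Uh0 \<M>" if "u \<in> Uh0 \<M>" "v \<in> Uh0 \<M>" for u v r
    using Uh0_lin[OF that, of 1] Uh0_lin[OF zero_in_Uh0 that(2), of r] by simp_all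
  then show ?thesis using zero_in_Uh0 unfolding subspace_def by blast
qed

section \<open>Face and element integrals\<close>

lemma set_integral_const_lborel:
  fixes c :: real
  assumes "compact K"
  shows "(LINT x:K|lborel. c) = measure lborel K * c"
proof -
  have "emeasure lborel K < \<infinity>" using assms emeasure_bounded_finite compact_imp_bounded by blast
  then show ?thesis using assms
    by (simp add: set_lebesgue_integral_def compact_imp_closed less_top[symmetric])
qed

locale face_mesh =
  fixes \<M> :: "('d::finite) mesh"
  assumes mesh: "simplicial_mesh \<M>"
begin

abbreviation fm :: "'d face \<Rightarrow> (real^'d) measure" where
  "fm \<equiv> face_measure \<M>"

lemma finite_Kh: "finite (Kh \<M>)"
  using mesh by (auto simp: simplicial_mesh_def triangulation_def)

lemma Kh_nonempty: "Kh \<M> \<noteq> {}"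
proof
  assume "Kh \<M> = {}"
  then have "closure (Omega \<M>) = {}" using mesh by (auto simp: simplicial_mesh_def)
  then show False using mesh by (auto simp: simplicial_mesh_def)
qed

lemma EI_facts:
  assumes "e \<in> EI \<M>"
  shows "fst e \<in> Kh \<M>" "snd e \<in> Kh \<M>" "norm (nrm \<M> e) = 1"
    "aff_dim (face_set e) = int CARD('d) - 1"
  using mesh assms by (auto simp: simplicial_mesh_def interior_face_def unit_normal_def)

lemma finite_EI: "finite (EI \<M>)"
proof (rule finite_subset)
  show "EI \<M> \<subseteq> Kh \<M> \<times> Kh \<M>" using EI_facts by (auto simp: mem_Times_iff)
qed (simp add: finite_Kh)

lemma compact_elem: "K \<in> Kh \<M> \<Longrightarrow> compact K"
  using mesh by (auto simp: simplicial_mesh_def intro: compact_simplex)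

text \<open>The face measure is the image of Lebesgue measure on a compact prism under the
  projection onto a closed affine set, a continuous map. Hence it has finite mass and is carried by
  a compact set, which makes continuous functions integrable.\<close>

lemma face_measure_bounded:
  assumes e: "e \<in> EI \<M>"
  shows "finite_measure (fm e)" and "\<exists>T. compact T \<and> (AE x in fm e. x \<in> T)"
proof -
  let ?P = "{x + t *\<^sub>R nrm \<M> e | x t. x \<in> face_set e \<and> t \<in> {0..1}}"
  let ?H = "affine hull (face_set e)"
  have "compact (face_set e)" using EI_facts[OF e] compact_elem by (auto simp: face_set_def compact_Int)
  then have "compact ((\<lambda>(x, t). x + t *\<^sub>R nrm \<M> e) ` (face_set e \<times> {0..1::real}))"
    by (intro compact_continuous_image compact_Times) (auto simp: case_prod_beta intro!: continuous_intros)
  moreover have "?P = (\<lambda>(x, t). x + t *\<^sub>R nrm \<M> e) ` (face_set e \<times> {0..1::real})" by force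
  ultimately have P: "compact ?P" by simp
  then have Pb: "?P \<in> sets lborel" using compact_imp_closed[OF P] by (simp only: sets_lborel borel_closed)
  have "emeasure lborel ?P < \<infinity>" using P emeasure_bounded_finite compact_imp_bounded by blast
  then have fin: "finite_measure (restrict_space lborel ?P)"
    using Pb by (intro finite_measureI) (simp add: emeasure_restrict_space space_restrict_space)
  \<comment> \<open>The empty set has affine dimension -1, whereas a face has dimension d - 1 \<ge>
    0. Projection onto the hull of an empty set would not be known to be continuous.\<close>
  have "face_set e \<noteq> {}"
  proof
    assume "face_set e = {}"
    then have "int CARD('d) = 0" using EI_facts(4)[OF e] by simp
    then show False by simp
  qed
  then have cont: "continuous_on UNIV (closest_point ?H)"
    by (intro continuous_on_closest_point affine_imp_convex) auto
  then have meas: "closest_point ?H \<in> measurable (restrict_space lborel ?P) borel"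
    by (intro measurable_restrict_space1) (simp add: borel_measurable_continuous_onI)
  show "finite_measure (fm e)" unfolding face_measure_def
    by (rule finite_measure.finite_measure_distr[OF fin meas])
  let ?T = "closest_point ?H ` ?P"
  have T: "compact ?T" by (rule compact_continuous_image[OF continuous_on_subset[OF cont] P]) simp
  have "AE x in fm e. x \<in> ?T" unfolding face_measure_def
  proof (subst AE_distr_iff[OF meas])
    show "{x \<in> space borel. x \<in> ?T} \<in> sets borel" using borel_closed[OF compact_imp_closed[OF T]] by (simp only: space_borel UNIV_I simp_thms Collect_mem_eq)
    show "AE x in restrict_space lborel ?P. closest_point ?H x \<in> ?T"
      by (rule AE_I2) (simp add: space_restrict_space)
  qed
  then show "\<exists>T. compact T \<and> (AE x in fm e. x \<in> T)" using T by blast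
qed

lemma sets_fm [measurable_cong, simp]: "sets (fm e) = sets borel"
  by (simp add: face_measure_def)

text \<open>Stated for measurable functions with a continuous majorant because the upwind value
  jumps where the old normal velocity changes sign.\<close>

lemma face_integrable:
  fixes f :: "real^'d \<Rightarrow> 'b::euclidean_space"
  assumes e: "e \<in> EI \<M>" and f: "f \<in> borel_measurable borel"
    and bd: "\<And>x. norm (f x) \<le> g x" and g: "continuous_on UNIV g"
  shows "integrable (fm e) f"
proof -
  interpret finite_measure "fm e" by (rule face_measure_bounded(1)[OF e])
  obtain T where T: "compact T" "AE x in fm e. x \<in> T" using face_measure_bounded(2)[OF e] by blast
  have "compact (g ` T)" using T(1) g by (meson compact_continuous_image continuous_on_subset subset_UNIV)
  then obtain B where B: "\<And>x. x \<in> T \<Longrightarrow> g x \<le> B"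
    using compact_imp_bounded bounded_imp_bdd_above unfolding bdd_above_def by (metis imageI)
  have "AE x in fm e. norm (f x) \<le> B" using T(2)
  proof (eventually_elim)
    case (elim x)
    then show ?case using B[of x] bd[of x] by linarith
  qed
  then show ?thesis by (rule integrable_const_bound) (use f in simp)
qed

lemma face_integrable_continuous:
  fixes f :: "real^'d \<Rightarrow> 'b::euclidean_space"
  assumes e: "e \<in> EI \<M>" and f: "continuous_on UNIV f"
  shows "integrable (fm e) f"
  by (rule face_integrable[OF e, where g="\<lambda>x. norm (f x)"])
    (auto intro: borel_measurable_continuous_onI f continuous_intros)

lemma jump_continuous: "v \<in> Vh \<M> \<Longrightarrow> continuous_on UNIV (jump e v)"
  unfolding jump_def by (intro continuous_intros) (auto intro: Vh_continuous)

lemma jump_lin: "jump e (u + fscale r v) x = jump e u x + r *\<^sub>R jump e v x"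
  by (simp add: jump_def algebra_simps)

text \<open>Tractions and pressures are constant on elements, so they see a displacement jump only
  through its face integral.\<close>

definition jint :: "'d face \<Rightarrow> ('d, real^'d) broken \<Rightarrow> real^'d" where
  "jint e v = (LINT x|fm e. jump e v x)"

lemma jint_lin:
  assumes "e \<in> EI \<M>" "u \<in> Vh \<M>" "v \<in> Vh \<M>"
  shows "jint e (u + fscale r v) = jint e u + r *\<^sub>R jint e v"
  unfolding jint_def jump_lin
  using assms by (simp add: face_integrable_continuous jump_continuous)

lemma ip_face_const:
  fixes a :: "'b::euclidean_space"
  assumes "e \<in> EI \<M>" "continuous_on UNIV f"
  shows "ip_face \<M> e (\<lambda>x. a) f = a \<bullet> (LINT x|fm e. f x)" "ip_face \<M> e f (\<lambda>x. a) = a \<bullet> (LINT x|fm e. f x)"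
  unfolding ip_face_def using face_integrable_continuous[OF assms] by (simp_all add: inner_commute)

lemma jump_product_integrable:
  assumes "e \<in> EI \<M>" "u \<in> Vh \<M>" "v \<in> Vh \<M>"
  shows "integrable (fm e) (\<lambda>x. jump e u x \<bullet> jump e v x)"
  using assms by (intro face_integrable_continuous continuous_intros jump_continuous)

lemma ip_face_jump_lin:
  assumes "e \<in> EI \<M>" "u \<in> Vh \<M>" "v \<in> Vh \<M>" "w \<in> Vh \<M>"
  shows "ip_face \<M> e (jump e (u + fscale r v)) (jump e w)
    = ip_face \<M> e (jump e u) (jump e w) + r * ip_face \<M> e (jump e v) (jump e w)"
  unfolding ip_face_def jump_lin
  using assms by (simp add: jump_product_integrable inner_add_left)

lemma ip_face_commute: "ip_face \<M> e f g = ip_face \<M> e g f"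
  by (simp add: ip_face_def inner_commute)

lemma ip_face_self_nonneg: "0 \<le> ip_face \<M> e f f"
  by (simp add: ip_face_def)

lemma h_face_nonneg: "0 \<le> h_face \<M> e"
  by (simp add: h_face_def)

lemma null_face_integral:
  fixes f :: "real^'d \<Rightarrow> 'b::euclidean_space"
  assumes e: "e \<in> EI \<M>" and h: "h_face \<M> e = 0"
  shows "(LINT x|fm e. f x) = 0"
proof -
  interpret finite_measure "fm e" by (rule face_measure_bounded(1)[OF e])
  have sp: "space (fm e) = UNIV" by (simp add: face_measure_def)
  have "emeasure (fm e) UNIV = 0" using h by (simp add: h_face_def emeasure_eq_measure)
  then have "AE x in fm e. f x = 0" by (intro AE_I[of _ _ UNIV]) (auto simp: sp)
  then show ?thesis by (rule integral_eq_zero_AE)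
qed

text \<open>Cauchy-Schwarz on one face, obtained from the nonnegative variance of the jump. The
  right-hand side is arranged to contain the penalty density with weight 1/h; for a face of measure
  zero both sides are 0.\<close>

lemma jint_bound:
  assumes e: "e \<in> EI \<M>" and v: "v \<in> Vh \<M>"
  shows "(norm (jint e v))\<^sup>2 \<le> (h_face \<M> e)\<^sup>2 * (1 / h_face \<M> e * ip_face \<M> e (jump e v) (jump e v))"
proof (cases "h_face \<M> e = 0")
  case True
  then show ?thesis using null_face_integral[OF e True] by (simp add: jint_def)
next
  case False
  interpret finite_measure "fm e" by (rule face_measure_bounded(1)[OF e])
  let ?h = "h_face \<M> e" and ?I = "jint e v" and ?J = "ip_face \<M> e (jump e v) (jump e v)"
  have h: "0 < ?h" using False h_face_nonneg[of e] by linarith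
  have sp: "space (fm e) = UNIV" by (simp add: face_measure_def)
  \<comment> \<open>The mean value of the jump over the face.\<close>
  define a where "a = (1 / ?h) *\<^sub>R ?I"
  note [simp] = jump_product_integrable[OF e v v] face_integrable_continuous[OF e jump_continuous[OF v]]
  have "0 \<le> (LINT x|fm e. (jump e v x - a) \<bullet> (jump e v x - a))"
    by (intro integral_nonneg_AE) simp
  also have "(\<lambda>x. (jump e v x - a) \<bullet> (jump e v x - a))
      = (\<lambda>x. jump e v x \<bullet> jump e v x - 2 * (jump e v x \<bullet> a) + a \<bullet> a)"
    by (simp add: algebra_simps inner_commute)
  also have "(LINT x|fm e. \<dots> x) = ?J - 2 * (?I \<bullet> a) + ?h * (a \<bullet> a)"
    by (simp add: ip_face_def jint_def h_face_def sp)
  also have "\<dots> = ?J - (?I \<bullet> ?I) / ?h"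
    using h by (simp add: a_def field_simps)
  finally have "?I \<bullet> ?I \<le> ?h * ?J" using h by (simp add: field_simps)
  then show ?thesis using h by (simp add: dot_square_norm power2_eq_square)
qed

lemma ip_elem_const:
  assumes "K \<in> Kh \<M>"
  shows "ip_elem K (\<lambda>x. a) (\<lambda>x. b) = measure lborel K * (a \<bullet> b)"
  unfolding ip_elem_def by (rule set_integral_const_lborel[OF compact_elem[OF assms]])

lemma ip_elem_lin:
  fixes f g k :: "real^'d \<Rightarrow> 'b::euclidean_space"
  assumes "K \<in> Kh \<M>" "continuous_on UNIV f" "continuous_on UNIV g" "continuous_on UNIV k"
  shows "ip_elem K (\<lambda>x. f x + r *\<^sub>R g x) k = ip_elem K f k + r * ip_elem K g k"
proof -
  have int: "set_integrable lborel K (\<lambda>x. F x \<bullet> G x)" if "continuous_on UNIV F" "continuous_on UNIV G" for F G :: "real^'d \<Rightarrow> 'b"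
    unfolding set_integrable_def
    by (intro borel_integrable_compact compact_elem assms(1) continuous_on_inner) (use that continuous_on_subset in blast)+
  show ?thesis unfolding ip_elem_def inner_add_left inner_scaleR_left
    using int assms by simp
qed

end

section \<open>Coercivity of the elasticity form\<close>

locale poroelastic_mesh = face_mesh \<M> for \<M> :: "('d::finite) mesh" +
  fixes P :: phys and \<sigma> :: real
  assumes phys: "valid_phys P" and shape: "nondegenerate \<sigma> \<M>"
begin

abbreviation vol :: "'d elem \<Rightarrow> real" where
  "vol K \<equiv> measure lborel K"

lemma ball_in_elem:
  assumes "K \<in> Kh \<M>"
  obtains z r where "0 < r" "ball z r \<subseteq> K"
  using shape assms ball_subset_cball unfolding nondegenerate_def by (meson subset_trans)

lemma vol_pos:
  assumes K: "K \<in> Kh \<M>"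
  shows "0 < vol K"
proof -
  obtain z r where zr: "0 < r" "ball z r \<subseteq> K" using ball_in_elem[OF K] .
  have "K \<in> fmeasurable lborel"
    using compact_elem[OF K] by (simp add: fmeasurable_compact)
  then have "measure lborel (ball z r) \<le> vol K"
    by (intro measure_mono_fmeasurable zr(2)) auto
  moreover have "0 < measure lborel (ball z r)" using content_ball_pos[OF zr(1)] by simp
  ultimately show ?thesis by linarith
qed

section \<open>Elementwise constant gradients and the reduced forms\<close>

abbreviation stress0 :: "real \<Rightarrow> ('d, real^'d) broken \<Rightarrow> 'd elem \<Rightarrow> real^'d^'d" where
  "stress0 \<gamma> v K \<equiv> stress P \<gamma> (v K) 0"

abbreviation strain0 :: "('d, real^'d) broken \<Rightarrow> 'd elem \<Rightarrow> real^'d^'d" where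
  "strain0 v K \<equiv> strain (v K) 0"

abbreviation div0 :: "('d, real^'d) broken \<Rightarrow> 'd elem \<Rightarrow> real" where
  "div0 v K \<equiv> divg (v K) 0"

lemma Vh_constant_gradient:
  assumes "v \<in> Vh \<M>" "K \<in> Kh \<M>"
  shows "stress P \<gamma> (v K) x = stress0 \<gamma> v K" "strain (v K) x = strain0 v K" "divg (v K) x = div0 v K"
  using Vh_affine(2)[OF assms, of x] by (simp_all add: stress_def strain_def divg_def)

lemma Vh_gradient_lin:
  assumes "u \<in> Vh \<M>" "v \<in> Vh \<M>" "K \<in> Kh \<M>"
  shows "strain0 (u + fscale r v) K = strain0 u K + r *\<^sub>R strain0 v K"
    "div0 (u + fscale r v) K = div0 u K + r * div0 v K"
    "stress0 \<gamma> (u + fscale r v) K = stress0 \<gamma> u K + r *\<^sub>R stress0 \<gamma> v K"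
proof -
  note g = Vh_grad_lin[OF assms, of r 0]
  show s: "strain0 (u + fscale r v) K = strain0 u K + r *\<^sub>R strain0 v K"
    unfolding strain_def g by (simp add: transpose_add transpose_scalar algebra_simps)
  show d: "div0 (u + fscale r v) K = div0 u K + r * div0 v K"
    unfolding divg_def g by (simp add: trace_add trace_scaleR)
  show "stress0 \<gamma> (u + fscale r v) K = stress0 \<gamma> u K + r *\<^sub>R stress0 \<gamma> v K"
    unfolding stress_def s d by (simp add: algebra_simps)
qed

lemma stress_inner_strain:
  "stress0 \<gamma> u K \<bullet> strain0 v K = 2 * eta P * (strain0 u K \<bullet> strain0 v K) + \<gamma> * div0 u K * div0 v K"
proof -
  have "trace (strain0 v K) = div0 v K"
    by (simp add: strain_def divg_def trace_scaleR trace_add trace_transpose_real)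
  then show ?thesis by (simp add: stress_def inner_add_left inner_mat_one)
qed

definition avg_traction :: "real \<Rightarrow> ('d, real^'d) broken \<Rightarrow> 'd face \<Rightarrow> real^'d" where
  "avg_traction \<gamma> v e = (1/2) *\<^sub>R ((stress0 \<gamma> v (fst e) + stress0 \<gamma> v (snd e)) *v nrm \<M> e)"

lemma avg_traction_lin:
  assumes "u \<in> Vh \<M>" "v \<in> Vh \<M>" "e \<in> EI \<M>"
  shows "avg_traction \<gamma> (u + fscale r v) e = avg_traction \<gamma> u e + r *\<^sub>R avg_traction \<gamma> v e"
  unfolding avg_traction_def using assms EI_facts[OF assms(3)]
  by (simp del: plus_fun_apply add: Vh_gradient_lin matrix_vector_mult_add_rdistrib scaleR_matrix_vector_assoc[symmetric] algebra_simps)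

text \<open>The symmetric interior penalty form of linear elasticity: \<open>bilinA\<close> without
  the pressure, with the integrals of constants evaluated.\<close>

definition elast :: "real \<Rightarrow> real \<Rightarrow> ('d, real^'d) broken \<Rightarrow> ('d, real^'d) broken \<Rightarrow> real" where
  "elast \<gamma> \<zeta>2 u v =
     (\<Sum>K\<in>Kh \<M>. vol K * (2 * eta P * (strain0 u K \<bullet> strain0 v K) + \<gamma> * div0 u K * div0 v K))
   - (\<Sum>e\<in>EI \<M>. avg_traction \<gamma> u e \<bullet> jint e v) - (\<Sum>e\<in>EI \<M>. avg_traction \<gamma> v e \<bullet> jint e u)
   + (\<Sum>e\<in>EI \<M>. \<zeta>2 / h_face \<M> e * ip_face \<M> e (jump e u) (jump e v))"

text \<open>The discrete divergence paired with a pressure. The same functional drives the momentum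
  balance and feeds the porosity equation; this match is what gives the elastic coupling a
  sign.\<close>

definition bdiv :: "('d elem \<Rightarrow> real) \<Rightarrow> ('d, real^'d) broken \<Rightarrow> real" where
  "bdiv p v = (\<Sum>K\<in>Kh \<M>. vol K * p K * div0 v K)
    - (\<Sum>e\<in>EI \<M>. (p (fst e) + p (snd e)) / 2 * (nrm \<M> e \<bullet> jint e v))"

lemma bdiv_alt:
  assumes v: "v \<in> Vh \<M>"
  shows "(\<Sum>K\<in>Kh \<M>. ip_elem K (pc p K) (divg (v K)))
    - (\<Sum>e\<in>EI \<M>. ip_face \<M> e (avg e (\<lambda>K x. p K *\<^sub>R nrm \<M> e)) (jump e v)) = bdiv p v"
proof -
  have 1: "ip_elem K (pc p K) (divg (v K)) = vol K * p K * div0 v K" if "K \<in> Kh \<M>" for K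
  proof -
    have "ip_elem K (pc p K) (divg (v K)) = ip_elem K (\<lambda>x. p K) (\<lambda>x. div0 v K)" unfolding pc_def
      by (rule arg_cong[where f="ip_elem K (\<lambda>x. p K)"], rule ext) (rule Vh_constant_gradient(3)[OF v that])
    then show ?thesis by (simp add: ip_elem_const[OF that])
  qed
  have 2: "ip_face \<M> e (avg e (\<lambda>K x. p K *\<^sub>R nrm \<M> e)) (jump e v)
      = (p (fst e) + p (snd e)) / 2 * (nrm \<M> e \<bullet> jint e v)" if e: "e \<in> EI \<M>" for e
  proof -
    have "avg e (\<lambda>K x. p K *\<^sub>R nrm \<M> e) = (\<lambda>x. ((p (fst e) + p (snd e)) / 2) *\<^sub>R nrm \<M> e)"
      by (simp add: avg_def fun_eq_iff scaleR_add_left[symmetric])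
    then show ?thesis using ip_face_const(1)[OF e jump_continuous[OF v], of "((p (fst e) + p (snd e)) / 2) *\<^sub>R nrm \<M> e"]
      by (simp add: jint_def)
  qed
  show ?thesis unfolding bdiv_def by (simp only: 1 2 cong: sum.cong)
qed

lemma bilinA_eq:
  assumes u: "u \<in> Vh \<M>" and v: "v \<in> Vh \<M>"
  shows "bilinA \<M> P \<gamma> \<zeta>2 u p v = elast \<gamma> \<zeta>2 u v - alpha P * bdiv p v"
proof -
  have "ip_elem K (stress P \<gamma> (u K)) (strain (v K))
      = vol K * (2 * eta P * (strain0 u K \<bullet> strain0 v K) + \<gamma> * div0 u K * div0 v K)" if "K \<in> Kh \<M>" for K
  proof -
    have "ip_elem K (stress P \<gamma> (u K)) (strain (v K)) = ip_elem K (\<lambda>x. stress0 \<gamma> u K) (\<lambda>x. strain0 v K)"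
      by (rule arg_cong2[where f="ip_elem K"]; rule ext)
        (rule Vh_constant_gradient(1)[OF u that], rule Vh_constant_gradient(2)[OF v that])
    then show ?thesis by (simp add: ip_elem_const[OF that] stress_inner_strain)
  qed
  moreover have tr: "avg e (\<lambda>K x. stress P \<gamma> (v K) x *v nrm \<M> e) = (\<lambda>x. avg_traction \<gamma> v e)"
    if e: "e \<in> EI \<M>" and v: "v \<in> Vh \<M>" for e v
  proof
    fix x
    show "avg e (\<lambda>K x. stress P \<gamma> (v K) x *v nrm \<M> e) x = avg_traction \<gamma> v e"
      unfolding avg_def avg_traction_def matrix_vector_mult_add_rdistrib
        Vh_constant_gradient(1)[OF v EI_facts(1)[OF e], of \<gamma> x]
        Vh_constant_gradient(1)[OF v EI_facts(2)[OF e], of \<gamma> x] ..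
  qed
  moreover have "ip_face \<M> e (avg e (\<lambda>K x. stress P \<gamma> (u K) x *v nrm \<M> e)) (jump e v)
      = avg_traction \<gamma> u e \<bullet> jint e v" if e: "e \<in> EI \<M>" for e
    unfolding tr[OF e u] jint_def by (rule ip_face_const(1)[OF e jump_continuous[OF v]])
  moreover have "ip_face \<M> e (jump e u) (avg e (\<lambda>K x. stress P \<gamma> (v K) x *v nrm \<M> e))
      = avg_traction \<gamma> v e \<bullet> jint e u" if e: "e \<in> EI \<M>" for e
    unfolding tr[OF e v] jint_def by (rule ip_face_const(2)[OF e jump_continuous[OF u]])
  ultimately show ?thesis
    by (simp add: bilinA_def elast_def bdiv_alt[OF v, symmetric] algebra_simps)
qed

lemma elast_commute: "elast \<gamma> \<zeta>2 u v = elast \<gamma> \<zeta>2 v u"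
  by (simp add: elast_def inner_commute ip_face_commute mult.commute mult.left_commute)

lemma elast_lin:
  assumes u: "u \<in> Vh \<M>" and v: "v \<in> Vh \<M>" and w: "w \<in> Vh \<M>"
  shows "elast \<gamma> \<zeta>2 (u + fscale r v) w = elast \<gamma> \<zeta>2 u w + r * elast \<gamma> \<zeta>2 v w"
proof -
  let ?z = "u + fscale r v"
  let ?E = "\<lambda>u K. vol K * (2 * eta P * (strain0 u K \<bullet> strain0 w K) + \<gamma> * div0 u K * div0 w K)"
  let ?J = "\<lambda>u e. \<zeta>2 / h_face \<M> e * ip_face \<M> e (jump e u) (jump e w)"
  have "(\<Sum>K\<in>Kh \<M>. ?E ?z K) = (\<Sum>K\<in>Kh \<M>. ?E u K + r * ?E v K)"
    by (intro sum.cong refl)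
      (simp del: plus_fun_apply add: Vh_gradient_lin[OF u v] inner_add_left algebra_simps)
  moreover have "(\<Sum>e\<in>EI \<M>. avg_traction \<gamma> ?z e \<bullet> jint e w)
      = (\<Sum>e\<in>EI \<M>. avg_traction \<gamma> u e \<bullet> jint e w + r * (avg_traction \<gamma> v e \<bullet> jint e w))"
    by (intro sum.cong refl, subst avg_traction_lin[OF u v], assumption) (simp add: inner_add_left)
  moreover have "(\<Sum>e\<in>EI \<M>. avg_traction \<gamma> w e \<bullet> jint e ?z)
      = (\<Sum>e\<in>EI \<M>. avg_traction \<gamma> w e \<bullet> jint e u + r * (avg_traction \<gamma> w e \<bullet> jint e v))"
    by (intro sum.cong refl, subst jint_lin[OF _ u v], assumption) (simp add: inner_add_right)
  moreover have "(\<Sum>e\<in>EI \<M>. ?J ?z e) = (\<Sum>e\<in>EI \<M>. ?J u e + r * ?J v e)"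
    by (intro sum.cong refl, subst ip_face_jump_lin[OF _ u v w], assumption) (simp add: distrib_left add_divide_distrib)
  ultimately show ?thesis
    unfolding elast_def sum.distrib sum_distrib_left[symmetric] by (simp only: right_diff_distrib distrib_left)
qed

lemma bdiv_lin:
  assumes u: "u \<in> Vh \<M>" and v: "v \<in> Vh \<M>"
  shows "bdiv p (u + fscale r v) = bdiv p u + r * bdiv p v"
proof -
  let ?z = "u + fscale r v"
  have "(\<Sum>K\<in>Kh \<M>. vol K * p K * div0 ?z K) = (\<Sum>K\<in>Kh \<M>. vol K * p K * div0 u K + r * (vol K * p K * div0 v K))"
    by (intro sum.cong refl, subst Vh_gradient_lin(2)[OF u v], assumption) (simp add: algebra_simps)
  moreover have "(\<Sum>e\<in>EI \<M>. (p (fst e) + p (snd e)) / 2 * (nrm \<M> e \<bullet> jint e ?z))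
     = (\<Sum>e\<in>EI \<M>. (p (fst e) + p (snd e)) / 2 * (nrm \<M> e \<bullet> jint e u)
        + r * ((p (fst e) + p (snd e)) / 2 * (nrm \<M> e \<bullet> jint e v)))"
    by (intro sum.cong refl, subst jint_lin[OF _ u v], assumption) (simp only: inner_add_right inner_scaleR_right distrib_left mult.left_commute)
  ultimately show ?thesis
    unfolding bdiv_def sum.distrib sum_distrib_left[symmetric] by (simp only: right_diff_distrib)
qed

definition ind :: "'d elem \<Rightarrow> 'd elem \<Rightarrow> real" where
  "ind K K' = (if K' = K then 1 else 0)"

lemma sum_ind: "K' \<in> Kh \<M> \<Longrightarrow> (\<Sum>K\<in>Kh \<M>. p K * ind K K') = p K'"
  by (simp add: ind_def finite_Kh if_distrib cong: if_cong)

lemma sum_ind': "K \<in> Kh \<M> \<Longrightarrow> (\<Sum>K'\<in>Kh \<M>. p K' * ind K K') = p K"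
  by (simp add: ind_def finite_Kh if_distrib cong: if_cong)

lemma ind_Qh: "K \<in> Kh \<M> \<Longrightarrow> ind K \<in> Qh \<M>"
  by (auto simp: ind_def Qh_def)

text \<open>By linearity in p, the numbers \<open>bdiv (ind K) v\<close> are the components of the
  discrete divergence, and its size can be measured by their Euclidean norm.\<close>

lemma bdiv_decomp: "bdiv p v = (\<Sum>K\<in>Kh \<M>. p K * bdiv (ind K) v)"
proof -
  have "(\<Sum>K\<in>Kh \<M>. p K * (\<Sum>K'\<in>Kh \<M>. vol K' * ind K K' * div0 v K'))
      = (\<Sum>K'\<in>Kh \<M>. \<Sum>K\<in>Kh \<M>. p K * (vol K' * ind K K' * div0 v K'))"
    by (subst sum.swap) (simp add: sum_distrib_left)
  also have "\<dots> = (\<Sum>K'\<in>Kh \<M>. vol K' * (\<Sum>K\<in>Kh \<M>. p K * ind K K') * div0 v K')"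
    by (simp add: sum_distrib_left sum_distrib_right mult_ac)
  finally have 1: "(\<Sum>K\<in>Kh \<M>. p K * (\<Sum>K'\<in>Kh \<M>. vol K' * ind K K' * div0 v K'))
      = (\<Sum>K'\<in>Kh \<M>. vol K' * p K' * div0 v K')" by (simp add: sum_ind cong: sum.cong)
  have "(\<Sum>K\<in>Kh \<M>. p K * (\<Sum>e\<in>EI \<M>. (ind K (fst e) + ind K (snd e)) / 2 * (nrm \<M> e \<bullet> jint e v)))
      = (\<Sum>e\<in>EI \<M>. \<Sum>K\<in>Kh \<M>. p K * ((ind K (fst e) + ind K (snd e)) / 2 * (nrm \<M> e \<bullet> jint e v)))"
    by (subst sum.swap) (simp add: sum_distrib_left)
  also have "\<dots> = (\<Sum>e\<in>EI \<M>. ((\<Sum>K\<in>Kh \<M>. p K * ind K (fst e)) + (\<Sum>K\<in>Kh \<M>. p K * ind K (snd e))) / 2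
       * (nrm \<M> e \<bullet> jint e v))"
    by (simp add: sum.distrib sum_distrib_left sum_distrib_right sum_divide_distrib algebra_simps add_divide_distrib)
  finally have 2: "(\<Sum>K\<in>Kh \<M>. p K * (\<Sum>e\<in>EI \<M>. (ind K (fst e) + ind K (snd e)) / 2 * (nrm \<M> e \<bullet> jint e v)))
      = (\<Sum>e\<in>EI \<M>. (p (fst e) + p (snd e)) / 2 * (nrm \<M> e \<bullet> jint e v))"
    by (simp add: sum_ind EI_facts cong: sum.cong)
  show ?thesis
    unfolding bdiv_def[of p v] bdiv_def[of "ind _" v] right_diff_distrib sum_subtractf 1 2 ..
qed

section \<open>Interior penalty coercivity\<close>

lemma norm_stress_le:
  assumes "0 < \<gamma>"
  shows "(norm (stress0 \<gamma> v K))\<^sup>2 \<le> (4 * eta P + 2 * \<gamma> * (norm (mat 1 :: real^'d^'d))\<^sup>2)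
    * (2 * eta P * (strain0 v K \<bullet> strain0 v K) + \<gamma> * div0 v K * div0 v K)"
proof -
  define k where "k = norm (mat 1 :: real^'d^'d)"
  define s where "s = norm (strain0 v K)"
  define t where "t = div0 v K"
  have eta: "0 < eta P" using phys by (simp add: valid_phys_def)
  have "norm (stress0 \<gamma> v K) \<le> 2 * eta P * s + \<gamma> * \<bar>t\<bar> * k"
    unfolding stress_def s_def k_def t_def
    using norm_triangle_ineq[of "(2 * eta P) *\<^sub>R strain0 v K" "(\<gamma> * div0 v K) *\<^sub>R mat 1"] eta assms by (simp add: abs_mult)
  then have "(norm (stress0 \<gamma> v K))\<^sup>2 \<le> (2 * eta P * s + \<gamma> * \<bar>t\<bar> * k)\<^sup>2" by (simp add: power_mono)
  also have "\<dots> \<le> 2 * (2 * eta P * s)\<^sup>2 + 2 * (\<gamma> * \<bar>t\<bar> * k)\<^sup>2"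
    using sum_squares_bound[of "2 * eta P * s" "\<gamma> * \<bar>t\<bar> * k"] by (simp add: power2_sum)
  also have "\<dots> = 4 * eta P * (2 * eta P * s\<^sup>2) + 2 * \<gamma> * k\<^sup>2 * (\<gamma> * t\<^sup>2)"
    by (simp add: power_mult_distrib power2_eq_square)
  also have "\<dots> \<le> (4 * eta P + 2 * \<gamma> * k\<^sup>2) * (2 * eta P * s\<^sup>2 + \<gamma> * t\<^sup>2)"
    using eta assms by (simp add: algebra_simps)
  finally show ?thesis by (simp add: k_def s_def t_def dot_square_norm power2_eq_square mult.assoc)
qed

lemma jump_penalty_nonneg: "0 \<le> 1 / h_face \<M> e * ip_face \<M> e (jump e v) (jump e v)"
  by (intro mult_nonneg_nonneg divide_nonneg_nonneg ip_face_self_nonneg h_face_nonneg) simp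

lemma sum_face_elem_le:
  fixes x :: "'d elem \<Rightarrow> real"
  assumes "\<And>K. K \<in> Kh \<M> \<Longrightarrow> 0 \<le> x K"
  shows "(\<Sum>e\<in>EI \<M>. x (fst e) + x (snd e)) \<le> 2 * real (card (EI \<M>)) * (\<Sum>K\<in>Kh \<M>. x K)"
proof -
  have "x (fst e) + x (snd e) \<le> 2 * (\<Sum>K\<in>Kh \<M>. x K)" if "e \<in> EI \<M>" for e
    using member_le_sum[of "fst e" "Kh \<M>" x] member_le_sum[of "snd e" "Kh \<M>" x] assms EI_facts[OF that] finite_Kh
    by force
  then have "(\<Sum>e\<in>EI \<M>. x (fst e) + x (snd e)) \<le> real (card (EI \<M>)) * (2 * (\<Sum>K\<in>Kh \<M>. x K))"
    by (rule sum_bounded_above)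
  then show ?thesis by simp
qed

text \<open>The usual penalty argument: Young's inequality splits each traction term into a small
  multiple of the elastic energy of the two neighbours and a multiple of the penalty. Since the
  stress is bounded by the energy with a factor growing with \<gamma>, so is the required
  \<zeta>2.\<close>

lemma elast_lower_bound:
  assumes g: "0 < \<gamma>"
  shows "\<exists>Z>0. \<forall>\<zeta>2\<ge>Z. \<forall>v\<in>Vh \<M>. \<gamma> / 2 * (\<Sum>K\<in>Kh \<M>. vol K * (div0 v K)\<^sup>2)
     + \<gamma> * (\<Sum>e\<in>EI \<M>. 1 / h_face \<M> e * ip_face \<M> e (jump e v) (jump e v)) \<le> elast \<gamma> \<zeta>2 v v"
proof -
  have eta: "0 < eta P" using phys by (simp add: valid_phys_def)
  define vmin where "vmin = Min (vol ` Kh \<M>)"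
  have vmin: "0 < vmin" "\<And>K. K \<in> Kh \<M> \<Longrightarrow> vmin \<le> vol K"
    using finite_Kh Kh_nonempty vol_pos by (auto simp: vmin_def)
  define q where "q = (4 * eta P + 2 * \<gamma> * (norm (mat 1 :: real^'d^'d))\<^sup>2) / vmin"
  have q: "0 < q" unfolding q_def using eta g vmin by (intro divide_pos_pos add_pos_nonneg) auto
  define nE where "nE = real (card (EI \<M>))"
  \<comment> \<open>The Young weight for which all traction terms together use at most half of the
    elastic energy; \<open>nE + 1\<close> instead of \<open>nE\<close> covers a mesh without
    interior faces.\<close>
  define s where "s = 1 / (4 * (nE + 1) * q)"
  have nE: "0 \<le> nE" by (simp add: nE_def)
  have s: "0 < s" unfolding s_def using q nE by simp
  define H where "H = (\<Sum>e\<in>EI \<M>. (h_face \<M> e)\<^sup>2)"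
  have H: "0 \<le> H" "\<And>e. e \<in> EI \<M> \<Longrightarrow> (h_face \<M> e)\<^sup>2 \<le> H"
    unfolding H_def using finite_EI by (auto intro!: sum_nonneg member_le_sum)
  \<comment> \<open>The first summand pays for the Young remainder. The second leaves the jumps with
    weight \<gamma>, as the discrete divergence contains jumps and is to be controlled with weight
    \<gamma>.\<close>
  define Z where "Z = H / (2 * s) + \<gamma>"
  have "\<gamma> / 2 * (\<Sum>K\<in>Kh \<M>. vol K * (div0 v K)\<^sup>2)
     + \<gamma> * (\<Sum>e\<in>EI \<M>. 1 / h_face \<M> e * ip_face \<M> e (jump e v) (jump e v)) \<le> elast \<gamma> \<zeta>2 v v"
    if z: "Z \<le> \<zeta>2" and v: "v \<in> Vh \<M>" for \<zeta>2 v
  proof -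
    define X where "X K = vol K * (2 * eta P * (strain0 v K \<bullet> strain0 v K) + \<gamma> * div0 v K * div0 v K)" for K
    define y where "y e = 1 / h_face \<M> e * ip_face \<M> e (jump e v) (jump e v)" for e
    define n where "n K = norm (stress0 \<gamma> v K)" for K
    have y: "0 \<le> y e" for e unfolding y_def by (rule jump_penalty_nonneg)
    have integrand: "0 \<le> 2 * eta P * (strain0 v K \<bullet> strain0 v K) + \<gamma> * div0 v K * div0 v K" for K
      using eta g by (simp add: mult.assoc)
    have n: "(n K)\<^sup>2 \<le> q * X K" if K: "K \<in> Kh \<M>" for K
    proof -
      have "(n K)\<^sup>2 \<le> (q * vmin) * (2 * eta P * (strain0 v K \<bullet> strain0 v K) + \<gamma> * div0 v K * div0 v K)"
        using norm_stress_le[OF g, of v K] vmin by (simp add: n_def q_def)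
      also have "\<dots> \<le> (q * vol K) * (2 * eta P * (strain0 v K \<bullet> strain0 v K) + \<gamma> * div0 v K * div0 v K)"
        using vmin(2)[OF K] q integrand by (intro mult_right_mono mult_left_mono) auto
      finally show ?thesis by (simp add: X_def mult.assoc)
    qed
    have jn: "(norm (jint e v))\<^sup>2 \<le> H * y e" if e: "e \<in> EI \<M>" for e
      using jint_bound[OF e v] mult_right_mono[OF H(2)[OF e] y[of e]] unfolding y_def by linarith
    have face: "2 * (avg_traction \<gamma> v e \<bullet> jint e v) \<le> s * ((n (fst e))\<^sup>2 + (n (snd e))\<^sup>2) + H / (2 * s) * y e"
      if e: "e \<in> EI \<M>" for e
    proof -
      have young: "a * b \<le> s * a\<^sup>2 + b\<^sup>2 / (4 * s)" for a b :: real
      proof -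
        have "(4 * s) * (a * b) \<le> (4 * s) * (s * a\<^sup>2 + b\<^sup>2 / (4 * s))"
          using sum_squares_bound[of "2 * s * a" b] s by (simp add: power2_eq_square algebra_simps)
        then show ?thesis using s by (simp only: mult_le_cancel_left_pos)
      qed
      have "norm (avg_traction \<gamma> v e) \<le> (n (fst e) + n (snd e)) / 2"
        unfolding avg_traction_def n_def
        using norm_matrix_vector_mult_le[of "stress0 \<gamma> v (fst e) + stress0 \<gamma> v (snd e)" "nrm \<M> e"]
          norm_triangle_ineq[of "stress0 \<gamma> v (fst e)" "stress0 \<gamma> v (snd e)"] EI_facts(3)[OF e]
        by simp
      then have "avg_traction \<gamma> v e \<bullet> jint e v \<le> (n (fst e) + n (snd e)) / 2 * norm (jint e v)"
        by (intro order_trans[OF norm_cauchy_schwarz] mult_right_mono norm_ge_zero)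
      then have "2 * (avg_traction \<gamma> v e \<bullet> jint e v) \<le> n (fst e) * norm (jint e v) + n (snd e) * norm (jint e v)"
        by (simp add: algebra_simps)
      also have "\<dots> \<le> s * ((n (fst e))\<^sup>2 + (n (snd e))\<^sup>2) + (norm (jint e v))\<^sup>2 / (2 * s)"
        using young[of "n (fst e)" "norm (jint e v)"] young[of "n (snd e)" "norm (jint e v)"] by (simp add: algebra_simps)
      also have "\<dots> \<le> s * ((n (fst e))\<^sup>2 + (n (snd e))\<^sup>2) + H / (2 * s) * y e"
        using jn[OF e] s by (simp add: divide_right_mono)
      finally show ?thesis .
    qed
    have SX: "0 \<le> (\<Sum>K\<in>Kh \<M>. X K)"
      unfolding X_def by (intro sum_nonneg mult_nonneg_nonneg integrand measure_nonneg)
    have "2 * (\<Sum>e\<in>EI \<M>. avg_traction \<gamma> v e \<bullet> jint e v)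
        \<le> (\<Sum>e\<in>EI \<M>. s * ((n (fst e))\<^sup>2 + (n (snd e))\<^sup>2) + H / (2 * s) * y e)"
      unfolding sum_distrib_left by (rule sum_mono) (rule face)
    also have "\<dots> = s * (\<Sum>e\<in>EI \<M>. (n (fst e))\<^sup>2 + (n (snd e))\<^sup>2) + H / (2 * s) * (\<Sum>e\<in>EI \<M>. y e)"
      by (simp add: sum.distrib sum_distrib_left distrib_left)
    finally have tr0: "2 * (\<Sum>e\<in>EI \<M>. avg_traction \<gamma> v e \<bullet> jint e v)
        \<le> s * (\<Sum>e\<in>EI \<M>. (n (fst e))\<^sup>2 + (n (snd e))\<^sup>2) + H / (2 * s) * (\<Sum>e\<in>EI \<M>. y e)" .
    have "(\<Sum>K\<in>Kh \<M>. (n K)\<^sup>2) \<le> q * (\<Sum>K\<in>Kh \<M>. X K)"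
      unfolding sum_distrib_left by (rule sum_mono) (rule n)
    then have "2 * nE * (\<Sum>K\<in>Kh \<M>. (n K)\<^sup>2) \<le> 2 * nE * (q * (\<Sum>K\<in>Kh \<M>. X K))"
      using nE by (intro mult_left_mono) auto
    moreover have "(\<Sum>e\<in>EI \<M>. (n (fst e))\<^sup>2 + (n (snd e))\<^sup>2) \<le> 2 * nE * (\<Sum>K\<in>Kh \<M>. (n K)\<^sup>2)"
      unfolding nE_def by (rule sum_face_elem_le) simp
    ultimately have "s * (\<Sum>e\<in>EI \<M>. (n (fst e))\<^sup>2 + (n (snd e))\<^sup>2) \<le> s * (2 * nE * (q * (\<Sum>K\<in>Kh \<M>. X K)))"
      using s by (intro mult_left_mono) auto
    also have "\<dots> \<le> 1 / 2 * (\<Sum>K\<in>Kh \<M>. X K)"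
    proof -
      have "s * 2 * nE * q = nE / (2 * (nE + 1))" unfolding s_def using q nE by (simp add: frac_eq_eq)
      also have "\<dots> \<le> 1 / 2" using nE by (simp add: pos_divide_le_eq)
      finally have "s * 2 * nE * q \<le> 1 / 2" .
      from mult_right_mono[OF this SX] show ?thesis by (simp add: mult_ac)
    qed
    finally have tr: "2 * (\<Sum>e\<in>EI \<M>. avg_traction \<gamma> v e \<bullet> jint e v)
        \<le> 1 / 2 * (\<Sum>K\<in>Kh \<M>. X K) + H / (2 * s) * (\<Sum>e\<in>EI \<M>. y e)"
      using tr0 by linarith
    have "(\<Sum>e\<in>EI \<M>. \<zeta>2 / h_face \<M> e * ip_face \<M> e (jump e v) (jump e v)) = \<zeta>2 * (\<Sum>e\<in>EI \<M>. y e)"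
      by (simp add: y_def sum_distrib_left)
    then have "elast \<gamma> \<zeta>2 v v = (\<Sum>K\<in>Kh \<M>. X K) - 2 * (\<Sum>e\<in>EI \<M>. avg_traction \<gamma> v e \<bullet> jint e v) + \<zeta>2 * (\<Sum>e\<in>EI \<M>. y e)"
      unfolding elast_def X_def by simp
    moreover have "Z * (\<Sum>e\<in>EI \<M>. y e) \<le> \<zeta>2 * (\<Sum>e\<in>EI \<M>. y e)"
      using z y by (intro mult_right_mono sum_nonneg) auto
    moreover have "Z * (\<Sum>e\<in>EI \<M>. y e) = H / (2 * s) * (\<Sum>e\<in>EI \<M>. y e) + \<gamma> * (\<Sum>e\<in>EI \<M>. y e)"
      by (simp add: Z_def distrib_right)
    moreover have "\<gamma> * (\<Sum>K\<in>Kh \<M>. vol K * (div0 v K)\<^sup>2) \<le> (\<Sum>K\<in>Kh \<M>. X K)"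
      unfolding sum_distrib_left X_def
    proof (rule sum_mono)
      fix K assume K: "K \<in> Kh \<M>"
      have "vol K * (\<gamma> * div0 v K * div0 v K) \<le> vol K * (2 * eta P * (strain0 v K \<bullet> strain0 v K) + \<gamma> * div0 v K * div0 v K)"
        using eta vol_pos[OF K] by (intro mult_left_mono) auto
      then show "\<gamma> * (vol K * (div0 v K)\<^sup>2) \<le> vol K * (2 * eta P * (strain0 v K \<bullet> strain0 v K) + \<gamma> * div0 v K * div0 v K)"
        by (simp add: power2_eq_square mult_ac)
    qed
    ultimately show ?thesis using tr unfolding y_def by linarith
  qed
  moreover have "0 < Z" unfolding Z_def using H s g by (simp add: add_nonneg_pos)
  ultimately show ?thesis by blast
qed

text \<open>Both parts of the discrete divergence are covered: the volume part by the divergence,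
  the face part by the jumps via \<open>jint_bound\<close>.\<close>

lemma bdiv_bound:
  "\<exists>c>0. \<forall>v\<in>Vh \<M>. c * (L2_set (\<lambda>K. bdiv (ind K) v) (Kh \<M>))\<^sup>2 \<le> 1 / 2 * (\<Sum>K\<in>Kh \<M>. vol K * (div0 v K)\<^sup>2)
     + (\<Sum>e\<in>EI \<M>. 1 / h_face \<M> e * ip_face \<M> e (jump e v) (jump e v))"
proof -
  define nE nK W H where "nE = real (card (EI \<M>))" and "nK = real (card (Kh \<M>))"
    and "W = (\<Sum>K\<in>Kh \<M>. vol K)" and "H = (\<Sum>e\<in>EI \<M>. (h_face \<M> e)\<^sup>2)"
  have nn: "0 \<le> nE" "0 \<le> nK" "0 \<le> W" "0 \<le> H"
    by (auto simp: nE_def nK_def W_def H_def intro!: sum_nonneg)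
  have H: "\<And>e. e \<in> EI \<M> \<Longrightarrow> (h_face \<M> e)\<^sup>2 \<le> H"
    unfolding H_def using finite_EI by (auto intro!: member_le_sum)
  \<comment> \<open>\<open>4 * W\<close> rather than \<open>2 * W\<close> compensates the factor 1/2
    in front of the divergence; the added 1 keeps k positive.\<close>
  define k where "k = 4 * W + 2 * nE * nK * H + 1"
  have k: "0 < k" unfolding k_def using nn by (intro add_nonneg_pos add_nonneg_nonneg mult_nonneg_nonneg) auto
  have "(L2_set (\<lambda>K. bdiv (ind K) v) (Kh \<M>))\<^sup>2 \<le> k * (1 / 2 * (\<Sum>K\<in>Kh \<M>. vol K * (div0 v K)\<^sup>2)
     + (\<Sum>e\<in>EI \<M>. 1 / h_face \<M> e * ip_face \<M> e (jump e v) (jump e v)))"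
    if v: "v \<in> Vh \<M>" for v
  proof -
    define y where "y e = 1 / h_face \<M> e * ip_face \<M> e (jump e v) (jump e v)" for e
    define I where "I e = norm (jint e v)" for e
    have y: "0 \<le> y e" for e unfolding y_def by (rule jump_penalty_nonneg)
    have Y: "0 \<le> (\<Sum>e\<in>EI \<M>. y e)" using y by (simp add: sum_nonneg)
    have "(\<Sum>e\<in>EI \<M>. (I e)\<^sup>2) \<le> (\<Sum>e\<in>EI \<M>. H * y e)"
    proof (rule sum_mono)
      fix e assume e: "e \<in> EI \<M>"
      show "(I e)\<^sup>2 \<le> H * y e"
        using jint_bound[OF e v] mult_right_mono[OF H[OF e] y[of e]] unfolding y_def I_def by linarith
    qed
    then have I: "(\<Sum>e\<in>EI \<M>. (I e)\<^sup>2) \<le> H * (\<Sum>e\<in>EI \<M>. y e)" by (simp add: sum_distrib_left)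
    have "(bdiv (ind K) v)\<^sup>2 \<le> 2 * W * (vol K * (div0 v K)\<^sup>2) + 2 * nE * H * (\<Sum>e\<in>EI \<M>. y e)"
      if K: "K \<in> Kh \<M>" for K
    proof -
      have "\<bar>(ind K (fst e) + ind K (snd e)) / 2 * (nrm \<M> e \<bullet> jint e v)\<bar> \<le> I e" if e: "e \<in> EI \<M>" for e
      proof -
        have 1: "\<bar>nrm \<M> e \<bullet> jint e v\<bar> \<le> I e"
          using Cauchy_Schwarz_ineq2[of "nrm \<M> e" "jint e v"] EI_facts(3)[OF e] by (simp add: I_def)
        have "\<bar>(ind K (fst e) + ind K (snd e)) / 2\<bar> \<le> 1" by (simp add: ind_def)
        then have "\<bar>(ind K (fst e) + ind K (snd e)) / 2\<bar> * \<bar>nrm \<M> e \<bullet> jint e v\<bar> \<le> 1 * I e"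
          using 1 by (intro mult_mono) auto
        then show ?thesis by (simp add: abs_mult)
      qed
      then have fb: "\<bar>\<Sum>e\<in>EI \<M>. (ind K (fst e) + ind K (snd e)) / 2 * (nrm \<M> e \<bullet> jint e v)\<bar> \<le> (\<Sum>e\<in>EI \<M>. I e)"
        by (intro order_trans[OF sum_abs] sum_mono)
      have "(\<Sum>K'\<in>Kh \<M>. vol K' * ind K K' * div0 v K') = vol K * div0 v K"
        using sum_ind'[OF K, of "\<lambda>K'. vol K' * div0 v K'"] by (simp add: mult_ac)
      then have b: "\<bar>bdiv (ind K) v\<bar> \<le> \<bar>vol K * div0 v K\<bar> + (\<Sum>e\<in>EI \<M>. I e)"
        unfolding bdiv_def using fb by linarith
      have 1: "(bdiv (ind K) v)\<^sup>2 \<le> (\<bar>vol K * div0 v K\<bar> + (\<Sum>e\<in>EI \<M>. I e))\<^sup>2"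
        using power_mono[OF b, of 2] by simp
      have 2: "(\<bar>vol K * div0 v K\<bar> + (\<Sum>e\<in>EI \<M>. I e))\<^sup>2 \<le> 2 * (vol K * div0 v K)\<^sup>2 + 2 * (\<Sum>e\<in>EI \<M>. I e)\<^sup>2"
        using sum_squares_bound[of "\<bar>vol K * div0 v K\<bar>" "\<Sum>e\<in>EI \<M>. I e"] by (simp add: power2_sum)
      have 3: "(\<Sum>e\<in>EI \<M>. I e)\<^sup>2 \<le> nE * (\<Sum>e\<in>EI \<M>. (I e)\<^sup>2)"
        unfolding nE_def by (metis sum_squared_le_sum_of_squares mult.commute)
      have 4: "nE * (\<Sum>e\<in>EI \<M>. (I e)\<^sup>2) \<le> nE * (H * (\<Sum>e\<in>EI \<M>. y e))" using I nn(1) by (rule mult_left_mono)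
      have "vol K \<le> W" unfolding W_def using K finite_Kh by (intro member_le_sum) auto
      then have "vol K * (vol K * (div0 v K)\<^sup>2) \<le> W * (vol K * (div0 v K)\<^sup>2)" by (intro mult_right_mono) auto
      then have 5: "(vol K * div0 v K)\<^sup>2 \<le> W * (vol K * (div0 v K)\<^sup>2)" by (simp add: power2_eq_square mult_ac)
      show ?thesis using 1 2 3 4 5 by linarith
    qed
    then have "(\<Sum>K\<in>Kh \<M>. (bdiv (ind K) v)\<^sup>2)
       \<le> (\<Sum>K\<in>Kh \<M>. 2 * W * (vol K * (div0 v K)\<^sup>2) + 2 * nE * H * (\<Sum>e\<in>EI \<M>. y e))" by (rule sum_mono)
    also have "\<dots> = 4 * W * (1 / 2 * (\<Sum>K\<in>Kh \<M>. vol K * (div0 v K)\<^sup>2)) + 2 * nE * nK * H * (\<Sum>e\<in>EI \<M>. y e)"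
      unfolding sum.distrib sum_constant sum_distrib_left[symmetric] by (simp add: nK_def)
    also have "\<dots> \<le> k * (1 / 2 * (\<Sum>K\<in>Kh \<M>. vol K * (div0 v K)\<^sup>2)) + k * (\<Sum>e\<in>EI \<M>. y e)"
      using nn Y by (intro add_mono mult_right_mono) (auto simp: k_def intro!: mult_nonneg_nonneg sum_nonneg)
    finally show ?thesis by (simp add: L2_set_power2 y_def distrib_left)
  qed
  then show ?thesis using k by (intro exI[of _ "1 / k"]) (simp add: pos_divide_le_eq mult.commute)
qed

text \<open>The point is the quantifier order: c depends on neither \<gamma> nor \<zeta>2, so the
  discrete divergence of a solution decays like 1/\<gamma>.\<close>

lemma elast_coercive:
  "\<exists>c>0. \<forall>\<gamma>>0. \<exists>Z>0. \<forall>\<zeta>2\<ge>Z. \<forall>v\<in>Vh \<M>.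
     c * \<gamma> * (L2_set (\<lambda>K. bdiv (ind K) v) (Kh \<M>))\<^sup>2 \<le> elast \<gamma> \<zeta>2 v v"
proof -
  obtain c where c: "0 < c" and cb: "\<And>v. v \<in> Vh \<M> \<Longrightarrow> c * (L2_set (\<lambda>K. bdiv (ind K) v) (Kh \<M>))\<^sup>2
     \<le> 1 / 2 * (\<Sum>K\<in>Kh \<M>. vol K * (div0 v K)\<^sup>2) + (\<Sum>e\<in>EI \<M>. 1 / h_face \<M> e * ip_face \<M> e (jump e v) (jump e v))"
    using bdiv_bound by blast
  have "\<exists>Z>0. \<forall>\<zeta>2\<ge>Z. \<forall>v\<in>Vh \<M>. c * \<gamma> * (L2_set (\<lambda>K. bdiv (ind K) v) (Kh \<M>))\<^sup>2 \<le> elast \<gamma> \<zeta>2 v v"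
    if g: "0 < \<gamma>" for \<gamma>
  proof -
    obtain Z where Z: "0 < Z" "\<And>\<zeta>2 v. \<lbrakk>Z \<le> \<zeta>2; v \<in> Vh \<M>\<rbrakk> \<Longrightarrow> \<gamma> / 2 * (\<Sum>K\<in>Kh \<M>. vol K * (div0 v K)\<^sup>2)
     + \<gamma> * (\<Sum>e\<in>EI \<M>. 1 / h_face \<M> e * ip_face \<M> e (jump e v) (jump e v)) \<le> elast \<gamma> \<zeta>2 v v"
      using elast_lower_bound[OF g] by blast
    have "c * \<gamma> * (L2_set (\<lambda>K. bdiv (ind K) v) (Kh \<M>))\<^sup>2 \<le> elast \<gamma> \<zeta>2 v v"
      if "Z \<le> \<zeta>2" "v \<in> Vh \<M>" for \<zeta>2 v
      using mult_left_mono[OF cb[OF that(2)], of \<gamma>] g Z(2)[OF that] by (simp add: algebra_simps)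
    then show ?thesis using Z(1) by blast
  qed
  then show ?thesis using c by blast
qed

end

section \<open>The discrete equations\<close>

locale linear_iteration = poroelastic_mesh \<M> P \<sigma> for \<M> :: "('d::finite) mesh" and P \<sigma> +
  fixes S :: "'d state" and \<rho>\<^sub>0 \<rho> :: real
  assumes state: "valid_state \<M> S" and rho0: "0 < \<rho>\<^sub>0" and rho: "\<rho> < 1"
    and c_old_bounds: "\<And>K. K \<in> Kh \<M> \<Longrightarrow> \<rho>\<^sub>0 \<le> beta P * c_old S K \<and> beta P * c_old S K \<le> \<rho>"
begin

lemma beta_pos: "0 < beta P" and tau_pos: "0 < tau P"
  using phys by (auto simp: valid_phys_def)

lemma c_old_pos: "K \<in> Kh \<M> \<Longrightarrow> 0 < c_old S K"
  using c_old_bounds[of K] rho0 beta_pos by (metis less_le_trans zero_less_mult_pos)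

lemma phi_old_bounds: "K \<in> Kh \<M> \<Longrightarrow> 0 < phi_old S K \<and> phi_old S K < 1"
  using state by (simp add: valid_state_def)

lemma theta_ge_1: "1 \<le> theta \<M> P S"
proof -
  obtain K where "K \<in> Kh \<M>" using Kh_nonempty by blast
  then show ?thesis unfolding theta_def Let_def using finite_Kh by (intro Max_ge) auto
qed

lemma mu_slope_pos:
  assumes "K \<in> Kh \<M>"
  shows "0 < mu_slope \<M> P S K"
proof -
  have "1 - beta P * c_old S K \<noteq> 0" using c_old_bounds[OF assms] rho by linarith
  then show ?thesis using theta_ge_1 c_old_pos[OF assms] phys
    by (auto simp: mu_slope_def valid_phys_def intro!: divide_pos_pos mult_pos_pos)
qed

lemma inverse_mobility_pos:
  assumes "K \<in> Kh \<M>"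
  shows "0 < 1 / mobility P (phi_old S K)"
  using phi_old_bounds[OF assms] phys
  by (auto simp: mobility_def permeability_def valid_phys_def intro!: divide_pos_pos mult_pos_pos)

section \<open>The Darcy form and the face fluxes\<close>

definition darcy :: "('d, real^'d) broken \<Rightarrow> ('d, real^'d) broken \<Rightarrow> real" where
  "darcy u w = (\<Sum>K\<in>Kh \<M>. ip_elem K (\<lambda>x. (1 / mobility P (phi_old S K)) *\<^sub>R u K x) (w K))"

definition flux :: "('d, real^'d) broken \<Rightarrow> 'd face \<Rightarrow> real" where
  "flux w e = (LINT x|fm e. c_upw \<M> S e x * (w (fst e) x \<bullet> nrm \<M> e))"

lemma ip_elem_scaled: "ip_elem K (\<lambda>x. k *\<^sub>R f x) g = k * ip_elem K f g"
  by (simp add: ip_elem_def)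

lemma ip_elem_commute: "ip_elem K f g = ip_elem K g f"
  by (simp add: ip_elem_def inner_commute)

lemma ip_elem_self_nonneg: "0 \<le> ip_elem K f f"
  by (auto simp: ip_elem_def set_lebesgue_integral_def intro!: integral_nonneg_AE)

lemma darcy_eq: "darcy u w = (\<Sum>K\<in>Kh \<M>. (1 / mobility P (phi_old S K)) * ip_elem K (u K) (w K))"
  by (simp only: darcy_def ip_elem_scaled)

lemma darcy_lin:
  assumes u: "u \<in> Vh \<M>" and v: "v \<in> Vh \<M>" and w: "w \<in> Vh \<M>"
  shows "darcy (u + fscale r v) w = darcy u w + r * darcy v w"
proof -
  have "ip_elem K ((u + fscale r v) K) (w K) = ip_elem K (u K) (w K) + r * ip_elem K (v K) (w K)"
    if K: "K \<in> Kh \<M>" for K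
  proof -
    have "(u + fscale r v) K = (\<lambda>x. u K x + r *\<^sub>R v K x)" by (simp add: fun_eq_iff)
    then show ?thesis using ip_elem_lin[OF K Vh_continuous[OF u] Vh_continuous[OF v] Vh_continuous[OF w]] by simp
  qed
  then have "darcy (u + fscale r v) w = (\<Sum>K\<in>Kh \<M>. (1 / mobility P (phi_old S K)) * ip_elem K (u K) (w K)
     + r * ((1 / mobility P (phi_old S K)) * ip_elem K (v K) (w K)))"
    unfolding darcy_eq by (intro sum.cong refl) (simp only: distrib_left mult.left_commute)
  then show ?thesis unfolding darcy_eq sum.distrib sum_distrib_left .
qed

lemma flux_lin:
  assumes e: "e \<in> EI \<M>" and u: "u \<in> Vh \<M>" and v: "v \<in> Vh \<M>"
  shows "flux (u + fscale r v) e = flux u e + r * flux v e"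
proof -
  have "uf_old S \<in> Vh \<M>" using state Uh_subset_Vh by (auto simp: valid_state_def)
  then have uo: "continuous_on UNIV (uf_old S (fst e))" by (rule Vh_continuous)
  have [measurable]: "uf_old S (fst e) \<in> borel_measurable borel"
    using uo by (rule borel_measurable_continuous_onI)
  have int: "integrable (fm e) (\<lambda>x. c_upw \<M> S e x * (w (fst e) x \<bullet> nrm \<M> e))" if w: "w \<in> Vh \<M>" for w
  proof (rule face_integrable[OF e])
    have [measurable]: "w (fst e) \<in> borel_measurable borel"
      using Vh_continuous[OF w] by (rule borel_measurable_continuous_onI)
    show "(\<lambda>x. c_upw \<M> S e x * (w (fst e) x \<bullet> nrm \<M> e)) \<in> borel_measurable borel"
      unfolding c_upw_def by measurable
    show "norm (c_upw \<M> S e x * (w (fst e) x \<bullet> nrm \<M> e))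
       \<le> (\<bar>c_old S (fst e)\<bar> + \<bar>c_old S (snd e)\<bar>) * \<bar>w (fst e) x \<bullet> nrm \<M> e\<bar>" for x
      by (auto simp: abs_mult c_upw_def intro!: mult_right_mono)
    show "continuous_on UNIV (\<lambda>x. (\<bar>c_old S (fst e)\<bar> + \<bar>c_old S (snd e)\<bar>) * \<bar>w (fst e) x \<bullet> nrm \<M> e\<bar>)"
      by (intro continuous_intros Vh_continuous[OF w])
  qed
  have "flux (u + fscale r v) e = (LINT x|fm e. c_upw \<M> S e x * (u (fst e) x \<bullet> nrm \<M> e)
     + r * (c_upw \<M> S e x * (v (fst e) x \<bullet> nrm \<M> e)))"
    by (simp add: flux_def inner_add_left algebra_simps)
  also have "\<dots> = flux u e + r * flux v e"
    using int[OF u] int[OF v] by (simp add: flux_def)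
  finally show ?thesis .
qed

text \<open>A vanishing norm on K only yields zeros on a ball inside K, by continuity. Two distinct
  zeros of a + b x force b = 0, hence a = 0, and w vanishes on the whole space.\<close>

lemma radial_affine_null:
  assumes K: "K \<in> Kh \<M>" and w: "\<And>x. w x = a + b *\<^sub>R x" and null: "ip_elem K w w = 0"
  shows "w x = (0 :: real^'d)"
proof -
  have cont: "continuous_on UNIV w" unfolding w[abs_def] by (intro continuous_intros)
  have "integrable lborel (\<lambda>x. indicator K x *\<^sub>R (w x \<bullet> w x))"
    by (intro borel_integrable_compact compact_elem[OF K] continuous_on_inner continuous_on_subset[OF cont]) auto
  then have ae: "AE x in lborel. indicator K x *\<^sub>R (w x \<bullet> w x) = 0"
    using null by (subst integral_nonneg_eq_0_iff_AE[symmetric]) (auto simp: ip_elem_def set_lebesgue_integral_def)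
  obtain z r where zr: "0 < r" "ball z r \<subseteq> K" using ball_in_elem[OF K] .
  have zero: "w y = 0" if y: "y \<in> ball z r" for y
  proof (rule ccontr)
    assume "w y \<noteq> 0"
    have "open (ball z r \<inter> {x. w x \<noteq> 0})"
      by (intro open_Int open_ball open_Collect_neq cont continuous_on_const)
    moreover have "y \<in> ball z r \<inter> {x. w x \<noteq> 0}" using y \<open>w y \<noteq> 0\<close> by blast
    ultimately obtain s where s: "0 < s" "ball y s \<subseteq> ball z r \<inter> {x. w x \<noteq> 0}"
      unfolding open_contains_ball by blast
    have "AE x in lborel. x \<notin> ball y s" using ae
    proof eventually_elim
      case (elim x)
      show ?case
      proof
        assume "x \<in> ball y s"
        then have "x \<in> K" "w x \<noteq> 0" using s(2) zr(2) by blast+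
        then show False using elim by simp
      qed
    qed
    then have "emeasure lborel (ball y s) = 0"
      using AE_iff_null_sets[of "ball y s" lborel] by auto
    then have "measure lborel (ball y s) = 0" by (simp add: measure_def)
    then show False using content_ball_pos[OF s(1), of y] by simp
  qed
  obtain i :: 'd where True by simp
  define y where "y = z + (r / 2) *\<^sub>R axis i 1"
  have "y \<in> ball z r" using zr(1) by (simp add: y_def dist_norm)
  then have az: "a + b *\<^sub>R z = 0" and "a + b *\<^sub>R y = 0"
    using zero[of y] zero[of z] zr(1) unfolding w by simp_all
  moreover have "(a + b *\<^sub>R y) - (a + b *\<^sub>R z) = (b * (r / 2)) *\<^sub>R axis i 1"
    by (simp add: y_def scaleR_add_right)
  ultimately have "(b * (r / 2)) *\<^sub>R axis i (1::real) = 0" by simp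
  then have "b = 0" using zr(1) by (simp add: axis_eq_0_iff)
  then show ?thesis using az unfolding w by simp
qed

lemma darcy_null:
  assumes w: "w \<in> Uh0 \<M>" and null: "darcy w w = 0" and K: "K \<in> Kh \<M>"
  shows "w K x = 0"
proof -
  let ?t = "\<lambda>K. (1 / mobility P (phi_old S K)) * ip_elem K (w K) (w K)"
  have "0 \<le> ?t K" if "K \<in> Kh \<M>" for K
    using that by (intro mult_nonneg_nonneg ip_elem_self_nonneg less_imp_le[OF inverse_mobility_pos])
  then have "?t K = 0"
    using null K sum_nonneg_eq_0_iff[OF finite_Kh, of ?t] unfolding darcy_eq by blast
  then have "ip_elem K (w K) (w K) = 0" using inverse_mobility_pos[OF K] by auto
  moreover obtain a b where "\<And>x. w K x = a + b *\<^sub>R x" using w K unfolding Uh0_def Uh_def by blast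
  ultimately show ?thesis using radial_affine_null[OF K] by blast
qed

text \<open>The second premise is compatibility with the null vectors of \<open>darcy\<close>; by
  \<open>darcy_null\<close> all their pieces on the mesh vanish identically.\<close>

lemma darcy_riesz:
  assumes "\<And>u v r. u \<in> Uh0 \<M> \<Longrightarrow> v \<in> Uh0 \<M> \<Longrightarrow> F (u + fscale r v) = F u + r * F v"
    and "\<And>w. w \<in> Uh0 \<M> \<Longrightarrow> (\<And>K x. K \<in> Kh \<M> \<Longrightarrow> w K x = 0) \<Longrightarrow> F w = 0"
  shows "\<exists>u\<in>Uh0 \<M>. \<forall>w\<in>Uh0 \<M>. darcy u w = F w"
proof -
  obtain G where G: "finite G" "Vh \<M> \<subseteq> module.span fscale G" using Vh_finite_span[OF finite_Kh] by blast
  note sub = Uh0_subset_Vh[THEN subsetD]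
  show ?thesis
  proof (rule riesz_subspace[where V="Uh0 \<M>" and B=darcy and F=F, OF vector_space_fscale subspace_Uh0 G(1)])
    show "Uh0 \<M> \<subseteq> module.span fscale G" using Uh0_subset_Vh G(2) by (rule subset_trans)
    show "darcy (u + fscale r v) w = darcy u w + r * darcy v w" if "u \<in> Uh0 \<M>" "v \<in> Uh0 \<M>" "w \<in> Uh0 \<M>" for u v w r
      using that by (intro darcy_lin sub)
    show "darcy u v = darcy v u" for u v by (simp only: darcy_eq ip_elem_commute)
    show "0 \<le> darcy u u" for u unfolding darcy_eq
      by (intro sum_nonneg mult_nonneg_nonneg ip_elem_self_nonneg less_imp_le[OF inverse_mobility_pos])
    show "F v = 0" if "v \<in> Uh0 \<M>" "darcy v v = 0" for v
      using assms(2)[OF that(1)] darcy_null[OF that] by blast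
  qed (use assms(1) in auto)
qed

lemma flux_lin_Uh0:
  "e \<in> EI \<M> \<Longrightarrow> u \<in> Uh0 \<M> \<Longrightarrow> v \<in> Uh0 \<M> \<Longrightarrow> flux (u + fscale r v) e = flux u e + r * flux v e"
  by (intro flux_lin Uh0_subset_Vh[THEN subsetD])

lemma flux_null:
  assumes "e \<in> EI \<M>" "\<And>K x. K \<in> Kh \<M> \<Longrightarrow> w K x = 0"
  shows "flux w e = 0"
  using assms(2) EI_facts(1)[OF assms(1)] by (simp add: flux_def)

definition darcy_solution :: "('d elem \<Rightarrow> real) \<Rightarrow> ('d, real^'d) broken \<Rightarrow> bool" where
  "darcy_solution \<mu> uf \<longleftrightarrow> uf \<in> Uh0 \<M> \<and>
     (\<forall>w\<in>Uh0 \<M>. darcy uf w = (\<Sum>e\<in>EI \<M>. (\<mu> (fst e) - \<mu> (snd e)) * flux w e))"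

lemma darcy_solution_exists: "\<exists>uf. darcy_solution \<mu> uf"
proof -
  have "\<exists>u\<in>Uh0 \<M>. \<forall>w\<in>Uh0 \<M>. darcy u w = (\<Sum>e\<in>EI \<M>. (\<mu> (fst e) - \<mu> (snd e)) * flux w e)"
  proof (rule darcy_riesz)
    show "(\<Sum>e\<in>EI \<M>. (\<mu> (fst e) - \<mu> (snd e)) * flux (u + fscale r v) e)
       = (\<Sum>e\<in>EI \<M>. (\<mu> (fst e) - \<mu> (snd e)) * flux u e) + r * (\<Sum>e\<in>EI \<M>. (\<mu> (fst e) - \<mu> (snd e)) * flux v e)"
      if "u \<in> Uh0 \<M>" "v \<in> Uh0 \<M>" for u v r
    proof -
      have "(\<Sum>e\<in>EI \<M>. (\<mu> (fst e) - \<mu> (snd e)) * flux (u + fscale r v) e)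
        = (\<Sum>e\<in>EI \<M>. (\<mu> (fst e) - \<mu> (snd e)) * flux u e + r * ((\<mu> (fst e) - \<mu> (snd e)) * flux v e))"
        by (intro sum.cong refl, subst flux_lin_Uh0[OF _ that], assumption) (simp only: distrib_left mult.left_commute)
      then show ?thesis unfolding sum.distrib sum_distrib_left .
    qed
    show "(\<Sum>e\<in>EI \<M>. (\<mu> (fst e) - \<mu> (snd e)) * flux w e) = 0"
      if "w \<in> Uh0 \<M>" "\<And>K x. K \<in> Kh \<M> \<Longrightarrow> w K x = 0" for w
      using flux_null[of _ w] that(2) by (intro sum.neutral ballI) simp
  qed
  then show ?thesis unfolding darcy_solution_def by blast
qed

text \<open>The Riesz representers of the face fluxes express the fluxes of a Darcy velocity
  through the jumps of the chemical potential alone.\<close>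

lemma flux_of_darcy_solution:
  "\<exists>T. \<forall>\<mu> uf. darcy_solution \<mu> uf \<longrightarrow>
     (\<forall>e\<in>EI \<M>. flux uf e = (\<Sum>e'\<in>EI \<M>. (\<mu> (fst e') - \<mu> (snd e')) * T e e'))"
proof -
  have "\<exists>u. u \<in> Uh0 \<M> \<and> (\<forall>w\<in>Uh0 \<M>. darcy u w = flux w e)" if "e \<in> EI \<M>" for e
    using darcy_riesz[of "\<lambda>w. flux w e"] flux_lin_Uh0[OF that] flux_null[OF that] by blast
  then obtain R where R: "\<And>e. e \<in> EI \<M> \<Longrightarrow> R e \<in> Uh0 \<M>" "\<And>e w. e \<in> EI \<M> \<Longrightarrow> w \<in> Uh0 \<M> \<Longrightarrow> darcy (R e) w = flux w e"
    by metis
  have "flux uf e = (\<Sum>e'\<in>EI \<M>. (\<mu> (fst e') - \<mu> (snd e')) * flux (R e) e')"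
    if "darcy_solution \<mu> uf" "e \<in> EI \<M>" for \<mu> uf e
  proof -
    \<comment> \<open>By symmetry of the Darcy form, the representer of the face flux can serve as
      test function in the equation of \<open>uf\<close>.\<close>
    have "flux uf e = darcy uf (R e)"
      using R(2)[OF that(2), of uf] that(1) unfolding darcy_solution_def darcy_eq by (simp add: ip_elem_commute)
    then show ?thesis using that(1) R(1)[OF that(2)] by (simp add: darcy_solution_def)
  qed
  then show ?thesis by (intro exI[of _ "\<lambda>e. flux (R e)"]) blast
qed

section \<open>Elementwise form of the equations\<close>

abbreviation us_incr :: "('d, real^'d) broken \<Rightarrow> ('d, real^'d) broken" where
  "us_incr us \<equiv> us + fscale (- 1) (us_old S)"

lemma us_old_Vh: "us_old S \<in> Vh \<M>"
  using state by (simp add: valid_state_def)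

text \<open>Indicators of elements are admissible tests in \<open>Qh\<close> and elements have
  positive volume, so the pressure and porosity equations decouple into one scalar equation per
  element.\<close>

lemma level_system_iff:
  "level_system \<M> P S \<gamma> \<zeta>2 N c p us uf \<phi> \<longleftrightarrow>
     p \<in> Qh \<M> \<and> us \<in> Vh \<M> \<and> \<phi> \<in> Qh \<M> \<and> darcy_solution (mu_h \<M> P S c) uf \<and>
     (\<forall>v\<in>Vh \<M>. elast \<gamma> \<zeta>2 us v = alpha P * bdiv p v) \<and>
     (\<forall>K\<in>Kh \<M>. p K = c_old S K * mu_h \<M> P S c K - free_energy P (c_old S K)) \<and>
     (\<forall>K\<in>Kh \<M>. vol K * (\<phi> K - phi_old S K) =
        vol K / N * (p K - p_old S K) + alpha P * bdiv (ind K) (us_incr us))"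
  (is "?L \<longleftrightarrow> ?R")
proof -
  \<comment> \<open>One equivalence serves both equations: with k = 0 for the pressure, and with k
    the discrete divergence of the displacement increment for the porosity.\<close>
  have test: "(\<forall>z\<in>Qh \<M>. (\<Sum>K\<in>Kh \<M>. vol K * (f K * z K)) = (\<Sum>K\<in>Kh \<M>. vol K * (g K * z K)) + (\<Sum>K\<in>Kh \<M>. z K * k K))
      \<longleftrightarrow> (\<forall>K\<in>Kh \<M>. vol K * f K = vol K * g K + k K)" for f g k :: "'d elem \<Rightarrow> real"
  proof
    assume A: "\<forall>z\<in>Qh \<M>. (\<Sum>K\<in>Kh \<M>. vol K * (f K * z K)) = (\<Sum>K\<in>Kh \<M>. vol K * (g K * z K)) + (\<Sum>K\<in>Kh \<M>. z K * k K)"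
    show "\<forall>K\<in>Kh \<M>. vol K * f K = vol K * g K + k K"
    proof
      fix K assume K: "K \<in> Kh \<M>"
      show "vol K * f K = vol K * g K + k K"
        using bspec[OF A ind_Qh[OF K]] sum_ind'[OF K, of "\<lambda>K. vol K * f K"] sum_ind'[OF K, of "\<lambda>K. vol K * g K"]
          sum_ind'[OF K, of k] by (simp add: mult.assoc mult.commute[of "ind K _"])
    qed
  next
    assume A: "\<forall>K\<in>Kh \<M>. vol K * f K = vol K * g K + k K"
    have "vol K * (f K * z K) = vol K * (g K * z K) + z K * k K" if "K \<in> Kh \<M>" for z K
      using bspec[OF A that] by (simp add: mult.assoc[symmetric] distrib_right)
    then show "\<forall>z\<in>Qh \<M>. (\<Sum>K\<in>Kh \<M>. vol K * (f K * z K)) = (\<Sum>K\<in>Kh \<M>. vol K * (g K * z K)) + (\<Sum>K\<in>Kh \<M>. z K * k K)"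
      by (simp add: sum.distrib cong: sum.cong)
  qed
  have e1: "(\<forall>v\<in>Vh \<M>. bilinA \<M> P \<gamma> \<zeta>2 us p v = 0) \<longleftrightarrow> (\<forall>v\<in>Vh \<M>. elast \<gamma> \<zeta>2 us v = alpha P * bdiv p v)"
    if "us \<in> Vh \<M>"
    using bilinA_eq[OF that] by simp
  have jmp: "ip_face \<M> e (jump e (pc \<mu>)) (\<lambda>x. c_upw \<M> S e x * (w (fst e) x \<bullet> nrm \<M> e)) = (\<mu> (fst e) - \<mu> (snd e)) * flux w e" for e \<mu> w
    by (simp add: ip_face_def jump_def pc_def flux_def)
  have e2: "(uf \<in> Uh0 \<M> \<and> (\<forall>w\<in>Uh0 \<M>.
        (\<Sum>K\<in>Kh \<M>. ip_elem K (\<lambda>x. (1 / mobility P (phi_old S K)) *\<^sub>R uf K x) (w K)) =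
        (\<Sum>e\<in>EI \<M>. ip_face \<M> e (jump e (pc (mu_h \<M> P S c)))
            (\<lambda>x. c_upw \<M> S e x * (w (fst e) x \<bullet> nrm \<M> e))))) \<longleftrightarrow> darcy_solution (mu_h \<M> P S c) uf"
    unfolding darcy_solution_def darcy_def jmp ..
  have pcc: "pc q K = (\<lambda>x. q K)" for q K by (simp add: pc_def)
  have e3: "(\<forall>z\<in>Qh \<M>. (\<Sum>K\<in>Kh \<M>. ip_elem K (pc p K) (pc z K)) =
        (\<Sum>K\<in>Kh \<M>. ip_elem K (\<lambda>x. c_old S K * mu_h \<M> P S c K - free_energy P (c_old S K)) (pc z K)))
     \<longleftrightarrow> (\<forall>K\<in>Kh \<M>. p K = c_old S K * mu_h \<M> P S c K - free_energy P (c_old S K))"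
    using test[of p "\<lambda>K. c_old S K * mu_h \<M> P S c K - free_energy P (c_old S K)" "\<lambda>_. 0"] vol_pos[THEN less_imp_neq]
    by (simp add: pcc ip_elem_const cong: sum.cong ball_cong)
  have e4: "(\<forall>\<psi>\<in>Qh \<M>.
        (\<Sum>K\<in>Kh \<M>. ip_elem K (\<lambda>x. \<phi> K - phi_old S K) (pc \<psi> K)) =
        1 / N * (\<Sum>K\<in>Kh \<M>. ip_elem K (\<lambda>x. p K - p_old S K) (pc \<psi> K))
        + alpha P * (\<Sum>K\<in>Kh \<M>. ip_elem K (divg (\<lambda>x. us K x - us_old S K x)) (pc \<psi> K))
        - alpha P * (\<Sum>e\<in>EI \<M>. ip_face \<M> e (avg e (\<lambda>K x. \<psi> K *\<^sub>R nrm \<M> e))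
            (jump e (\<lambda>K x. us K x - us_old S K x))))
     \<longleftrightarrow> (\<forall>K\<in>Kh \<M>. vol K * (\<phi> K - phi_old S K) =
        vol K / N * (p K - p_old S K) + alpha P * bdiv (ind K) (us_incr us))" (is "?A \<longleftrightarrow> ?B")
    if us: "us \<in> Vh \<M>"
  proof -
    let ?d = "us_incr us"
    have d: "?d \<in> Vh \<M>" using us us_old_Vh by (rule Vh_lin)
    have eq: "(\<lambda>K x. us K x - us_old S K x) = ?d" by (simp add: fun_eq_iff)
    then have eqK: "(\<lambda>x. us K x - us_old S K x) = ?d K" for K by metis
    have "(\<Sum>K\<in>Kh \<M>. ip_elem K (\<lambda>x. \<phi> K - phi_old S K) (pc \<psi> K)) =
        1 / N * (\<Sum>K\<in>Kh \<M>. ip_elem K (\<lambda>x. p K - p_old S K) (pc \<psi> K))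
        + alpha P * (\<Sum>K\<in>Kh \<M>. ip_elem K (divg (\<lambda>x. us K x - us_old S K x)) (pc \<psi> K))
        - alpha P * (\<Sum>e\<in>EI \<M>. ip_face \<M> e (avg e (\<lambda>K x. \<psi> K *\<^sub>R nrm \<M> e))
            (jump e (\<lambda>K x. us K x - us_old S K x)))
      \<longleftrightarrow> (\<Sum>K\<in>Kh \<M>. vol K * ((\<phi> K - phi_old S K) * \<psi> K)) =
        (\<Sum>K\<in>Kh \<M>. vol K * (1 / N * (p K - p_old S K) * \<psi> K)) + (\<Sum>K\<in>Kh \<M>. \<psi> K * (alpha P * bdiv (ind K) ?d))" for \<psi>
    proof -
      have "alpha P * (\<Sum>K\<in>Kh \<M>. ip_elem K (divg (\<lambda>x. us K x - us_old S K x)) (pc \<psi> K))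
        - alpha P * (\<Sum>e\<in>EI \<M>. ip_face \<M> e (avg e (\<lambda>K x. \<psi> K *\<^sub>R nrm \<M> e))
            (jump e (\<lambda>K x. us K x - us_old S K x))) = alpha P * bdiv \<psi> ?d"
        unfolding bdiv_alt[OF d, symmetric] eq eqK right_diff_distrib by (simp only: ip_elem_commute)
      also have "\<dots> = (\<Sum>K\<in>Kh \<M>. \<psi> K * (alpha P * bdiv (ind K) ?d))"
        unfolding bdiv_decomp[of \<psi>] sum_distrib_left by (simp only: mult.left_commute)
      finally have 1: "alpha P * (\<Sum>K\<in>Kh \<M>. ip_elem K (divg (\<lambda>x. us K x - us_old S K x)) (pc \<psi> K))
        - alpha P * (\<Sum>e\<in>EI \<M>. ip_face \<M> e (avg e (\<lambda>K x. \<psi> K *\<^sub>R nrm \<M> e))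
            (jump e (\<lambda>K x. us K x - us_old S K x))) = (\<Sum>K\<in>Kh \<M>. \<psi> K * (alpha P * bdiv (ind K) ?d))" .
      have 2: "1 / N * (\<Sum>K\<in>Kh \<M>. ip_elem K (\<lambda>x. p K - p_old S K) (pc \<psi> K))
        = (\<Sum>K\<in>Kh \<M>. vol K * (1 / N * (p K - p_old S K) * \<psi> K))"
        by (simp add: pcc ip_elem_const sum_distrib_left mult_ac cong: sum.cong)
      have 3: "(\<Sum>K\<in>Kh \<M>. ip_elem K (\<lambda>x. \<phi> K - phi_old S K) (pc \<psi> K)) = (\<Sum>K\<in>Kh \<M>. vol K * ((\<phi> K - phi_old S K) * \<psi> K))"
        by (simp add: pcc ip_elem_const cong: sum.cong)
      show ?thesis using 1 unfolding 2 3 by linarith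
    qed
    then show ?thesis
      using test[of "\<lambda>K. \<phi> K - phi_old S K" "\<lambda>K. 1 / N * (p K - p_old S K)" "\<lambda>K. alpha P * bdiv (ind K) ?d"] by simp
  qed
  show ?thesis unfolding level_system_def using e1 e2 e3 e4 by blast
qed

text \<open>On a face of measure zero all integrals vanish, and so does the penalty weight, since \<open>1 / 0 = 0\<close>;
  such faces do not connect elements in the graph of the mass balance.\<close>

definition Ep :: "'d face set" where
  "Ep = {e \<in> EI \<M>. h_face \<M> e \<noteq> 0}"

lemma Ep_facts: "finite Ep" "Ep \<subseteq> EI \<M>"
  using finite_EI by (auto simp: Ep_def)

lemma flux_degenerate:
  assumes "e \<in> EI \<M>" "e \<notin> Ep"
  shows "flux w e = 0"
  using null_face_integral[OF assms(1)] assms by (simp add: flux_def Ep_def)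

text \<open>Jumps of piecewise constants are constant along a face, so the weight 1/h cancels the
  mass h of the face: the penalty is the graph Laplacian with unit edge weights.\<close>

lemma penalty_sum:
  "(\<Sum>e\<in>EI \<M>. \<zeta> / h_face \<M> e * ip_face \<M> e (jump e (pc q)) (jump e (pc z)))
    = \<zeta> * (\<Sum>e\<in>Ep. (q (fst e) - q (snd e)) * (z (fst e) - z (snd e)))"
proof -
  have "\<zeta> / h_face \<M> e * ip_face \<M> e (jump e (pc q)) (jump e (pc z))
     = (if h_face \<M> e \<noteq> 0 then \<zeta> * ((q (fst e) - q (snd e)) * (z (fst e) - z (snd e))) else 0)" for e
    by (simp add: ip_face_def jump_def pc_def h_face_def face_measure_def)
  then have "(\<Sum>e\<in>EI \<M>. \<zeta> / h_face \<M> e * ip_face \<M> e (jump e (pc q)) (jump e (pc z)))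
     = (\<Sum>e\<in>EI \<M>. if h_face \<M> e \<noteq> 0 then \<zeta> * ((q (fst e) - q (snd e)) * (z (fst e) - z (snd e))) else 0)"
    by simp
  also have "\<dots> = (\<Sum>e\<in>Ep. \<zeta> * ((q (fst e) - q (snd e)) * (z (fst e) - z (snd e))))"
    unfolding Ep_def using finite_EI by (rule sum.inter_filter[symmetric])
  finally show ?thesis by (simp add: sum_distrib_left)
qed

text \<open>Brings the balance into the form of a reaction-diffusion system on the graph, where the
  test function is an arbitrary function of the elements.\<close>

lemma mass_eq_iff:
  "mass_eq \<M> P S \<zeta>1 \<phi> uf c' \<longleftrightarrow>
     (\<forall>q. (\<Sum>K\<in>Kh \<M>. vol K * (\<phi> K * c' K - phi_old S K * c_old S K) / tau P * q K)
        + (\<Sum>e\<in>Ep. flux uf e * (q (fst e) - q (snd e)))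
        + \<zeta>1 * (\<Sum>e\<in>Ep. (mu_h \<M> P S c' (fst e) - mu_h \<M> P S c' (snd e)) * (q (fst e) - q (snd e))) = 0)"
  (is "_ \<longleftrightarrow> (\<forall>q. ?X q = 0)")
proof -
  have f: "(\<Sum>e\<in>EI \<M>. ip_face \<M> e (\<lambda>x. c_upw \<M> S e x * (uf (fst e) x \<bullet> nrm \<M> e)) (jump e (pc q)))
      = (\<Sum>e\<in>Ep. flux uf e * (q (fst e) - q (snd e)))" for q
  proof -
    have "(\<Sum>e\<in>EI \<M>. ip_face \<M> e (\<lambda>x. c_upw \<M> S e x * (uf (fst e) x \<bullet> nrm \<M> e)) (jump e (pc q)))
      = (\<Sum>e\<in>EI \<M>. flux uf e * (q (fst e) - q (snd e)))"
      by (simp add: ip_face_def jump_def pc_def flux_def)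
    also have "\<dots> = (\<Sum>e\<in>Ep. flux uf e * (q (fst e) - q (snd e)))"
      using Ep_facts finite_EI flux_degenerate by (intro sum.mono_neutral_right) auto
    finally show ?thesis .
  qed
  have t: "(\<Sum>K\<in>Kh \<M>. ip_elem K (\<lambda>x. (\<phi> K * c' K - phi_old S K * c_old S K) / tau P) (pc q K))
     = (\<Sum>K\<in>Kh \<M>. vol K * (\<phi> K * c' K - phi_old S K * c_old S K) / tau P * q K)" for q
    by (intro sum.cong refl) (simp add: pc_def ip_elem_const)
  have eq: "mass_eq \<M> P S \<zeta>1 \<phi> uf c' \<longleftrightarrow> (\<forall>q\<in>Qh \<M>. ?X q = 0)"
    unfolding mass_eq_def f t penalty_sum ..
  \<comment> \<open>Only values on elements of the mesh enter, so cutting q off outside the mesh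
    changes nothing and places it in \<open>Qh\<close>.\<close>
  have cut: "?X q = ?X (\<lambda>K. if K \<in> Kh \<M> then q K else 0)" for q
  proof -
    have "fst e \<in> Kh \<M>" "snd e \<in> Kh \<M>" if "e \<in> Ep" for e using that Ep_facts(2) EI_facts(1,2) by blast+
    then show ?thesis by (simp cong: sum.cong)
  qed
  have Qhq: "(\<lambda>K. if K \<in> Kh \<M> then q K else 0) \<in> Qh \<M>" for q :: "'d elem \<Rightarrow> real" by (simp add: Qh_def)
  show ?thesis
  proof
    assume "mass_eq \<M> P S \<zeta>1 \<phi> uf c'"
    then have A: "\<forall>q\<in>Qh \<M>. ?X q = 0" by (rule eq[THEN iffD1])
    show "\<forall>q. ?X q = 0"
      by (rule allI, rule trans[OF cut], rule bspec[OF A Qhq])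
  next
    assume "\<forall>q. ?X q = 0"
    then show "mass_eq \<M> P S \<zeta>1 \<phi> uf c'" unfolding eq by simp
  qed
qed

text \<open>Bundles what a sufficiently large \<zeta>2 provides, with k the mesh constant of
  \<open>elast_coercive\<close>; the estimates below meet \<zeta>2 only through this
  predicate.\<close>

definition stable :: "real \<Rightarrow> real \<Rightarrow> real \<Rightarrow> bool" where
  "stable k \<gamma> \<zeta>2 \<longleftrightarrow> 0 < k \<and> 0 < \<gamma> \<and>
     (\<forall>v\<in>Vh \<M>. k * \<gamma> * (L2_set (\<lambda>K. bdiv (ind K) v) (Kh \<M>))\<^sup>2 \<le> elast \<gamma> \<zeta>2 v v)"

lemma stable_nonneg:
  assumes "stable k \<gamma> \<zeta>2" "v \<in> Vh \<M>"
  shows "0 \<le> elast \<gamma> \<zeta>2 v v"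
proof -
  have "0 \<le> k * \<gamma> * (L2_set (\<lambda>K. bdiv (ind K) v) (Kh \<M>))\<^sup>2" using assms by (simp add: stable_def)
  also have "\<dots> \<le> elast \<gamma> \<zeta>2 v v" using assms unfolding stable_def by blast
  finally show ?thesis .
qed

text \<open>The form may have a kernel, such as rigid motions. Stability shows that the discrete
  divergence vanishes there, so the right-hand side is compatible for every pressure.\<close>

lemma elast_solution_exists:
  assumes st: "stable k \<gamma> \<zeta>2"
  shows "\<exists>u\<in>Vh \<M>. \<forall>v\<in>Vh \<M>. elast \<gamma> \<zeta>2 u v = alpha P * bdiv p v"
proof -
  obtain G where G: "finite G" "Vh \<M> \<subseteq> module.span fscale G" using Vh_finite_span[OF finite_Kh] by blast
  show ?thesis
  proof (rule riesz_subspace[where V="Vh \<M>" and B="elast \<gamma> \<zeta>2" and F="\<lambda>v. alpha P * bdiv p v",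
        OF vector_space_fscale subspace_Vh G elast_lin elast_commute stable_nonneg[OF st]])
    show "alpha P * bdiv p (u + fscale r v) = alpha P * bdiv p u + r * (alpha P * bdiv p v)"
      if "u \<in> Vh \<M>" "v \<in> Vh \<M>" for u v r
      unfolding bdiv_lin[OF that] by (simp only: distrib_left mult.left_commute)
    show "alpha P * bdiv p v = 0" if v: "v \<in> Vh \<M>" and null: "elast \<gamma> \<zeta>2 v v = 0" for v
    proof -
      have "k * \<gamma> * (L2_set (\<lambda>K. bdiv (ind K) v) (Kh \<M>))\<^sup>2 \<le> 0" using st v null by (force simp: stable_def)
      then have "L2_set (\<lambda>K. bdiv (ind K) v) (Kh \<M>) = 0" using st by (simp add: stable_def mult_le_0_iff)
      then have "bdiv (ind K) v = 0" if "K \<in> Kh \<M>" for K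
        using that finite_Kh by (simp add: L2_set_eq_0_iff)
      then show ?thesis by (subst bdiv_decomp) simp
    qed
  qed
qed

lemma level_system_exists:
  assumes st: "stable k \<gamma> \<zeta>2"
  shows "\<exists>p us uf \<phi>. level_system \<M> P S \<gamma> \<zeta>2 N c p us uf \<phi>"
proof -
  define p where "p = (\<lambda>K. if K \<in> Kh \<M> then c_old S K * mu_h \<M> P S c K - free_energy P (c_old S K) else 0)"
  obtain us where us: "us \<in> Vh \<M>" "\<forall>v\<in>Vh \<M>. elast \<gamma> \<zeta>2 us v = alpha P * bdiv p v"
    using elast_solution_exists[OF st] by blast
  obtain uf where uf: "darcy_solution (mu_h \<M> P S c) uf" using darcy_solution_exists by blast
  define \<phi> where "\<phi> = (\<lambda>K. if K \<in> Kh \<M> then phi_old S K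
     + ((p K - p_old S K) / N + alpha P * bdiv (ind K) (us_incr us) / vol K) else 0)"
  have "vol K * (\<phi> K - phi_old S K) = vol K / N * (p K - p_old S K) + alpha P * bdiv (ind K) (us_incr us)"
    if "K \<in> Kh \<M>" for K
    using that vol_pos[OF that] by (simp add: \<phi>_def distrib_left)
  then have "level_system \<M> P S \<gamma> \<zeta>2 N c p us uf \<phi>"
    unfolding level_system_iff using us uf by (auto simp: p_def \<phi>_def Qh_def)
  then show ?thesis by blast
qed

lemma mu_h_split:
  "mu_h \<M> P S c K = (chem_pot P (c_old S K) - mu_slope \<M> P S K * c_old S K) + mu_slope \<M> P S K * c K"
  by (simp add: mu_h_def algebra_simps)

text \<open>In the unknown \<open>mu_slope * c'\<close> the penalty term becomes symmetric. With
  positive porosity the form is definite on \<open>Qh\<close>, so the Riesz theorem applies.\<close>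

lemma mass_eq_exists:
  assumes phi: "\<And>K. K \<in> Kh \<M> \<Longrightarrow> 0 < \<phi> K" and z: "0 \<le> \<zeta>1"
  shows "\<exists>c'\<in>Qh \<M>. mass_eq \<M> P S \<zeta>1 \<phi> uf c'"
proof -
  let ?s = "mu_slope \<M> P S"
  define sc where "sc = (\<lambda>(r::real) (f::'d elem \<Rightarrow> real) x. r * f x)"
  interpret vector_space sc unfolding sc_def by (rule vector_space_fun)
  define jmp where "jmp q e = q (fst e) - q (snd e)" for q :: "'d elem \<Rightarrow> real" and e
  \<comment> \<open>The reaction coefficient after the substitution; dividing by the slope undoes
    the change of unknown.\<close>
  define D where "D K = vol K * \<phi> K / (tau P * ?s K)" for K
  define B where "B u v = (\<Sum>K\<in>Kh \<M>. D K * u K * v K) + \<zeta>1 * (\<Sum>e\<in>Ep. jmp u e * jmp v e)" for u v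
  \<comment> \<open>The part of the linearised chemical potential that does not depend on the new
    concentration; its jumps are moved to the right-hand side.\<close>
  define \<kappa> where "\<kappa> K = chem_pot P (c_old S K) - ?s K * c_old S K" for K
  define a where "a K = vol K * (phi_old S K * c_old S K) / tau P" for K
  define F where "F q = (\<Sum>K\<in>Kh \<M>. a K * q K) + (\<Sum>e\<in>Ep. (- flux uf e - \<zeta>1 * jmp \<kappa> e) * jmp q e)" for q
  have D: "0 < D K" if "K \<in> Kh \<M>" for K
    unfolding D_def using phi[OF that] vol_pos[OF that] mu_slope_pos[OF that] tau_pos by simp
  have app: "(u + sc r v) K = u K + r * v K" for u r v K by (simp add: sc_def)
  have japp: "jmp (u + sc r v) e = jmp u e + r * jmp v e" for u r v e
    unfolding jmp_def app by (simp add: algebra_simps)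
  have cl: "u + sc r v \<in> Qh \<M>" if "u \<in> Qh \<M>" "v \<in> Qh \<M>" for u v r
    using that unfolding Qh_def mem_Collect_eq app by simp
  have z0: "0 \<in> Qh \<M>" by (simp add: Qh_def)
  have "u + v \<in> Qh \<M>" "sc r v \<in> Qh \<M>" if "u \<in> Qh \<M>" "v \<in> Qh \<M>" for u v r
    using cl[OF that, of 1] cl[OF z0 that(2), of r] by simp_all
  then have sub: "subspace (Qh \<M>)" using z0 unfolding subspace_def by blast
  have span: "Qh \<M> \<subseteq> span (ind ` Kh \<M>)"
  proof
    fix q assume q: "q \<in> Qh \<M>"
    have "q = (\<Sum>K\<in>Kh \<M>. sc (q K) (ind K))"
    proof
      fix K'
      have "(\<Sum>K\<in>Kh \<M>. sc (q K) (ind K)) K' = (\<Sum>K\<in>Kh \<M>. q K * ind K K')"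
        by (simp add: sum_fun_apply sc_def)
      also have "\<dots> = q K'"
      proof (cases "K' \<in> Kh \<M>")
        case False
        then show ?thesis using q by (auto simp: Qh_def ind_def intro!: sum.neutral)
      qed (rule sum_ind)
      finally show "q K' = (\<Sum>K\<in>Kh \<M>. sc (q K) (ind K)) K'" by simp
    qed
    also have "\<dots> \<in> span (ind ` Kh \<M>)" by (intro span_sum span_scale span_base imageI)
    finally show "q \<in> span (ind ` Kh \<M>)" .
  qed
  have fin: "finite (ind ` Kh \<M>)" using finite_Kh by simp
  have "\<exists>u\<in>Qh \<M>. \<forall>v\<in>Qh \<M>. B u v = F v"
  proof (rule riesz_subspace[OF vector_space_axioms sub fin span])
    fix u v w r
    have "(\<Sum>K\<in>Kh \<M>. D K * (u + sc r v) K * w K) = (\<Sum>K\<in>Kh \<M>. D K * u K * w K + r * (D K * v K * w K))"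
      unfolding app by (simp add: algebra_simps)
    moreover have "(\<Sum>e\<in>Ep. jmp (u + sc r v) e * jmp w e) = (\<Sum>e\<in>Ep. jmp u e * jmp w e + r * (jmp v e * jmp w e))"
      unfolding japp by (simp add: algebra_simps)
    ultimately show "B (u + sc r v) w = B u w + r * B v w"
      unfolding B_def sum.distrib sum_distrib_left[symmetric] by (simp add: algebra_simps)
    show "B u v = B v u" unfolding B_def by (simp add: mult_ac)
    have "0 \<le> D K * u K * u K" if "K \<in> Kh \<M>" for K using D[OF that] by (simp add: mult.assoc)
    then have "0 \<le> (\<Sum>K\<in>Kh \<M>. D K * u K * u K)" by (rule sum_nonneg)
    moreover have "0 \<le> \<zeta>1 * (\<Sum>e\<in>Ep. jmp u e * jmp u e)" using z by (simp add: sum_nonneg)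
    ultimately show "0 \<le> B u u" unfolding B_def by (rule add_nonneg_nonneg)
    have "(\<Sum>K\<in>Kh \<M>. a K * (u + sc r v) K) = (\<Sum>K\<in>Kh \<M>. a K * u K + r * (a K * v K))"
      unfolding app by (simp add: algebra_simps)
    moreover have "(\<Sum>e\<in>Ep. (- flux uf e - \<zeta>1 * jmp \<kappa> e) * jmp (u + sc r v) e)
       = (\<Sum>e\<in>Ep. (- flux uf e - \<zeta>1 * jmp \<kappa> e) * jmp u e + r * ((- flux uf e - \<zeta>1 * jmp \<kappa> e) * jmp v e))"
      unfolding japp by (simp only: distrib_left mult.left_commute)
    ultimately show "F (u + sc r v) = F u + r * F v"
      unfolding F_def sum.distrib sum_distrib_left[symmetric] by (simp only: distrib_left)
  next
    fix q assume q: "q \<in> Qh \<M>" and null: "B q q = 0"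
    have nn: "0 \<le> D K * q K * q K" if "K \<in> Kh \<M>" for K using D[OF that] by (simp add: mult.assoc)
    have "0 \<le> \<zeta>1 * (\<Sum>e\<in>Ep. jmp q e * jmp q e)" using z by (simp add: sum_nonneg)
    then have "(\<Sum>K\<in>Kh \<M>. D K * q K * q K) = 0" using null sum_nonneg[of "Kh \<M>", OF nn] unfolding B_def by force
    then have "D K * q K * q K = 0" if "K \<in> Kh \<M>" for K
      using sum_nonneg_eq_0_iff[of "Kh \<M>" "\<lambda>K. D K * q K * q K", OF finite_Kh nn] that by blast
    then have "q K = 0" for K using D q by (cases "K \<in> Kh \<M>") (force simp: Qh_def)+
    then show "F q = 0" by (simp add: F_def jmp_def)
  qed
  then obtain u where u: "u \<in> Qh \<M>" "\<And>v. v \<in> Qh \<M> \<Longrightarrow> B u v = F v" by blast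
  define c' where "c' K = (if K \<in> Kh \<M> then u K / ?s K else 0)" for K
  have sc': "?s K * c' K = u K" if "K \<in> Kh \<M>" for K using mu_slope_pos[OF that] that by (simp add: c'_def)
  have "c' \<in> Qh \<M>" by (simp add: Qh_def c'_def)
  moreover have "(\<Sum>K\<in>Kh \<M>. vol K * (\<phi> K * c' K - phi_old S K * c_old S K) / tau P * q K)
        + (\<Sum>e\<in>Ep. flux uf e * (q (fst e) - q (snd e)))
        + \<zeta>1 * (\<Sum>e\<in>Ep. (mu_h \<M> P S c' (fst e) - mu_h \<M> P S c' (snd e)) * (q (fst e) - q (snd e))) = 0" for q
  proof -
    define q' where "q' K = (if K \<in> Kh \<M> then q K else 0)" for K
    have fs: "fst e \<in> Kh \<M>" "snd e \<in> Kh \<M>" if "e \<in> Ep" for e using that Ep_facts(2) EI_facts(1,2) by blast+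
    have j: "jmp q' e = q (fst e) - q (snd e)" if "e \<in> Ep" for e using fs[OF that] by (simp add: q'_def jmp_def)
    have "vol K * (\<phi> K * c' K - phi_old S K * c_old S K) / tau P * q K = D K * u K * q' K - a K * q' K"
      if K: "K \<in> Kh \<M>" for K
      using K mu_slope_pos[OF K] tau_pos by (simp add: D_def a_def c'_def q'_def field_simps)
    then have 1: "(\<Sum>K\<in>Kh \<M>. vol K * (\<phi> K * c' K - phi_old S K * c_old S K) / tau P * q K)
       = (\<Sum>K\<in>Kh \<M>. D K * u K * q' K) - (\<Sum>K\<in>Kh \<M>. a K * q' K)"
      unfolding sum_subtractf[symmetric] by (rule sum.cong[OF refl])
    have "mu_h \<M> P S c' (fst e) - mu_h \<M> P S c' (snd e) = jmp \<kappa> e + jmp u e" if "e \<in> Ep" for e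
      unfolding mu_h_split sc'[OF fs(1)[OF that]] sc'[OF fs(2)[OF that]] jmp_def \<kappa>_def by simp
    then have 2: "(\<Sum>e\<in>Ep. (mu_h \<M> P S c' (fst e) - mu_h \<M> P S c' (snd e)) * (q (fst e) - q (snd e)))
      = (\<Sum>e\<in>Ep. jmp \<kappa> e * jmp q' e) + (\<Sum>e\<in>Ep. jmp u e * jmp q' e)"
      unfolding sum.distrib[symmetric] by (intro sum.cong refl) (simp only: j distrib_right)
    have 3: "(\<Sum>e\<in>Ep. flux uf e * (q (fst e) - q (snd e))) = (\<Sum>e\<in>Ep. flux uf e * jmp q' e)"
      by (intro sum.cong refl) (simp only: j)
    have 4: "(\<Sum>e\<in>Ep. (- flux uf e - \<zeta>1 * jmp \<kappa> e) * jmp q' e)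
      = - (\<Sum>e\<in>Ep. flux uf e * jmp q' e) - \<zeta>1 * (\<Sum>e\<in>Ep. jmp \<kappa> e * jmp q' e)"
      by (simp add: left_diff_distrib sum_subtractf sum_negf sum_distrib_left mult.assoc)
    have "q' \<in> Qh \<M>" by (simp add: Qh_def q'_def)
    then have "B u q' = F q'" by (rule u(2))
    then show ?thesis unfolding 1 2 3 unfolding B_def F_def 4 by (simp add: algebra_simps)
  qed
  then have "mass_eq \<M> P S \<zeta>1 \<phi> uf c'" unfolding mass_eq_iff by blast
  ultimately show ?thesis by blast
qed

lemma darcy_solution_diff:
  assumes "darcy_solution \<mu>1 u1" "darcy_solution \<mu>2 u2"
  shows "darcy_solution (\<lambda>K. \<mu>1 K - \<mu>2 K) (u1 + fscale (- 1) u2)"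
proof -
  have u: "u1 \<in> Uh0 \<M>" "u2 \<in> Uh0 \<M>" using assms by (auto simp: darcy_solution_def)
  have "darcy (u1 + fscale (- 1) u2) w = (\<Sum>e\<in>EI \<M>. ((\<mu>1 (fst e) - \<mu>2 (fst e)) - (\<mu>1 (snd e) - \<mu>2 (snd e))) * flux w e)"
    if w: "w \<in> Uh0 \<M>" for w
  proof -
    have "darcy (u1 + fscale (- 1) u2) w = darcy u1 w - darcy u2 w"
      using darcy_lin[of u1 u2 w "-1"] u w Uh0_subset_Vh by (auto simp del: plus_fun_apply)
    also have "\<dots> = (\<Sum>e\<in>EI \<M>. (\<mu>1 (fst e) - \<mu>1 (snd e)) * flux w e - (\<mu>2 (fst e) - \<mu>2 (snd e)) * flux w e)"
      using assms w unfolding darcy_solution_def sum_subtractf by simp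
    finally show ?thesis by (simp add: algebra_simps)
  qed
  then show ?thesis using Uh0_lin[OF u] unfolding darcy_solution_def by blast
qed

subsection \<open>A priori estimates\<close>

lemma jump_L2_bound:
  "L2_set (\<lambda>e. q (fst e) - q (snd e)) Ep \<le> 2 * real (card Ep) * L2_set q (Kh \<M>)"
proof -
  have "L2_set (\<lambda>e. q (fst e) - q (snd e)) Ep \<le> real (card Ep) * (2 * L2_set q (Kh \<M>))"
  proof (rule L2_set_le_const)
    fix e assume "e \<in> Ep"
    then have "fst e \<in> Kh \<M>" "snd e \<in> Kh \<M>" using Ep_facts(2) EI_facts(1,2) by blast+
    then have "\<bar>q (fst e)\<bar> \<le> L2_set q (Kh \<M>)" "\<bar>q (snd e)\<bar> \<le> L2_set q (Kh \<M>)"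
      by (auto intro: abs_le_L2_set[OF finite_Kh])
    then show "\<bar>q (fst e) - q (snd e)\<bar> \<le> 2 * L2_set q (Kh \<M>)" by linarith
  qed (simp_all add: Ep_facts)
  then show ?thesis by simp
qed

text \<open>The representation of fluxes by potential jumps has finitely many coefficients, fixed by
  the mesh and the old time level, so the constant is free of all parameters of the
  iteration.\<close>

lemma flux_bound:
  "\<exists>C>0. \<forall>\<mu> uf. darcy_solution \<mu> uf \<longrightarrow> L2_set (flux uf) Ep \<le> C * L2_set \<mu> (Kh \<M>)"
proof -
  obtain T where T: "\<And>\<mu> uf e. darcy_solution \<mu> uf \<Longrightarrow> e \<in> EI \<M> \<Longrightarrow>
     flux uf e = (\<Sum>e'\<in>EI \<M>. (\<mu> (fst e') - \<mu> (snd e')) * T e e')"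
    using flux_of_darcy_solution by blast
  obtain b where b: "0 < b" "\<forall>x\<in>EI \<M> \<times> EI \<M>. \<bar>(case x of (e, e') \<Rightarrow> T e e')\<bar> \<le> b"
    using finite_upper_bound[of "EI \<M> \<times> EI \<M>" "\<lambda>(e, e'). T e e'"] finite_EI by auto
  define C where "C = real (card Ep) * (real (card (EI \<M>)) * (2 * b)) + 1"
  have "L2_set (flux uf) Ep \<le> C * L2_set \<mu> (Kh \<M>)" if d: "darcy_solution \<mu> uf" for \<mu> uf
  proof -
    let ?n = "L2_set \<mu> (Kh \<M>)"
    have "\<bar>flux uf e\<bar> \<le> real (card (EI \<M>)) * (2 * ?n * b)" if "e \<in> Ep" for e
    proof -
      have e: "e \<in> EI \<M>" using that Ep_facts(2) by blast
      have "\<bar>flux uf e\<bar> \<le> (\<Sum>e'\<in>EI \<M>. \<bar>(\<mu> (fst e') - \<mu> (snd e')) * T e e'\<bar>)"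
        unfolding T[OF d e] by (rule sum_abs)
      also have "\<dots> \<le> real (card (EI \<M>)) * (2 * ?n * b)"
      proof (rule sum_bounded_above)
        fix e' assume e': "e' \<in> EI \<M>"
        have "\<bar>\<mu> (fst e')\<bar> \<le> ?n" "\<bar>\<mu> (snd e')\<bar> \<le> ?n"
          using EI_facts(1,2)[OF e'] by (auto intro: abs_le_L2_set[OF finite_Kh])
        then have "\<bar>\<mu> (fst e') - \<mu> (snd e')\<bar> \<le> 2 * ?n" by linarith
        moreover have "\<bar>T e e'\<bar> \<le> b" using b(2) e e' by auto
        ultimately show "\<bar>(\<mu> (fst e') - \<mu> (snd e')) * T e e'\<bar> \<le> 2 * ?n * b"
          unfolding abs_mult by (intro mult_mono) auto
      qed
      finally show ?thesis .
    qed
    then have "L2_set (flux uf) Ep \<le> real (card Ep) * (real (card (EI \<M>)) * (2 * ?n * b))"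
      using b(1) Ep_facts(1) by (intro L2_set_le_const) auto
    also have "\<dots> \<le> C * ?n" by (simp add: C_def algebra_simps)
    finally show ?thesis .
  qed
  moreover have "0 < C" using b(1) by (simp add: C_def add_nonneg_pos)
  ultimately show ?thesis by blast
qed

text \<open>The graph estimate for \<open>mu_slope * y\<close>. Porosities in [m, 1) confine the
  reaction coefficient to a fixed positive interval, which makes the constant uniform in the
  porosity.\<close>

lemma mass_stability:
  assumes m: "0 < m"
  shows "\<exists>C>0. \<forall>\<zeta>1\<ge>C. \<forall>\<phi> y f g. (\<forall>K\<in>Kh \<M>. m \<le> \<phi> K \<and> \<phi> K < 1) \<longrightarrow>
     (\<forall>q. (\<Sum>K\<in>Kh \<M>. vol K * \<phi> K / tau P * y K * q K)
        + \<zeta>1 * (\<Sum>e\<in>Ep. (mu_slope \<M> P S (fst e) * y (fst e) - mu_slope \<M> P S (snd e) * y (snd e)) * (q (fst e) - q (snd e)))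
      = (\<Sum>K\<in>Kh \<M>. f K * q K) + (\<Sum>e\<in>Ep. g e * (q (fst e) - q (snd e)))) \<longrightarrow>
     L2_set y (Kh \<M>) \<le> C * (L2_set f (Kh \<M>) + L2_set g Ep / \<zeta>1)"
proof -
  let ?s = "mu_slope \<M> P S"
  obtain va where va: "0 < va" "\<forall>K\<in>Kh \<M>. va \<le> vol K" using finite_lower_bound[of "Kh \<M>" vol, OF finite_Kh vol_pos] by blast
  obtain vb where vb: "0 < vb" "\<forall>K\<in>Kh \<M>. \<bar>vol K\<bar> \<le> vb" using finite_upper_bound[of "Kh \<M>" vol, OF finite_Kh] by blast
  obtain sa where sa: "0 < sa" "\<forall>K\<in>Kh \<M>. sa \<le> ?s K" using finite_lower_bound[of "Kh \<M>" ?s, OF finite_Kh mu_slope_pos] by blast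
  obtain sb where sb: "0 < sb" "\<forall>K\<in>Kh \<M>. \<bar>?s K\<bar> \<le> sb" using finite_upper_bound[of "Kh \<M>" ?s, OF finite_Kh] by blast
  have d0: "0 < va * m / (tau P * sb)" using va m sb tau_pos by simp
  obtain C where C: "0 < C" and est: "\<And>\<zeta> D \<psi> f g. \<lbrakk>C \<le> \<zeta>;
     \<forall>K\<in>Kh \<M>. va * m / (tau P * sb) \<le> D K \<and> D K \<le> vb / (tau P * sa);
     \<forall>q. (\<Sum>K\<in>Kh \<M>. D K * \<psi> K * q K) + \<zeta> * (\<Sum>e\<in>Ep. (\<psi> (fst e) - \<psi> (snd e)) * (q (fst e) - q (snd e)))
      = (\<Sum>K\<in>Kh \<M>. f K * q K) + (\<Sum>e\<in>Ep. g e * (q (fst e) - q (snd e)))\<rbrakk> \<Longrightarrow>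
     L2_set \<psi> (Kh \<M>) \<le> C * (L2_set f (Kh \<M>) + L2_set g Ep / \<zeta>)"
    using graph_reaction_diffusion_estimate[OF Ep_facts(1) finite_Kh d0, of "vb / (tau P * sa)"] by blast
  have "L2_set y (Kh \<M>) \<le> (C + C / sa) * (L2_set f (Kh \<M>) + L2_set g Ep / \<zeta>1)"
    if z: "C + C / sa \<le> \<zeta>1" and phi: "\<forall>K\<in>Kh \<M>. m \<le> \<phi> K \<and> \<phi> K < 1"
      and eq: "\<forall>q. (\<Sum>K\<in>Kh \<M>. vol K * \<phi> K / tau P * y K * q K)
        + \<zeta>1 * (\<Sum>e\<in>Ep. (?s (fst e) * y (fst e) - ?s (snd e) * y (snd e)) * (q (fst e) - q (snd e)))
      = (\<Sum>K\<in>Kh \<M>. f K * q K) + (\<Sum>e\<in>Ep. g e * (q (fst e) - q (snd e)))" for \<zeta>1 \<phi> y f g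
  proof -
    have zC: "C \<le> \<zeta>1" using z C sa(1) by (smt (verit) divide_pos_pos)
    have zp: "0 < \<zeta>1" using zC C by linarith
    define D where "D K = vol K * \<phi> K / (tau P * ?s K)" for K
    have Db: "va * m / (tau P * sb) \<le> D K \<and> D K \<le> vb / (tau P * sa)" if K: "K \<in> Kh \<M>" for K
    proof -
      have b: "va \<le> vol K" "vol K \<le> vb" "sa \<le> ?s K" "?s K \<le> sb" "m \<le> \<phi> K" "\<phi> K \<le> 1"
        using va vb sa sb phi K by (auto simp: abs_le_iff less_imp_le)
      have "va * m \<le> vol K * \<phi> K" using b va(1) m by (intro mult_mono) auto
      moreover have "tau P * ?s K \<le> tau P * sb" using b tau_pos by simp
      moreover have "vol K * \<phi> K \<le> vb * 1" using b va(1) vb(1) m by (intro mult_mono) auto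
      moreover have "tau P * sa \<le> tau P * ?s K" using b tau_pos by simp
      moreover have "0 < va * m" "0 < tau P * ?s K" "0 < tau P * sa"
        using va(1) m sa(1) tau_pos mu_slope_pos[OF K] by simp_all
      ultimately show ?thesis
        unfolding D_def by (intro conjI frac_le) linarith+
    qed
    have "L2_set (\<lambda>K. ?s K * y K) (Kh \<M>) \<le> C * (L2_set f (Kh \<M>) + L2_set g Ep / \<zeta>1)"
    proof (rule est[OF zC])
      show "\<forall>K\<in>Kh \<M>. va * m / (tau P * sb) \<le> D K \<and> D K \<le> vb / (tau P * sa)" using Db by blast
      have "D K * (?s K * y K) * q = vol K * \<phi> K / tau P * y K * q" if "K \<in> Kh \<M>" for K q
        using mu_slope_pos[OF that] by (simp add: D_def)
      then show "\<forall>q. (\<Sum>K\<in>Kh \<M>. D K * (?s K * y K) * q K)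
         + \<zeta>1 * (\<Sum>e\<in>Ep. (?s (fst e) * y (fst e) - ?s (snd e) * y (snd e)) * (q (fst e) - q (snd e)))
         = (\<Sum>K\<in>Kh \<M>. f K * q K) + (\<Sum>e\<in>Ep. g e * (q (fst e) - q (snd e)))"
        using eq by (simp cong: sum.cong)
    qed
    then have s1: "1 / sa * L2_set (\<lambda>K. ?s K * y K) (Kh \<M>) \<le> 1 / sa * (C * (L2_set f (Kh \<M>) + L2_set g Ep / \<zeta>1))"
      using sa(1) by (intro mult_left_mono) auto
    have "L2_set y (Kh \<M>) \<le> 1 / sa * L2_set (\<lambda>K. ?s K * y K) (Kh \<M>)"
    proof (rule L2_set_scaled)
      fix K assume K: "K \<in> Kh \<M>"
      have "sa * \<bar>y K\<bar> \<le> \<bar>?s K\<bar> * \<bar>y K\<bar>" using sa K by (intro mult_right_mono) force+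
      then show "\<bar>y K\<bar> \<le> 1 / sa * \<bar>?s K * y K\<bar>" using sa(1) by (simp add: abs_mult pos_le_divide_eq mult.commute)
    qed (use sa in simp)
    also have "\<dots> \<le> 1 / sa * (C * (L2_set f (Kh \<M>) + L2_set g Ep / \<zeta>1))" by (rule s1)
    also have "\<dots> \<le> (C + C / sa) * (L2_set f (Kh \<M>) + L2_set g Ep / \<zeta>1)"
      using C sa(1) zp by (simp add: distrib_right)
    finally show ?thesis .
  qed
  moreover have "0 < C + C / sa" using C sa(1) by (simp add: add_pos_pos)
  ultimately show ?thesis by blast
qed

text \<open>Testing the porosity equation with the pressure, the elastic contribution is nonnegative,
  so a bounded porosity bounds the pressure by a multiple of Biot's modulus.\<close>

lemma pressure_bound:
  "\<exists>C>0. \<forall>k \<gamma> \<zeta>2 N c p us uf \<phi>. 1 \<le> N \<longrightarrow> stable k \<gamma> \<zeta>2 \<longrightarrow>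
     level_system \<M> P S \<gamma> \<zeta>2 N c p us uf \<phi> \<longrightarrow> (\<forall>K\<in>Kh \<M>. 0 < \<phi> K \<and> \<phi> K < 1) \<longrightarrow>
     L2_set p (Kh \<M>) \<le> C * N"
proof -
  obtain va where va: "0 < va" "\<forall>K\<in>Kh \<M>. va \<le> vol K" using finite_lower_bound[of "Kh \<M>" vol, OF finite_Kh vol_pos] by blast
  \<comment> \<open>A majorant of the data \<open>r\<close> below that does not involve N: two
    porosities in (0, 1) differ by less than 1, and N \<ge> 1.\<close>
  define h where "h K = vol K * (1 + \<bar>p_old S K\<bar>) + \<bar>alpha P * bdiv (ind K) (us_old S)\<bar>" for K
  define C where "C = L2_set h (Kh \<M>) / va + 1"
  have C: "0 < C" using va(1) by (simp add: C_def add_nonneg_pos)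
  have "L2_set p (Kh \<M>) \<le> C * N"
    if N: "1 \<le> N" and st: "stable k \<gamma> \<zeta>2" and lev: "level_system \<M> P S \<gamma> \<zeta>2 N c p us uf \<phi>"
      and phi: "\<forall>K\<in>Kh \<M>. 0 < \<phi> K \<and> \<phi> K < 1" for k \<gamma> \<zeta>2 N c p us uf \<phi>
  proof -
    let ?n = "L2_set p (Kh \<M>)"
    \<comment> \<open>The porosity equation solved for the unknown pressure and displacement:
      \<open>r K = vol K / N * p K + alpha P * bdiv (ind K) us\<close>.\<close>
    define r where "r K = vol K * (\<phi> K - phi_old S K + p_old S K / N) + alpha P * bdiv (ind K) (us_old S)" for K
    have us: "us \<in> Vh \<M>" and el: "\<forall>v\<in>Vh \<M>. elast \<gamma> \<zeta>2 us v = alpha P * bdiv p v"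
      and por: "\<And>K. K \<in> Kh \<M> \<Longrightarrow> vol K * (\<phi> K - phi_old S K) =
        vol K / N * (p K - p_old S K) + alpha P * bdiv (ind K) (us_incr us)"
      using lev unfolding level_system_iff by blast+
    have "p K * r K = vol K / N * (p K)\<^sup>2 + alpha P * (p K * bdiv (ind K) us)" if K: "K \<in> Kh \<M>" for K
    proof -
      have "bdiv (ind K) (us_incr us) = bdiv (ind K) us - bdiv (ind K) (us_old S)"
        using bdiv_lin[OF us us_old_Vh, of "ind K" "-1"] by simp
      then have "alpha P * bdiv (ind K) (us_incr us) = alpha P * bdiv (ind K) us - alpha P * bdiv (ind K) (us_old S)"
        by (simp only: right_diff_distrib)
      moreover have "r K = vol K * (\<phi> K - phi_old S K) + vol K / N * p_old S K + alpha P * bdiv (ind K) (us_old S)"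
        unfolding r_def by (simp add: distrib_left)
      ultimately have "r K = vol K / N * p K + alpha P * bdiv (ind K) us"
        using por[OF K] unfolding right_diff_distrib by linarith
      then show ?thesis by (simp add: algebra_simps power2_eq_square)
    qed
    then have "(\<Sum>K\<in>Kh \<M>. p K * r K) = (\<Sum>K\<in>Kh \<M>. vol K / N * (p K)\<^sup>2) + alpha P * bdiv p us"
      unfolding bdiv_decomp[of p us] sum_distrib_left sum.distrib[symmetric] by (rule sum.cong[OF refl])
    \<comment> \<open>The momentum balance tested with \<open>us\<close> identifies this coupling
      term with the elastic energy, whatever the sign of \<open>alpha P\<close>.\<close>
    moreover have "0 \<le> alpha P * bdiv p us" using el us stable_nonneg[OF st us] by simp
    moreover have "va / N * ?n\<^sup>2 \<le> (\<Sum>K\<in>Kh \<M>. vol K / N * (p K)\<^sup>2)"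
      unfolding L2_set_power2 sum_distrib_left
      using va N by (intro sum_mono mult_right_mono divide_right_mono) auto
    moreover have "(\<Sum>K\<in>Kh \<M>. p K * r K) \<le> ?n * L2_set h (Kh \<M>)"
    proof -
      have "\<bar>r K\<bar> \<le> \<bar>h K\<bar>" if K: "K \<in> Kh \<M>" for K
      proof -
        have "\<bar>p_old S K / N\<bar> \<le> \<bar>p_old S K\<bar>" using N by (simp add: divide_le_eq mult_le_cancel_left1)
        moreover have "\<bar>\<phi> K - phi_old S K\<bar> \<le> 1" using phi phi_old_bounds[OF K] K by (smt (verit))
        ultimately have "\<bar>\<phi> K - phi_old S K + p_old S K / N\<bar> \<le> 1 + \<bar>p_old S K\<bar>" by linarith
        then have "\<bar>vol K * (\<phi> K - phi_old S K + p_old S K / N)\<bar> \<le> vol K * (1 + \<bar>p_old S K\<bar>)"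
          unfolding abs_mult using vol_pos[OF K] by simp
        then show ?thesis unfolding r_def h_def by linarith
      qed
      then have "L2_set r (Kh \<M>) \<le> L2_set h (Kh \<M>)"
        using L2_set_scaled[of "Kh \<M>" r 1 h] by simp
      then have "?n * L2_set r (Kh \<M>) \<le> ?n * L2_set h (Kh \<M>)" by (intro mult_left_mono) auto
      then show ?thesis using abs_sum_mult_le_L2_set[of p r "Kh \<M>"] by linarith
    qed
    ultimately have "?n * (va / N * ?n) \<le> ?n * L2_set h (Kh \<M>)"
      by (simp only: power2_eq_square mult.left_commute)
    then have "va / N * ?n \<le> L2_set h (Kh \<M>)"
      by (rule mult_self_cancel_le[rotated 2]) simp_all
    then have "?n \<le> L2_set h (Kh \<M>) / va * N" using va(1) N by (simp add: field_simps)
    also have "\<dots> \<le> C * N" using N by (simp add: C_def distrib_right)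
    finally show ?thesis .
  qed
  then show ?thesis using C by blast
qed

text \<open>The pressure bound passes to the chemical potential because \<open>c_old S\<close> is
  bounded away from 0, then to the fluxes, which the graph estimate divides by \<zeta>1. Data of
  order 1 fit into the bound since N \<ge> \<zeta>1.\<close>

lemma concentration_bound:
  assumes m: "0 < m"
  shows "\<exists>C>0. \<forall>\<zeta>1\<ge>C. \<forall>N\<ge>\<zeta>1. \<forall>k \<gamma> \<zeta>2 c p us uf \<phi> c'. stable k \<gamma> \<zeta>2 \<longrightarrow>
     level_system \<M> P S \<gamma> \<zeta>2 N c p us uf \<phi> \<longrightarrow> (\<forall>K\<in>Kh \<M>. m \<le> \<phi> K \<and> \<phi> K < 1) \<longrightarrow>
     mass_eq \<M> P S \<zeta>1 \<phi> uf c' \<longrightarrow> L2_set c' (Kh \<M>) \<le> C * N / \<zeta>1"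
proof -
  let ?s = "mu_slope \<M> P S"
  obtain Cg where Cg: "0 < Cg" and est: "\<And>\<zeta>1 \<phi> y f g. \<lbrakk>Cg \<le> \<zeta>1; \<forall>K\<in>Kh \<M>. m \<le> \<phi> K \<and> \<phi> K < 1;
     \<forall>q. (\<Sum>K\<in>Kh \<M>. vol K * \<phi> K / tau P * y K * q K)
        + \<zeta>1 * (\<Sum>e\<in>Ep. (?s (fst e) * y (fst e) - ?s (snd e) * y (snd e)) * (q (fst e) - q (snd e)))
      = (\<Sum>K\<in>Kh \<M>. f K * q K) + (\<Sum>e\<in>Ep. g e * (q (fst e) - q (snd e)))\<rbrakk> \<Longrightarrow>
     L2_set y (Kh \<M>) \<le> Cg * (L2_set f (Kh \<M>) + L2_set g Ep / \<zeta>1)"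
    using mass_stability[OF m] by blast
  obtain Cp where Cp: "0 < Cp" and pb: "\<And>k \<gamma> \<zeta>2 N c p us uf \<phi>. \<lbrakk>1 \<le> N; stable k \<gamma> \<zeta>2;
     level_system \<M> P S \<gamma> \<zeta>2 N c p us uf \<phi>; \<forall>K\<in>Kh \<M>. 0 < \<phi> K \<and> \<phi> K < 1\<rbrakk> \<Longrightarrow> L2_set p (Kh \<M>) \<le> Cp * N"
    using pressure_bound by blast
  obtain Cf where Cf: "0 < Cf" and fb: "\<And>\<mu> uf. darcy_solution \<mu> uf \<Longrightarrow> L2_set (flux uf) Ep \<le> Cf * L2_set \<mu> (Kh \<M>)"
    using flux_bound by blast
  obtain ca where ca: "0 < ca" "\<forall>K\<in>Kh \<M>. ca \<le> c_old S K" using finite_lower_bound[of "Kh \<M>" "c_old S", OF finite_Kh c_old_pos] by blast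
  define A where "A = L2_set (\<lambda>K. free_energy P (c_old S K)) (Kh \<M>)"
  define \<kappa> where "\<kappa> K = chem_pot P (c_old S K) - ?s K * c_old S K" for K
  define j where "j = L2_set (\<lambda>e. \<kappa> (fst e) - \<kappa> (snd e)) Ep"
  define f where "f K = vol K * (phi_old S K * c_old S K) / tau P" for K
  define Cm where "Cm = 1 / ca * (Cp + A)"
  define C where "C = 1 + Cg + Cg * (L2_set f (Kh \<M>) + Cf * Cm + j)"
  have A: "0 \<le> A" and j: "0 \<le> j" by (simp_all add: A_def j_def)
  have Cm: "0 \<le> Cm" unfolding Cm_def using ca(1) Cp A by simp
  have rest: "0 \<le> Cg * (L2_set f (Kh \<M>) + Cf * Cm + j)"
    using Cg Cf Cm j by (intro mult_nonneg_nonneg add_nonneg_nonneg) auto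
  have C0: "0 < C" and C1: "1 \<le> C" and CgC: "Cg \<le> C" using rest Cg unfolding C_def by linarith+
  have "L2_set c' (Kh \<M>) \<le> C * N / \<zeta>1"
    if z: "C \<le> \<zeta>1" and N: "\<zeta>1 \<le> N" and st: "stable k \<gamma> \<zeta>2" and lev: "level_system \<M> P S \<gamma> \<zeta>2 N c p us uf \<phi>"
      and phi: "\<forall>K\<in>Kh \<M>. m \<le> \<phi> K \<and> \<phi> K < 1" and mass: "mass_eq \<M> P S \<zeta>1 \<phi> uf c'"
    for \<zeta>1 N k \<gamma> \<zeta>2 c p us uf \<phi> c'
  proof -
    let ?mu = "mu_h \<M> P S c"
    have z1: "1 \<le> \<zeta>1" and N1: "1 \<le> N" using z N C1 by linarith+
    have phi0: "\<forall>K\<in>Kh \<M>. 0 < \<phi> K \<and> \<phi> K < 1" using phi m by force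
    have pn: "L2_set p (Kh \<M>) \<le> Cp * N" by (rule pb[OF N1 st lev phi0])
    have da: "darcy_solution ?mu uf"
      and pmu: "\<And>K. K \<in> Kh \<M> \<Longrightarrow> p K = c_old S K * ?mu K - free_energy P (c_old S K)"
      using lev unfolding level_system_iff by blast+
    have "L2_set ?mu (Kh \<M>) \<le> 1 / ca * L2_set (\<lambda>K. p K + free_energy P (c_old S K)) (Kh \<M>)"
    proof (rule L2_set_scaled)
      fix K assume K: "K \<in> Kh \<M>"
      have "ca * \<bar>?mu K\<bar> \<le> \<bar>c_old S K\<bar> * \<bar>?mu K\<bar>" using ca K by (intro mult_right_mono) force+
      also have "\<dots> = \<bar>p K + free_energy P (c_old S K)\<bar>" unfolding pmu[OF K] by (simp add: abs_mult)
      finally show "\<bar>?mu K\<bar> \<le> 1 / ca * \<bar>p K + free_energy P (c_old S K)\<bar>"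
        using ca(1) by (simp add: pos_le_divide_eq mult.commute)
    qed (use ca in simp)
    also have "\<dots> \<le> 1 / ca * (Cp * N + A * N)"
    proof (rule mult_left_mono)
      have "A \<le> A * N" using A N1 by (simp add: mult_le_cancel_left1)
      then show "L2_set (\<lambda>K. p K + free_energy P (c_old S K)) (Kh \<M>) \<le> Cp * N + A * N"
        using L2_set_triangle_ineq[of p "\<lambda>K. free_energy P (c_old S K)" "Kh \<M>"] pn unfolding A_def by linarith
    qed (use ca in simp)
    also have "\<dots> = Cm * N" by (simp add: Cm_def distrib_right add_divide_distrib)
    finally have mub: "L2_set ?mu (Kh \<M>) \<le> Cm * N" .
    have fl: "L2_set (flux uf) Ep \<le> Cf * Cm * N"
      using fb[OF da] mult_left_mono[OF mub less_imp_le[OF Cf]] by (simp only: mult.assoc)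
    \<comment> \<open>The offset jumps carry a factor \<zeta>1, which the graph estimate divides out
      again; they contribute a term of order 1 only.\<close>
    define g where "g e = - flux uf e + - (\<zeta>1 * (\<kappa> (fst e) - \<kappa> (snd e)))" for e
    have "L2_set (\<lambda>e. \<zeta>1 * (\<kappa> (fst e) - \<kappa> (snd e))) Ep \<le> \<zeta>1 * j"
      unfolding j_def using z1 by (intro L2_set_scaled) (auto simp: abs_mult)
    then have gb: "L2_set g Ep \<le> Cf * Cm * N + \<zeta>1 * j"
      unfolding g_def using L2_set_triangle_ineq[of "\<lambda>e. - flux uf e" "\<lambda>e. - (\<zeta>1 * (\<kappa> (fst e) - \<kappa> (snd e)))" Ep] fl
      unfolding L2_set_uminus by linarith
    have fs: "fst e \<in> Kh \<M>" "snd e \<in> Kh \<M>" if "e \<in> Ep" for e using that Ep_facts(2) EI_facts(1,2) by blast+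
    have "(\<Sum>K\<in>Kh \<M>. vol K * \<phi> K / tau P * c' K * q K)
        + \<zeta>1 * (\<Sum>e\<in>Ep. (?s (fst e) * c' (fst e) - ?s (snd e) * c' (snd e)) * (q (fst e) - q (snd e)))
      = (\<Sum>K\<in>Kh \<M>. f K * q K) + (\<Sum>e\<in>Ep. g e * (q (fst e) - q (snd e)))" for q
    proof -
      have "(\<Sum>K\<in>Kh \<M>. vol K * (\<phi> K * c' K - phi_old S K * c_old S K) / tau P * q K)
        = (\<Sum>K\<in>Kh \<M>. vol K * \<phi> K / tau P * c' K * q K) - (\<Sum>K\<in>Kh \<M>. f K * q K)"
        unfolding sum_subtractf[symmetric] by (intro sum.cong refl) (simp add: f_def right_diff_distrib left_diff_distrib diff_divide_distrib)
      moreover have "(\<Sum>e\<in>Ep. flux uf e * (q (fst e) - q (snd e)))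
        + \<zeta>1 * (\<Sum>e\<in>Ep. (mu_h \<M> P S c' (fst e) - mu_h \<M> P S c' (snd e)) * (q (fst e) - q (snd e)))
        = \<zeta>1 * (\<Sum>e\<in>Ep. (?s (fst e) * c' (fst e) - ?s (snd e) * c' (snd e)) * (q (fst e) - q (snd e)))
          - (\<Sum>e\<in>Ep. g e * (q (fst e) - q (snd e)))"
        unfolding sum_subtractf[symmetric] sum.distrib[symmetric] sum_distrib_left
        by (intro sum.cong refl) (simp only: mu_h_split g_def \<kappa>_def, simp add: algebra_simps)
      moreover note mass[unfolded mass_eq_iff, THEN spec, of q]
      ultimately show ?thesis by linarith
    qed
    then have "L2_set c' (Kh \<M>) \<le> Cg * (L2_set f (Kh \<M>) + L2_set g Ep / \<zeta>1)"
      using est[of \<zeta>1 \<phi> c' f g] z CgC phi by auto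
    also have "\<dots> \<le> Cg * ((L2_set f (Kh \<M>) + Cf * Cm + j) * (N / \<zeta>1))"
    proof (rule mult_left_mono)
      \<comment> \<open>Lets all terms of order 1 be majorised by multiples of N / \<zeta>1.\<close>
      have Nz: "1 \<le> N / \<zeta>1" using N z1 by simp
      have "L2_set g Ep / \<zeta>1 \<le> (Cf * Cm * N + \<zeta>1 * j) / \<zeta>1" using gb z1 by (intro divide_right_mono) auto
      also have "\<dots> = Cf * Cm * (N / \<zeta>1) + j" using z1 by (simp add: add_divide_distrib)
      also have "\<dots> \<le> Cf * Cm * (N / \<zeta>1) + j * (N / \<zeta>1)" using Nz j mult_left_mono[OF Nz j] by simp
      moreover have "L2_set f (Kh \<M>) \<le> L2_set f (Kh \<M>) * (N / \<zeta>1)" using mult_left_mono[OF Nz, of "L2_set f (Kh \<M>)"] by simp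
      ultimately show "L2_set f (Kh \<M>) + L2_set g Ep / \<zeta>1 \<le> (L2_set f (Kh \<M>) + Cf * Cm + j) * (N / \<zeta>1)"
        unfolding distrib_right by linarith
    qed (use Cg in simp)
    also have "\<dots> = (Cg * (L2_set f (Kh \<M>) + Cf * Cm + j)) * (N / \<zeta>1)" by (simp only: mult.assoc)
    also have "\<dots> \<le> C * (N / \<zeta>1)"
      using z1 N1 Cg by (intro mult_right_mono) (auto simp: C_def)
    finally show ?thesis by simp
  qed
  then show ?thesis using C0 by blast
qed

text \<open>Testing the difference of two momentum balances with itself bounds its energy by the
  pressure difference times the discrete divergence. Coercivity cancels one factor of the latter and
  leaves it of order 1/\<gamma>. The pressure difference is a fixed multiple of the concentration
  difference on each element.\<close>

lemma porosity_lipschitz: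
  assumes k: "0 < k"
  shows "\<exists>C>0. \<forall>N \<gamma> \<zeta>2 c1 p1 us1 uf1 \<phi>1 c2 p2 us2 uf2 \<phi>2. 1 \<le> N \<longrightarrow> N \<le> \<gamma> \<longrightarrow> stable k \<gamma> \<zeta>2 \<longrightarrow>
     level_system \<M> P S \<gamma> \<zeta>2 N c1 p1 us1 uf1 \<phi>1 \<longrightarrow> level_system \<M> P S \<gamma> \<zeta>2 N c2 p2 us2 uf2 \<phi>2 \<longrightarrow>
     L2_set (\<lambda>K. \<phi>1 K - \<phi>2 K) (Kh \<M>) \<le> C / N * L2_set (\<lambda>K. c1 K - c2 K) (Kh \<M>)"
proof -
  let ?s = "mu_slope \<M> P S"
  obtain va where va: "0 < va" "\<forall>K\<in>Kh \<M>. va \<le> vol K" using finite_lower_bound[of "Kh \<M>" vol, OF finite_Kh vol_pos] by blast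
  obtain b where b: "0 < b" "\<forall>K\<in>Kh \<M>. \<bar>c_old S K * ?s K\<bar> \<le> b"
    using finite_upper_bound[of "Kh \<M>" "\<lambda>K. c_old S K * ?s K", OF finite_Kh] by blast
  let ?a = "\<bar>alpha P\<bar>"
  define C1 where "C1 = 1 + ?a / va * (?a / k)"
  have C1: "0 < C1" unfolding C1_def using va(1) k by (intro add_pos_nonneg) auto
  have "L2_set (\<lambda>K. \<phi>1 K - \<phi>2 K) (Kh \<M>) \<le> (C1 * b) / N * L2_set (\<lambda>K. c1 K - c2 K) (Kh \<M>)"
    if N: "1 \<le> N" and g: "N \<le> \<gamma>" and st: "stable k \<gamma> \<zeta>2"
      and l1: "level_system \<M> P S \<gamma> \<zeta>2 N c1 p1 us1 uf1 \<phi>1" and l2: "level_system \<M> P S \<gamma> \<zeta>2 N c2 p2 us2 uf2 \<phi>2"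
    for N \<gamma> \<zeta>2 c1 p1 us1 uf1 \<phi>1 c2 p2 us2 uf2 \<phi>2
  proof -
    have u: "us1 \<in> Vh \<M>" "us2 \<in> Vh \<M>"
      and el: "\<And>v. v \<in> Vh \<M> \<Longrightarrow> elast \<gamma> \<zeta>2 us1 v = alpha P * bdiv p1 v"
        "\<And>v. v \<in> Vh \<M> \<Longrightarrow> elast \<gamma> \<zeta>2 us2 v = alpha P * bdiv p2 v"
      and pr: "\<And>K. K \<in> Kh \<M> \<Longrightarrow> p1 K = c_old S K * mu_h \<M> P S c1 K - free_energy P (c_old S K)"
        "\<And>K. K \<in> Kh \<M> \<Longrightarrow> p2 K = c_old S K * mu_h \<M> P S c2 K - free_energy P (c_old S K)"
      and por: "\<And>K. K \<in> Kh \<M> \<Longrightarrow> vol K * (\<phi>1 K - phi_old S K) =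
        vol K / N * (p1 K - p_old S K) + alpha P * bdiv (ind K) (us_incr us1)"
        "\<And>K. K \<in> Kh \<M> \<Longrightarrow> vol K * (\<phi>2 K - phi_old S K) =
        vol K / N * (p2 K - p_old S K) + alpha P * bdiv (ind K) (us_incr us2)"
      using l1 l2 unfolding level_system_iff by blast+
    define d where "d = us1 + fscale (- 1) us2"
    define dp where "dp K = p1 K - p2 K" for K
    define B where "B K = bdiv (ind K) d" for K
    let ?n = "L2_set dp (Kh \<M>)" and ?B = "L2_set B (Kh \<M>)"
    have d: "d \<in> Vh \<M>" unfolding d_def using u by (rule Vh_lin)
    have "elast \<gamma> \<zeta>2 d d = elast \<gamma> \<zeta>2 us1 d - elast \<gamma> \<zeta>2 us2 d"
      using elast_lin[OF u d, of \<gamma> \<zeta>2 "-1", folded d_def] by linarith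
    also have "\<dots> = alpha P * bdiv p1 d - alpha P * bdiv p2 d"
      by (simp only: el[OF d])
    also have "\<dots> = alpha P * (\<Sum>K\<in>Kh \<M>. dp K * B K)"
      unfolding bdiv_decomp[of p1] bdiv_decomp[of p2] dp_def B_def by (simp add: left_diff_distrib right_diff_distrib sum_subtractf)
    also have "\<dots> \<le> ?a * (?n * ?B)"
    proof -
      have "alpha P * (\<Sum>K\<in>Kh \<M>. dp K * B K) \<le> ?a * \<bar>\<Sum>K\<in>Kh \<M>. dp K * B K\<bar>"
        unfolding abs_mult[symmetric] by (rule abs_ge_self)
      also have "\<dots> \<le> ?a * (?n * ?B)" by (intro mult_left_mono abs_sum_mult_le_L2_set) simp
      finally show ?thesis .
    qed
    finally have "elast \<gamma> \<zeta>2 d d \<le> ?a * (?n * ?B)" .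
    moreover have "k * \<gamma> * ?B\<^sup>2 \<le> elast \<gamma> \<zeta>2 d d"
      using st d unfolding stable_def B_def by blast
    ultimately have "k * \<gamma> * ?B\<^sup>2 \<le> ?a * (?n * ?B)" by linarith
    then have "?B * (k * \<gamma> * ?B) \<le> ?B * (?a * ?n)" by (simp add: power2_eq_square mult_ac)
    then have kB: "k * \<gamma> * ?B \<le> ?a * ?n"
      by (rule mult_self_cancel_le[rotated 2]) simp_all
    \<comment> \<open>Here \<gamma> \<ge> N is used: the elastic part of the porosity gets the same
      decay 1/N as the compressibility part.\<close>
    have "k * N * ?B \<le> k * \<gamma> * ?B" using g k by (intro mult_right_mono mult_left_mono) auto
    then have "k * N * ?B \<le> ?a * ?n" using kB by linarith
    then have Bb: "?B \<le> ?a / k * ?n / N" using k N by (simp add: pos_le_divide_eq mult_ac)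
    have eqK: "\<phi>1 K - \<phi>2 K = dp K / N + alpha P / vol K * B K" if K: "K \<in> Kh \<M>" for K
    proof -
      have "bdiv (ind K) (us_incr us1) = bdiv (ind K) us1 - bdiv (ind K) (us_old S)"
        "bdiv (ind K) (us_incr us2) = bdiv (ind K) us2 - bdiv (ind K) (us_old S)"
        "B K = bdiv (ind K) us1 - bdiv (ind K) us2"
        using bdiv_lin[OF u(1) us_old_Vh, of "ind K" "-1"] bdiv_lin[OF u(2) us_old_Vh, of "ind K" "-1"]
          bdiv_lin[OF u, of "ind K" "-1"] by (simp_all add: B_def d_def)
      then have incr: "bdiv (ind K) (us_incr us1) - bdiv (ind K) (us_incr us2) = B K" by linarith
      have "vol K * (\<phi>1 K - phi_old S K) - vol K * (\<phi>2 K - phi_old S K) =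
        (vol K / N * (p1 K - p_old S K) + alpha P * bdiv (ind K) (us_incr us1))
        - (vol K / N * (p2 K - p_old S K) + alpha P * bdiv (ind K) (us_incr us2))"
        by (simp only: por[OF K])
      also have "\<dots> = vol K / N * dp K + alpha P * (bdiv (ind K) (us_incr us1) - bdiv (ind K) (us_incr us2))"
        unfolding dp_def by (simp add: right_diff_distrib del: plus_fun_apply)
      finally have "vol K * (\<phi>1 K - \<phi>2 K) = vol K / N * dp K + alpha P * B K"
        unfolding incr by (simp add: right_diff_distrib)
      then have "vol K * (\<phi>1 K - \<phi>2 K) = vol K * (dp K / N + alpha P / vol K * B K)"
        using vol_pos[OF K] by (simp add: distrib_left)
      then show ?thesis using vol_pos[OF K] by simp
    qed
    have "L2_set (\<lambda>K. \<phi>1 K - \<phi>2 K) (Kh \<M>) = L2_set (\<lambda>K. dp K / N + alpha P / vol K * B K) (Kh \<M>)"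
      using eqK by (intro L2_set_cong) auto
    also have "\<dots> \<le> L2_set (\<lambda>K. dp K / N) (Kh \<M>) + L2_set (\<lambda>K. alpha P / vol K * B K) (Kh \<M>)"
      by (rule L2_set_triangle_ineq)
    also have "\<dots> \<le> 1 / N * ?n + ?a / va * ?B"
    proof (intro add_mono L2_set_scaled)
      show "\<bar>dp K / N\<bar> \<le> 1 / N * \<bar>dp K\<bar>" for K using N by simp
      fix K assume K: "K \<in> Kh \<M>"
      have "?a / vol K \<le> ?a / va" using va K vol_pos[OF K] by (intro divide_left_mono) auto
      then have "?a / vol K * \<bar>B K\<bar> \<le> ?a / va * \<bar>B K\<bar>" by (intro mult_right_mono) auto
      then show "\<bar>alpha P / vol K * B K\<bar> \<le> ?a / va * \<bar>B K\<bar>" using vol_pos[OF K] by (simp add: abs_mult)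
    qed (use N va in auto)
    also have "\<dots> \<le> 1 / N * ?n + ?a / va * (?a / k * ?n / N)"
      using Bb va(1) by (intro add_left_mono mult_left_mono) auto
    also have "\<dots> = C1 / N * ?n" by (simp add: C1_def algebra_simps add_divide_distrib)
    also have "\<dots> \<le> C1 / N * (b * L2_set (\<lambda>K. c1 K - c2 K) (Kh \<M>))"
    proof (rule mult_left_mono)
      show "?n \<le> b * L2_set (\<lambda>K. c1 K - c2 K) (Kh \<M>)"
      proof (rule L2_set_scaled)
        fix K assume K: "K \<in> Kh \<M>"
        have "dp K = c_old S K * ?s K * (c1 K - c2 K)"
          unfolding dp_def pr[OF K] mu_h_def by (simp add: algebra_simps)
        then show "\<bar>dp K\<bar> \<le> b * \<bar>c1 K - c2 K\<bar>" using b(2) K by (simp add: abs_mult mult_right_mono)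
      qed (use b in simp)
    qed (use C1 N in simp)
    finally show ?thesis by simp
  qed
  then show ?thesis using C1 b(1) by (intro exI[of _ "C1 * b"]) auto
qed

text \<open>Split \<open>\<phi>1 * c1' - \<phi>2 * c2'\<close> as
  \<open>\<phi>1 * (c1' - c2') + (\<phi>1 - \<phi>2) * c2'\<close>. The first term stays in the
  operator, the second is data, and only one of the two new concentrations has to be
  bounded.\<close>

lemma iteration_lipschitz:
  assumes k: "0 < k" and m: "0 < m"
  shows "\<exists>C>0. \<forall>\<zeta>1\<ge>C. \<forall>N\<ge>\<zeta>1. \<forall>\<gamma>\<ge>N. \<forall>\<zeta>2 c1 p1 us1 uf1 \<phi>1 c1' c2 p2 us2 uf2 \<phi>2 c2'. stable k \<gamma> \<zeta>2 \<longrightarrow>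
     level_system \<M> P S \<gamma> \<zeta>2 N c1 p1 us1 uf1 \<phi>1 \<longrightarrow> level_system \<M> P S \<gamma> \<zeta>2 N c2 p2 us2 uf2 \<phi>2 \<longrightarrow>
     (\<forall>K\<in>Kh \<M>. m \<le> \<phi>1 K \<and> \<phi>1 K < 1) \<longrightarrow> (\<forall>K\<in>Kh \<M>. m \<le> \<phi>2 K \<and> \<phi>2 K < 1) \<longrightarrow>
     mass_eq \<M> P S \<zeta>1 \<phi>1 uf1 c1' \<longrightarrow> mass_eq \<M> P S \<zeta>1 \<phi>2 uf2 c2' \<longrightarrow>
     L2_set (\<lambda>K. c1' K - c2' K) (Kh \<M>) \<le> C / \<zeta>1 * L2_set (\<lambda>K. c1 K - c2 K) (Kh \<M>)"
proof -
  let ?s = "mu_slope \<M> P S"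
  obtain Cg where Cg: "0 < Cg" and est: "\<And>\<zeta>1 \<phi> y f g. \<lbrakk>Cg \<le> \<zeta>1; \<forall>K\<in>Kh \<M>. m \<le> \<phi> K \<and> \<phi> K < 1;
     \<forall>q. (\<Sum>K\<in>Kh \<M>. vol K * \<phi> K / tau P * y K * q K)
        + \<zeta>1 * (\<Sum>e\<in>Ep. (?s (fst e) * y (fst e) - ?s (snd e) * y (snd e)) * (q (fst e) - q (snd e)))
      = (\<Sum>K\<in>Kh \<M>. f K * q K) + (\<Sum>e\<in>Ep. g e * (q (fst e) - q (snd e)))\<rbrakk> \<Longrightarrow>
     L2_set y (Kh \<M>) \<le> Cg * (L2_set f (Kh \<M>) + L2_set g Ep / \<zeta>1)"
    using mass_stability[OF m] by (elim exE conjE) (rule that, assumption, blast)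
  obtain Cc where Cc: "0 < Cc" and cb: "\<And>\<zeta>1 N k \<gamma> \<zeta>2 c p us uf \<phi> c'. \<lbrakk>Cc \<le> \<zeta>1; \<zeta>1 \<le> N; stable k \<gamma> \<zeta>2;
     level_system \<M> P S \<gamma> \<zeta>2 N c p us uf \<phi>; \<forall>K\<in>Kh \<M>. m \<le> \<phi> K \<and> \<phi> K < 1;
     mass_eq \<M> P S \<zeta>1 \<phi> uf c'\<rbrakk> \<Longrightarrow> L2_set c' (Kh \<M>) \<le> Cc * N / \<zeta>1"
    using concentration_bound[OF m] by (elim exE conjE) (rule that, assumption, blast)
  obtain Cp where Cp: "0 < Cp" and pl: "\<And>N \<gamma> \<zeta>2 c1 p1 us1 uf1 \<phi>1 c2 p2 us2 uf2 \<phi>2. \<lbrakk>1 \<le> N; N \<le> \<gamma>; stable k \<gamma> \<zeta>2;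
     level_system \<M> P S \<gamma> \<zeta>2 N c1 p1 us1 uf1 \<phi>1; level_system \<M> P S \<gamma> \<zeta>2 N c2 p2 us2 uf2 \<phi>2\<rbrakk> \<Longrightarrow>
     L2_set (\<lambda>K. \<phi>1 K - \<phi>2 K) (Kh \<M>) \<le> Cp / N * L2_set (\<lambda>K. c1 K - c2 K) (Kh \<M>)"
    using porosity_lipschitz[OF k] by (elim exE conjE) (rule that, assumption, blast)
  obtain Cf where Cf: "0 < Cf" and fb: "\<And>\<mu> uf. darcy_solution \<mu> uf \<Longrightarrow> L2_set (flux uf) Ep \<le> Cf * L2_set \<mu> (Kh \<M>)"
    using flux_bound by (elim exE conjE) (rule that, assumption, blast)
  obtain vb where vb: "0 < vb" "\<forall>K\<in>Kh \<M>. \<bar>vol K\<bar> \<le> vb" using finite_upper_bound[of "Kh \<M>" vol, OF finite_Kh] by blast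
  obtain sb where sb: "0 < sb" "\<forall>K\<in>Kh \<M>. \<bar>?s K\<bar> \<le> sb" using finite_upper_bound[of "Kh \<M>" ?s, OF finite_Kh] by blast
  define C1 where "C1 = vb / tau P * Cc * Cp + Cf * sb"
  have C1: "0 < C1" unfolding C1_def using vb(1) tau_pos Cc Cp Cf sb(1) by (intro add_pos_pos mult_pos_pos divide_pos_pos)
  define C where "C = 1 + Cg + Cc + Cg * C1"
  have CgC1: "0 < Cg * C1" using Cg C1 by simp
  then have C0: "0 < C" using Cg Cc unfolding C_def by linarith
  have "L2_set (\<lambda>K. c1' K - c2' K) (Kh \<M>) \<le> C / \<zeta>1 * L2_set (\<lambda>K. c1 K - c2 K) (Kh \<M>)"
    if z: "C \<le> \<zeta>1" and N: "\<zeta>1 \<le> N" and g: "N \<le> \<gamma>" and st: "stable k \<gamma> \<zeta>2"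
      and l1: "level_system \<M> P S \<gamma> \<zeta>2 N c1 p1 us1 uf1 \<phi>1" and l2: "level_system \<M> P S \<gamma> \<zeta>2 N c2 p2 us2 uf2 \<phi>2"
      and phi1: "\<forall>K\<in>Kh \<M>. m \<le> \<phi>1 K \<and> \<phi>1 K < 1" and phi2: "\<forall>K\<in>Kh \<M>. m \<le> \<phi>2 K \<and> \<phi>2 K < 1"
      and m1: "mass_eq \<M> P S \<zeta>1 \<phi>1 uf1 c1'" and m2: "mass_eq \<M> P S \<zeta>1 \<phi>2 uf2 c2'"
    for \<zeta>1 N \<gamma> \<zeta>2 c1 p1 us1 uf1 \<phi>1 c1' c2 p2 us2 uf2 \<phi>2 c2'
  proof -
    have zs: "1 \<le> \<zeta>1" "Cg \<le> \<zeta>1" "Cc \<le> \<zeta>1" using z Cg Cc CgC1 unfolding C_def by linarith+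
    have N1: "1 \<le> N" using zs N by linarith
    let ?n = "L2_set (\<lambda>K. c1 K - c2 K) (Kh \<M>)"
    define y where "y K = c1' K - c2' K" for K
    \<comment> \<open>The porosity difference against the new concentration \<open>c2'\<close>,
      treated as a reaction source.\<close>
    define f where "f K = - (vol K * (\<phi>1 K - \<phi>2 K) * c2' K / tau P)" for K
    define uf where "uf = uf1 + fscale (- 1) uf2"
    have da: "darcy_solution (mu_h \<M> P S c1) uf1" "darcy_solution (mu_h \<M> P S c2) uf2"
      using l1 l2 unfolding level_system_iff by blast+
    then have u: "uf1 \<in> Uh0 \<M>" "uf2 \<in> Uh0 \<M>" by (auto simp: darcy_solution_def)
    have fl: "flux uf e = flux uf1 e - flux uf2 e" if "e \<in> Ep" for e
      using flux_lin_Uh0[OF _ u, of e "-1"] that Ep_facts(2) by (auto simp: uf_def simp del: plus_fun_apply)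
    have "L2_set (flux uf) Ep \<le> Cf * L2_set (\<lambda>K. mu_h \<M> P S c1 K - mu_h \<M> P S c2 K) (Kh \<M>)"
      unfolding uf_def by (intro fb darcy_solution_diff da)
    also have "\<dots> \<le> Cf * (sb * ?n)"
    proof (intro mult_left_mono L2_set_scaled)
      fix K assume K: "K \<in> Kh \<M>"
      have "mu_h \<M> P S c1 K - mu_h \<M> P S c2 K = ?s K * (c1 K - c2 K)" by (simp add: mu_h_def algebra_simps)
      then show "\<bar>mu_h \<M> P S c1 K - mu_h \<M> P S c2 K\<bar> \<le> sb * \<bar>c1 K - c2 K\<bar>"
        using sb(2) K by (simp add: abs_mult mult_right_mono)
    qed (use Cf sb in simp_all)
    finally have flb: "L2_set (flux uf) Ep \<le> Cf * sb * ?n" by simp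
    have c2b: "L2_set c2' (Kh \<M>) \<le> Cc * N / \<zeta>1" by (rule cb[OF zs(3) N st l2 phi2 m2])
    have "L2_set f (Kh \<M>) \<le> (vb / tau P * (Cc * N / \<zeta>1)) * L2_set (\<lambda>K. \<phi>1 K - \<phi>2 K) (Kh \<M>)"
    proof (rule L2_set_scaled)
      fix K assume K: "K \<in> Kh \<M>"
      have "\<bar>c2' K\<bar> \<le> Cc * N / \<zeta>1" using abs_le_L2_set[OF finite_Kh K, of c2'] c2b by linarith
      then have "(\<bar>vol K\<bar> / tau P) * \<bar>c2' K\<bar> \<le> vb / tau P * (Cc * N / \<zeta>1)"
        using vb K tau_pos by (intro mult_mono divide_right_mono) auto
      then have "(\<bar>vol K\<bar> / tau P) * \<bar>c2' K\<bar> * \<bar>\<phi>1 K - \<phi>2 K\<bar> \<le> vb / tau P * (Cc * N / \<zeta>1) * \<bar>\<phi>1 K - \<phi>2 K\<bar>"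
        by (rule mult_right_mono) simp
      moreover have "\<bar>f K\<bar> = (\<bar>vol K\<bar> / tau P) * \<bar>c2' K\<bar> * \<bar>\<phi>1 K - \<phi>2 K\<bar>"
        using tau_pos unfolding f_def abs_minus_cancel abs_divide abs_mult by simp
      ultimately show "\<bar>f K\<bar> \<le> vb / tau P * (Cc * N / \<zeta>1) * \<bar>\<phi>1 K - \<phi>2 K\<bar>" by simp
    qed (use vb tau_pos Cc N1 zs in simp)
    also have "\<dots> \<le> (vb / tau P * (Cc * N / \<zeta>1)) * (Cp / N * ?n)"
      using vb tau_pos Cc N1 zs by (intro mult_left_mono pl[OF N1 g st l1 l2]) simp
    \<comment> \<open>The growth in N of the concentration bound cancels the 1/N of the porosity
      difference, leaving the factor 1/\<zeta>1.\<close>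
    also have "\<dots> = vb / tau P * Cc * Cp / \<zeta>1 * ?n" using N1 by simp
    finally have fbd: "L2_set f (Kh \<M>) \<le> vb / tau P * Cc * Cp / \<zeta>1 * ?n" .
    have "(\<Sum>K\<in>Kh \<M>. vol K * \<phi>1 K / tau P * y K * q K)
        + \<zeta>1 * (\<Sum>e\<in>Ep. (?s (fst e) * y (fst e) - ?s (snd e) * y (snd e)) * (q (fst e) - q (snd e)))
      = (\<Sum>K\<in>Kh \<M>. f K * q K) + (\<Sum>e\<in>Ep. - flux uf e * (q (fst e) - q (snd e)))" for q
    proof -
      have "(\<Sum>K\<in>Kh \<M>. vol K * (\<phi>1 K * c1' K - phi_old S K * c_old S K) / tau P * q K)
        - (\<Sum>K\<in>Kh \<M>. vol K * (\<phi>2 K * c2' K - phi_old S K * c_old S K) / tau P * q K)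
        = (\<Sum>K\<in>Kh \<M>. vol K * \<phi>1 K / tau P * y K * q K) - (\<Sum>K\<in>Kh \<M>. f K * q K)"
        unfolding sum_subtractf[symmetric] f_def y_def
        by (intro sum.cong refl) (simp add: algebra_simps diff_divide_distrib)
      moreover have "(\<Sum>e\<in>Ep. flux uf1 e * (q (fst e) - q (snd e))) - (\<Sum>e\<in>Ep. flux uf2 e * (q (fst e) - q (snd e)))
        = - (\<Sum>e\<in>Ep. - flux uf e * (q (fst e) - q (snd e)))"
        unfolding sum_subtractf[symmetric] sum_negf[symmetric]
        by (intro sum.cong refl) (simp add: fl left_diff_distrib)
      moreover have "\<zeta>1 * (\<Sum>e\<in>Ep. (mu_h \<M> P S c1' (fst e) - mu_h \<M> P S c1' (snd e)) * (q (fst e) - q (snd e)))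
        - \<zeta>1 * (\<Sum>e\<in>Ep. (mu_h \<M> P S c2' (fst e) - mu_h \<M> P S c2' (snd e)) * (q (fst e) - q (snd e)))
        = \<zeta>1 * (\<Sum>e\<in>Ep. (?s (fst e) * y (fst e) - ?s (snd e) * y (snd e)) * (q (fst e) - q (snd e)))"
        unfolding right_diff_distrib[symmetric] sum_subtractf[symmetric]
        by (intro arg_cong2[where f="(*)"] sum.cong refl) (simp add: mu_h_split y_def algebra_simps)
      moreover note m1[unfolded mass_eq_iff, THEN spec, of q] m2[unfolded mass_eq_iff, THEN spec, of q]
      ultimately show ?thesis by linarith
    qed
    then have "L2_set y (Kh \<M>) \<le> Cg * (L2_set f (Kh \<M>) + L2_set (\<lambda>e. - flux uf e) Ep / \<zeta>1)"
      using est[of \<zeta>1 \<phi>1 y f "\<lambda>e. - flux uf e"] zs(2) phi1 by blast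
    also have "\<dots> \<le> Cg * (vb / tau P * Cc * Cp / \<zeta>1 * ?n + Cf * sb * ?n / \<zeta>1)"
      unfolding L2_set_uminus using fbd flb Cg zs by (intro mult_left_mono add_mono divide_right_mono) auto
    also have "\<dots> = (Cg * C1) / \<zeta>1 * ?n" by (simp add: C1_def algebra_simps add_divide_distrib)
    also have "\<dots> \<le> C / \<zeta>1 * ?n"
      using zs Cg Cc by (intro mult_right_mono divide_right_mono) (auto simp: C_def)
    finally show ?thesis unfolding y_def .
  qed
  then show ?thesis using C0 by blast
qed

subsection \<open>Contraction\<close>

lemma C_phi_min_pos: "0 < C_phi_min \<M> S"
  unfolding C_phi_min_def using finite_Kh Kh_nonempty phi_old_bounds by (subst Min_gr_iff) auto

lemma C_mu_min_pos: "0 < C_mu_min \<M> P S"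
  unfolding C_mu_min_def using finite_Kh Kh_nonempty mu_slope_pos by (subst Min_gr_iff) auto

lemma C_lambda_pos: "0 < C_lambda \<M> P S"
  unfolding C_lambda_def using finite_Kh Kh_nonempty inverse_mobility_pos by (subst Min_gr_iff) auto

lemma dist_energy_eq:
  "dist_energy \<M> P S \<zeta>1 r C c d = 3 * C_phi_min \<M> S / 4 * (\<Sum>K\<in>Kh \<M>. vol K * (c K - d K)\<^sup>2)
     + jump_coeff \<M> P S \<zeta>1 r C * (L2_set (\<lambda>e. (c (fst e) - d (fst e)) - (c (snd e) - d (snd e))) Ep)\<^sup>2"
proof -
  have "(\<Sum>K\<in>Kh \<M>. ip_elem K (pc (\<lambda>K. c K - d K) K) (pc (\<lambda>K. c K - d K) K)) = (\<Sum>K\<in>Kh \<M>. vol K * (c K - d K)\<^sup>2)"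
    by (intro sum.cong refl) (simp add: pc_def ip_elem_const power2_eq_square)
  then show ?thesis
    unfolding dist_energy_def Let_def L2_set_power2 penalty_sum by (simp add: power2_eq_square)
qed

text \<open>The lower bound keeps only the volume part, as the jump weight is positive; the upper
  one bounds jumps by values and the jump weight by a multiple of \<zeta>1. Neither a nor b depends
  on \<zeta>1.\<close>

lemma dist_energy_bounds:
  assumes C: "0 < C"
  shows "\<exists>a>0. \<exists>b>0. \<forall>\<zeta>1\<ge>1. 0 < jump_coeff \<M> P S \<zeta>1 r C \<longrightarrow> (\<forall>c d.
     a * (L2_set (\<lambda>K. c K - d K) (Kh \<M>))\<^sup>2 \<le> dist_energy \<M> P S \<zeta>1 r C c d \<and>
     dist_energy \<M> P S \<zeta>1 r C c d \<le> b * \<zeta>1 * (L2_set (\<lambda>K. c K - d K) (Kh \<M>))\<^sup>2)"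
proof -
  obtain va where va: "0 < va" "\<forall>K\<in>Kh \<M>. va \<le> vol K"
    using finite_lower_bound[of "Kh \<M>" vol, OF finite_Kh vol_pos] by blast
  obtain vb where vb: "0 < vb" "\<forall>K\<in>Kh \<M>. \<bar>vol K\<bar> \<le> vb" using finite_upper_bound[of "Kh \<M>" vol, OF finite_Kh] by blast
  define A where "A = 3 * C_phi_min \<M> S / 4"
  define M where "M = C_mu_min \<M> P S"
  define t where "t = 2 * real (card Ep)"
  have A: "0 < A" using C_phi_min_pos by (simp add: A_def)
  have M: "0 < M" using C_mu_min_pos by (simp add: M_def)
  have "A * va * (L2_set (\<lambda>K. c K - d K) (Kh \<M>))\<^sup>2 \<le> dist_energy \<M> P S \<zeta>1 r C c d \<and>
     dist_energy \<M> P S \<zeta>1 r C c d \<le> (A * vb + M * t\<^sup>2) * \<zeta>1 * (L2_set (\<lambda>K. c K - d K) (Kh \<M>))\<^sup>2"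
    if z: "1 \<le> \<zeta>1" and jc: "0 < jump_coeff \<M> P S \<zeta>1 r C" for \<zeta>1 c d
  proof -
    let ?n = "L2_set (\<lambda>K. c K - d K) (Kh \<M>)"
    define V where "V = (\<Sum>K\<in>Kh \<M>. vol K * (c K - d K)\<^sup>2)"
    define J where "J = (L2_set (\<lambda>e. (c (fst e) - d (fst e)) - (c (snd e) - d (snd e))) Ep)\<^sup>2"
    have J0: "0 \<le> J" by (simp add: J_def)
    have E: "dist_energy \<M> P S \<zeta>1 r C c d = A * V + jump_coeff \<M> P S \<zeta>1 r C * J"
      unfolding dist_energy_eq A_def V_def J_def ..
    have "va * ?n\<^sup>2 \<le> V" unfolding L2_set_power2 sum_distrib_left V_def
      using va by (intro sum_mono mult_right_mono) auto
    then have low: "A * va * ?n\<^sup>2 \<le> A * V" using A by (simp add: mult.assoc)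
    have "V \<le> vb * ?n\<^sup>2" unfolding L2_set_power2 sum_distrib_left V_def
      using vb by (intro sum_mono mult_right_mono) auto
    then have "A * V \<le> A * vb * ?n\<^sup>2" using A by (simp add: mult.assoc)
    also have "\<dots> \<le> A * vb * \<zeta>1 * ?n\<^sup>2" using A vb z by (intro mult_right_mono) auto
    finally have up1: "A * V \<le> A * vb * \<zeta>1 * ?n\<^sup>2" .
    have "J \<le> (t * ?n)\<^sup>2" unfolding J_def t_def
      using jump_L2_bound[of "\<lambda>K. c K - d K"] by (intro power_mono) auto
    then have "jump_coeff \<M> P S \<zeta>1 r C * J \<le> jump_coeff \<M> P S \<zeta>1 r C * (t\<^sup>2 * ?n\<^sup>2)"
      using jc by (simp add: power_mult_distrib)
    \<comment> \<open>The subtracted term with \<open>C\<close> is nonnegative and is dropped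
      here.\<close>
    also have "jump_coeff \<M> P S \<zeta>1 r C \<le> \<zeta>1 * M"
      using C C_lambda_pos by (simp add: jump_coeff_def M_def)
    finally have up2: "jump_coeff \<M> P S \<zeta>1 r C * J \<le> M * t\<^sup>2 * \<zeta>1 * ?n\<^sup>2"
      by (simp add: mult_right_mono mult_ac)
    have "0 \<le> jump_coeff \<M> P S \<zeta>1 r C * J" using jc J0 by simp
    then show ?thesis unfolding E using low up1 up2 by (simp add: distrib_right)
  qed
  moreover have "0 < A * va" "0 < A * vb + M * t\<^sup>2"
    using A va(1) vb(1) M by (auto intro!: add_pos_nonneg)
  ultimately show ?thesis by blast
qed

text \<open>The premise \<open>lip\<close> is the Lipschitz estimate for equal old iterates. It
  makes the outcome independent of the chosen solution of the level system, in particular of the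
  kernel part of the displacement.\<close>

lemma iteration_step_unique_exists:
  assumes st: "stable k \<gamma> \<zeta>2" and m: "0 < m" and z: "0 \<le> \<zeta>1"
    and c: "c \<in> iterates \<M> P S \<gamma> \<zeta>2 N m"
    and lip: "\<And>p1 us1 uf1 \<phi>1 c1' p2 us2 uf2 \<phi>2 c2'.
      \<lbrakk>level_system \<M> P S \<gamma> \<zeta>2 N c p1 us1 uf1 \<phi>1; level_system \<M> P S \<gamma> \<zeta>2 N c p2 us2 uf2 \<phi>2;
       \<forall>K\<in>Kh \<M>. m \<le> \<phi>1 K \<and> \<phi>1 K < 1; \<forall>K\<in>Kh \<M>. m \<le> \<phi>2 K \<and> \<phi>2 K < 1;
       mass_eq \<M> P S \<zeta>1 \<phi>1 uf1 c1'; mass_eq \<M> P S \<zeta>1 \<phi>2 uf2 c2'\<rbrakk> \<Longrightarrow>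
       L2_set (\<lambda>K. c1' K - c2' K) (Kh \<M>) \<le> 0"
  shows "\<exists>!c'. iteration_step \<M> P S \<gamma> \<zeta>1 \<zeta>2 N c c'"
proof -
  have bd: "\<forall>K\<in>Kh \<M>. m \<le> \<phi> K \<and> \<phi> K < 1" if "level_system \<M> P S \<gamma> \<zeta>2 N c p us uf \<phi>" for p us uf \<phi>
    using c that unfolding iterates_def by blast
  obtain p us uf \<phi> where lev: "level_system \<M> P S \<gamma> \<zeta>2 N c p us uf \<phi>"
    using level_system_exists[OF st] by blast
  have "0 < \<phi> K" if "K \<in> Kh \<M>" for K using bd[OF lev] m that by force
  then obtain c' where c': "c' \<in> Qh \<M>" "mass_eq \<M> P S \<zeta>1 \<phi> uf c'"
    using mass_eq_exists[OF _ z] by blast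
  show ?thesis
  proof (rule ex1I)
    show "iteration_step \<M> P S \<gamma> \<zeta>1 \<zeta>2 N c c'"
      unfolding iteration_step_def using lev c' by blast
    fix d' assume "iteration_step \<M> P S \<gamma> \<zeta>1 \<zeta>2 N c d'"
    then obtain p2 us2 uf2 \<phi>2 where d': "d' \<in> Qh \<M>" and l2: "level_system \<M> P S \<gamma> \<zeta>2 N c p2 us2 uf2 \<phi>2"
      and m2: "mass_eq \<M> P S \<zeta>1 \<phi>2 uf2 d'"
      unfolding iteration_step_def by blast
    have "L2_set (\<lambda>K. d' K - c' K) (Kh \<M>) \<le> 0"
      by (rule lip[OF l2 lev bd[OF l2] bd[OF lev] m2 c'(2)])
    then have "L2_set (\<lambda>K. d' K - c' K) (Kh \<M>) = 0" by (simp add: order_antisym)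
    then have "\<forall>K\<in>Kh \<M>. d' K - c' K = 0" using finite_Kh by (simp add: L2_set_eq_0_iff)
    then show "d' = c'" using d' c'(1) by (force simp: Qh_def fun_eq_iff)
  qed
qed

lemma contraction:
  assumes C: "0 < C" and m: "0 < m"
  shows "\<exists>\<zeta>1_min>0. \<forall>\<zeta>1\<ge>\<zeta>1_min. \<exists>N_min>0. \<forall>N\<ge>N_min.
         \<exists>\<gamma>_min>0. \<forall>\<gamma>\<ge>\<gamma>_min. \<exists>\<zeta>2_min>0. \<forall>\<zeta>2\<ge>\<zeta>2_min.
           0 < jump_coeff \<M> P S \<zeta>1 \<rho> C \<and>
           (\<forall>c\<in>iterates \<M> P S \<gamma> \<zeta>2 N m. \<exists>!c'. iteration_step \<M> P S \<gamma> \<zeta>1 \<zeta>2 N c c') \<and>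
           (\<exists>C_con. 0 < C_con \<and> C_con < 1 \<and>
             (\<forall>c\<in>iterates \<M> P S \<gamma> \<zeta>2 N m. \<forall>d\<in>iterates \<M> P S \<gamma> \<zeta>2 N m.
                dist_energy \<M> P S \<zeta>1 \<rho> C
                  (Fh \<M> P S \<gamma> \<zeta>1 \<zeta>2 N c) (Fh \<M> P S \<gamma> \<zeta>1 \<zeta>2 N d)
                \<le> C_con * dist_energy \<M> P S \<zeta>1 \<rho> C c d))"
proof -
  obtain k where k: "0 < k" and co: "\<forall>\<gamma>>0. \<exists>Z>0. \<forall>\<zeta>2\<ge>Z. \<forall>v\<in>Vh \<M>.
     k * \<gamma> * (L2_set (\<lambda>K. bdiv (ind K) v) (Kh \<M>))\<^sup>2 \<le> elast \<gamma> \<zeta>2 v v"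
    using elast_coercive by (elim exE conjE) (rule that)
  obtain L where L: "0 < L" and lip0: "\<forall>\<zeta>1\<ge>L. \<forall>N\<ge>\<zeta>1. \<forall>\<gamma>\<ge>N. \<forall>\<zeta>2 c1 p1 us1 uf1 \<phi>1 c1' c2 p2 us2 uf2 \<phi>2 c2'. stable k \<gamma> \<zeta>2 \<longrightarrow>
     level_system \<M> P S \<gamma> \<zeta>2 N c1 p1 us1 uf1 \<phi>1 \<longrightarrow> level_system \<M> P S \<gamma> \<zeta>2 N c2 p2 us2 uf2 \<phi>2 \<longrightarrow>
     (\<forall>K\<in>Kh \<M>. m \<le> \<phi>1 K \<and> \<phi>1 K < 1) \<longrightarrow> (\<forall>K\<in>Kh \<M>. m \<le> \<phi>2 K \<and> \<phi>2 K < 1) \<longrightarrow>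
     mass_eq \<M> P S \<zeta>1 \<phi>1 uf1 c1' \<longrightarrow> mass_eq \<M> P S \<zeta>1 \<phi>2 uf2 c2' \<longrightarrow>
     L2_set (\<lambda>K. c1' K - c2' K) (Kh \<M>) \<le> L / \<zeta>1 * L2_set (\<lambda>K. c1 K - c2 K) (Kh \<M>)"
    using iteration_lipschitz[OF k m] by (elim exE conjE) (rule that)
  note lip = lip0[
    THEN spec, THEN mp, THEN spec, THEN mp, THEN spec, THEN mp, THEN spec, THEN spec, THEN
    spec, THEN spec, THEN spec, THEN spec, THEN spec, THEN spec, THEN spec, THEN spec,
    THEN spec, THEN spec, THEN spec, THEN mp, THEN mp, THEN mp, THEN mp, THEN mp, THEN mp,
    THEN mp]
  obtain a b where a: "0 < a" and b: "0 < b" and en0: "\<forall>\<zeta>1\<ge>1. 0 < jump_coeff \<M> P S \<zeta>1 \<rho> C \<longrightarrow> (\<forall>c d.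
     a * (L2_set (\<lambda>K. c K - d K) (Kh \<M>))\<^sup>2 \<le> dist_energy \<M> P S \<zeta>1 \<rho> C c d \<and>
     dist_energy \<M> P S \<zeta>1 \<rho> C c d \<le> b * \<zeta>1 * (L2_set (\<lambda>K. c K - d K) (Kh \<M>))\<^sup>2)"
    using dist_energy_bounds[OF C, of \<rho>] by (elim exE conjE) (rule that)
  note en = en0[THEN spec, THEN mp, THEN mp, THEN spec, THEN spec]
  \<comment> \<open>The value of \<zeta>1 at which \<open>jump_coeff\<close> changes sign.\<close>
  define J where "J = (\<rho>\<^sup>2 * C / ((beta P)\<^sup>2 * C_lambda \<M> P S)) / C_mu_min \<M> P S"
  have J: "0 \<le> J" unfolding J_def using C C_lambda_pos C_mu_min_pos by (intro divide_nonneg_pos divide_nonneg_nonneg) auto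
  \<comment> \<open>The summands ensure, in turn, \<zeta>1 \<ge> 1, the Lipschitz estimate, a
    positive jump weight, and the contraction factor 1/2.\<close>
  define Z1 where "Z1 = 1 + L + J + 2 * b * L\<^sup>2 / a"
  have last: "0 \<le> 2 * b * L\<^sup>2 / a" using a b by simp
  have Z1: "0 < Z1" using L J last unfolding Z1_def by linarith
  have main: "0 < jump_coeff \<M> P S \<zeta>1 \<rho> C \<and>
           (\<forall>c\<in>iterates \<M> P S \<gamma> \<zeta>2 N m. \<exists>!c'. iteration_step \<M> P S \<gamma> \<zeta>1 \<zeta>2 N c c') \<and>
           (\<exists>C_con. 0 < C_con \<and> C_con < 1 \<and>
             (\<forall>c\<in>iterates \<M> P S \<gamma> \<zeta>2 N m. \<forall>d\<in>iterates \<M> P S \<gamma> \<zeta>2 N m.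
                dist_energy \<M> P S \<zeta>1 \<rho> C
                  (Fh \<M> P S \<gamma> \<zeta>1 \<zeta>2 N c) (Fh \<M> P S \<gamma> \<zeta>1 \<zeta>2 N d)
                \<le> C_con * dist_energy \<M> P S \<zeta>1 \<rho> C c d))"
    if z: "Z1 \<le> \<zeta>1" and N: "\<zeta>1 \<le> N" and g: "N \<le> \<gamma>" and st: "stable k \<gamma> \<zeta>2" for \<zeta>1 N \<gamma> \<zeta>2
  proof -
    have zs: "1 \<le> \<zeta>1" "L \<le> \<zeta>1" "J < \<zeta>1" "2 * b * L\<^sup>2 / a \<le> \<zeta>1"
      using z L J last unfolding Z1_def by linarith+
    have jc: "0 < jump_coeff \<M> P S \<zeta>1 \<rho> C"
      using zs(3)[unfolded J_def pos_divide_less_eq[OF C_mu_min_pos]] unfolding jump_coeff_def by linarith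
    have ex1: "\<exists>!c'. iteration_step \<M> P S \<gamma> \<zeta>1 \<zeta>2 N c c'" if c: "c \<in> iterates \<M> P S \<gamma> \<zeta>2 N m" for c
    proof (rule iteration_step_unique_exists[OF st m _ c])
      show "0 \<le> \<zeta>1" using zs by linarith
      show "L2_set (\<lambda>K. c1' K - c2' K) (Kh \<M>) \<le> 0"
        if "level_system \<M> P S \<gamma> \<zeta>2 N c p1 us1 uf1 \<phi>1" "level_system \<M> P S \<gamma> \<zeta>2 N c p2 us2 uf2 \<phi>2"
          "\<forall>K\<in>Kh \<M>. m \<le> \<phi>1 K \<and> \<phi>1 K < 1" "\<forall>K\<in>Kh \<M>. m \<le> \<phi>2 K \<and> \<phi>2 K < 1"
          "mass_eq \<M> P S \<zeta>1 \<phi>1 uf1 c1'" "mass_eq \<M> P S \<zeta>1 \<phi>2 uf2 c2'"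
        for p1 us1 uf1 \<phi>1 c1' p2 us2 uf2 \<phi>2 c2'
        \<comment> \<open>Both solutions belong to the same c, so the right-hand side of the
          Lipschitz estimate is 0.\<close>
        using lip[OF zs(2) N g st that] by (simp add: L2_set_def)
    qed
    have Fh: "\<exists>p us uf \<phi>. level_system \<M> P S \<gamma> \<zeta>2 N c p us uf \<phi> \<and> (\<forall>K\<in>Kh \<M>. m \<le> \<phi> K \<and> \<phi> K < 1)
        \<and> mass_eq \<M> P S \<zeta>1 \<phi> uf (Fh \<M> P S \<gamma> \<zeta>1 \<zeta>2 N c)" if c: "c \<in> iterates \<M> P S \<gamma> \<zeta>2 N m" for c
    proof -
      have "iteration_step \<M> P S \<gamma> \<zeta>1 \<zeta>2 N c (Fh \<M> P S \<gamma> \<zeta>1 \<zeta>2 N c)"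
        unfolding Fh_def by (rule theI'[OF ex1[OF c]])
      then obtain p us uf \<phi> where lev: "level_system \<M> P S \<gamma> \<zeta>2 N c p us uf \<phi>"
        and mass: "mass_eq \<M> P S \<zeta>1 \<phi> uf (Fh \<M> P S \<gamma> \<zeta>1 \<zeta>2 N c)"
        unfolding iteration_step_def by (elim conjE exE) (rule that)
      have "\<forall>K\<in>Kh \<M>. m \<le> \<phi> K \<and> \<phi> K < 1" using c lev unfolding iterates_def by blast
      with lev mass show ?thesis by (intro exI conjI)
    qed
    have "dist_energy \<M> P S \<zeta>1 \<rho> C (Fh \<M> P S \<gamma> \<zeta>1 \<zeta>2 N c) (Fh \<M> P S \<gamma> \<zeta>1 \<zeta>2 N d)
        \<le> 1 / 2 * dist_energy \<M> P S \<zeta>1 \<rho> C c d"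
      if c: "c \<in> iterates \<M> P S \<gamma> \<zeta>2 N m" and d: "d \<in> iterates \<M> P S \<gamma> \<zeta>2 N m" for c d
    proof -
      let ?n = "L2_set (\<lambda>K. c K - d K) (Kh \<M>)"
      let ?n' = "L2_set (\<lambda>K. Fh \<M> P S \<gamma> \<zeta>1 \<zeta>2 N c K - Fh \<M> P S \<gamma> \<zeta>1 \<zeta>2 N d K) (Kh \<M>)"
      have "?n' \<le> L / \<zeta>1 * ?n"
        using Fh[OF c] Fh[OF d] by (elim exE conjE) (rule lip[OF zs(2) N g st])
      then have "?n'\<^sup>2 \<le> (L / \<zeta>1 * ?n)\<^sup>2" by (rule power_mono) simp
      then have "b * \<zeta>1 * ?n'\<^sup>2 \<le> b * \<zeta>1 * (L / \<zeta>1 * ?n)\<^sup>2" using b zs by (intro mult_left_mono) auto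
      also have "\<dots> = b * L\<^sup>2 / \<zeta>1 * ?n\<^sup>2" using zs by (simp add: power2_eq_square)
      also have "\<dots> \<le> a / 2 * ?n\<^sup>2"
      proof (rule mult_right_mono)
        \<comment> \<open>The energy may inflate the norm by \<open>b * \<zeta>1\<close>, but the
          squared Lipschitz constant gains two powers of 1/\<zeta>1; one is left over and beats the
          ratio of b to a.\<close>
        have "2 * b * L\<^sup>2 \<le> \<zeta>1 * a" using zs(4) a by (simp only: pos_divide_le_eq)
        then show "b * L\<^sup>2 / \<zeta>1 \<le> a / 2" using zs(1) by (simp add: pos_divide_le_eq mult.commute)
      qed simp
      also have "\<dots> \<le> 1 / 2 * dist_energy \<M> P S \<zeta>1 \<rho> C c d" using en[OF zs(1) jc, of c d] by simp
      finally show ?thesis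
        using en[OF zs(1) jc, of "Fh \<M> P S \<gamma> \<zeta>1 \<zeta>2 N c" "Fh \<M> P S \<gamma> \<zeta>1 \<zeta>2 N d"] by linarith
    qed
    then show ?thesis using jc ex1 by (intro conjI exI[of _ "1 / 2"]) auto
  qed
  show ?thesis
  proof (rule nested_thresholds[OF Z1])
    fix \<zeta>1 N \<gamma> assume z: "Z1 \<le> \<zeta>1" and N: "\<zeta>1 \<le> N" and g: "N \<le> \<gamma>"
    have g0: "0 < \<gamma>" using Z1 z N g by linarith
    obtain Z2 where Z2: "0 < Z2" "\<forall>\<zeta>2\<ge>Z2. \<forall>v\<in>Vh \<M>.
      k * \<gamma> * (L2_set (\<lambda>K. bdiv (ind K) v) (Kh \<M>))\<^sup>2 \<le> elast \<gamma> \<zeta>2 v v"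
      using co[rule_format, OF g0] by (elim exE conjE) (rule that)
    then have st: "stable k \<gamma> \<zeta>2" if "Z2 \<le> \<zeta>2" for \<zeta>2
      unfolding stable_def using k g0 that by blast
    show "\<exists>\<zeta>2_min>0. \<forall>\<zeta>2\<ge>\<zeta>2_min.
           0 < jump_coeff \<M> P S \<zeta>1 \<rho> C \<and>
           (\<forall>c\<in>iterates \<M> P S \<gamma> \<zeta>2 N m. \<exists>!c'. iteration_step \<M> P S \<gamma> \<zeta>1 \<zeta>2 N c c') \<and>
           (\<exists>C_con. 0 < C_con \<and> C_con < 1 \<and>
             (\<forall>c\<in>iterates \<M> P S \<gamma> \<zeta>2 N m. \<forall>d\<in>iterates \<M> P S \<gamma> \<zeta>2 N m.
                dist_energy \<M> P S \<zeta>1 \<rho> C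
                  (Fh \<M> P S \<gamma> \<zeta>1 \<zeta>2 N c) (Fh \<M> P S \<gamma> \<zeta>1 \<zeta>2 N d)
                \<le> C_con * dist_energy \<M> P S \<zeta>1 \<rho> C c d))"
      by (rule exI[of _ Z2], rule conjI[OF Z2(1)], intro allI impI) (rule main[OF z N g st])
  qed
qed

end

theorem lemma5p1:
  fixes \<M> :: "('d::finite) mesh" and P :: phys and S :: "'d state"
    and \<sigma>\<^sub>1 \<sigma>\<^sub>2 \<rho>\<^sub>0 \<rho> C m :: real
  assumes "CARD('d) \<in> {2, 3}"
    and "simplicial_mesh \<M>" and "nondegenerate \<sigma>\<^sub>1 \<M>" and "quasi_uniform \<sigma>\<^sub>2 \<M>"
    and "valid_phys P" and "valid_state \<M> S"
    and "0 < \<rho>\<^sub>0" and "\<rho> < 1"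
    and "\<forall>K\<in>Kh \<M>. \<rho>\<^sub>0 \<le> beta P * c_old S K \<and> beta P * c_old S K \<le> \<rho>"
    and "0 < C" and "0 < m" and "m < 1"
  shows "\<exists>\<zeta>1_min>0. \<forall>\<zeta>1\<ge>\<zeta>1_min. \<exists>N_min>0. \<forall>N\<ge>N_min.
         \<exists>\<gamma>_min>0. \<forall>\<gamma>\<ge>\<gamma>_min. \<exists>\<zeta>2_min>0. \<forall>\<zeta>2\<ge>\<zeta>2_min.
           0 < jump_coeff \<M> P S \<zeta>1 \<rho> C \<and>
           (\<forall>c\<in>iterates \<M> P S \<gamma> \<zeta>2 N m. \<exists>!c'. iteration_step \<M> P S \<gamma> \<zeta>1 \<zeta>2 N c c') \<and>
           (\<exists>C_con. 0 < C_con \<and> C_con < 1 \<and>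
             (\<forall>c\<in>iterates \<M> P S \<gamma> \<zeta>2 N m. \<forall>d\<in>iterates \<M> P S \<gamma> \<zeta>2 N m.
                dist_energy \<M> P S \<zeta>1 \<rho> C
                  (Fh \<M> P S \<gamma> \<zeta>1 \<zeta>2 N c) (Fh \<M> P S \<gamma> \<zeta>1 \<zeta>2 N d)
                \<le> C_con * dist_energy \<M> P S \<zeta>1 \<rho> C c d))"
proof -
  interpret linear_iteration \<M> P \<sigma>\<^sub>1 S \<rho>\<^sub>0 \<rho>
    using assms by unfold_locales auto
  show ?thesis using \<open>0 < C\<close> \<open>0 < m\<close> by (rule contraction)
qed

end
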